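(* Let $\mathrm{SU}(3)/\mathbb{T}^2$ be the Wallach flag manifold, where $\mathbb{T}^2\subset\mathrm{SU}(3)$ is the subgroup of diagonal matrices, endowed with the $\mathrm{SU}(3)$-invariant symplectic form $\Omega$ determined by $\omega(X,Y)=\mathrm{tr}\big(X_0[Y,X]\big)$ for $X,Y\in\mathfrak{m}$, with $X_0=\mathrm{diag}(\mathbf{i},-\mathbf{i},0)$. Then the $\mathrm{SU}(3)$-invariant preferred symplectic connection of $\mathrm{SU}(3)/\mathbb{T}^2$ coincides with the natural symplectic connection $\nabla^{\mathbf{s}}$. Moreover, it is Ricci-parallel, i.e. $\nabla^{\mathbf{s}}\mathrm{ric}^{\mathbf{s}}=0$, where $\mathrm{ric}^{\mathbf s}$ is the Ricci curvature tensor of $\nabla^{\mathbf s}$.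
   Context: Put $G=\mathrm{SU}(3)$, $H=\mathbb{T}^2$ (diagonal matrices in $\mathrm{SU}(3)$), with Lie algebras $\mathfrak{g},\mathfrak{h}$. The reductive decomposition used is $\mathfrak{g}=\mathfrak{h}\oplus\mathfrak{m}$, where $\mathfrak{m}$ is the orthogonal complement of $\mathfrak{h}$ for the Killing form, i.e. the space of matrices in $\mathfrak{su}(3)$ with zero diagonal. $T_H(G/H)$ is identified with $\mathfrak{m}$; $\omega$ is the value of $\Omega$ at the base point, and $v_\mathfrak{m}$ is the projection of $v\in\mathfrak{g}$ on $\mathfrak{m}$ along $\mathfrak{h}$. $G$-invariant connections $\nabla$ on $G/H$ correspond one-to-one to $\mathrm{Ad}(H)$-invariant bilinear products $\mathrm{L}:\mathfrak{m}\times\mathfrak{m}\to\mathfrak{m}$ via $\mathrm{L}_x(y)=(\nabla_{x^\#}y^\#-[x^\#,y^\#])_H$, where $x^\#_p=\frac{d}{dt}|_{t=0}\exp(tx)\cdot p$. The natural symplectic connection $\nabla^{\mathbf{s}}$ is the $G$-invariant connection associated with the product $\mathrm{L}^{\mathbf{s}}$ defined by $\omega(\mathrm{L}^{\mathbf{s}}_x(y),z)=\frac13\omega([x,y]_\mathfrak{m},z)+\frac13\omega([x,z]_\mathfrak{m},y)$. A symplectic connection on a symplectic manifold $(M,\Omega)$ is a torsion-free connection $\nabla$ with $\nabla\Omega=0$. Its Ricci tensor is $\mathrm{ric}^\nabla(X,Y)=\mathrm{tr}(Z\mapsto K(X,Z)Y)$, with $K(X,Y)=[\nabla_X,\nabla_Y]-\nabla_{[X,Y]}$.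 It is called preferred if $(\nabla_X\mathrm{ric}^\nabla)(Y,Z)+(\nabla_Z\mathrm{ric}^\nabla)(X,Y)+(\nabla_Y\mathrm{ric}^\nabla)(Z,X)=0$ for all vector fields $X,Y,Z$. It is a known result (Cahen–Gutt–Rawnsley, Lett. Math. Phys. 48 (1999)) that $\mathrm{SU}(3)/\mathbb{T}^2$ admits a unique $\mathrm{SU}(3)$-invariant preferred symplectic connection; this is the connection referred to in the claim. *)

theory Defs
  imports "HOL-Analysis.Analysis"
begin

section \<open>Smooth maps\<close>

primrec C_diff_on :: "nat \<Rightarrow> ('a::euclidean_space \<Rightarrow> 'b::real_normed_vector) \<Rightarrow> 'a set \<Rightarrow> bool" where
  "C_diff_on 0 f S \<longleftrightarrow> continuous_on S f"
| "C_diff_on (Suc k) f S \<longleftrightarrow>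
     (\<forall>x\<in>S. f differentiable (at x)) \<and> (\<forall>v. C_diff_on k (\<lambda>x. frechet_derivative f (at x) v) S)"

definition smooth_on_open :: "('a::euclidean_space \<Rightarrow> 'b::real_normed_vector) \<Rightarrow> 'a set \<Rightarrow> bool" where
  "smooth_on_open f S \<longleftrightarrow> open S \<and> (\<forall>k. C_diff_on k f S)"

text \<open>Smoothness on a subset of a Euclidean space (here: a submanifold), by local extension.\<close>

definition smooth_on_subset :: "('a::euclidean_space \<Rightarrow> 'b::real_normed_vector) \<Rightarrow> 'a set \<Rightarrow> bool" where
  "smooth_on_subset f S \<longleftrightarrow>
     (\<forall>x\<in>S. \<exists>U F. x \<in> U \<and> smooth_on_open F U \<and> (\<forall>y\<in>U \<inter> S. F y = f y))"

section \<open>The groups \<open>SU(3)\<close> and \<open>T\<close>, and their Lie algebras\<close>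

type_synonym cmat = "complex^3^3"

definition ctranspose :: "cmat \<Rightarrow> cmat" where
  "ctranspose A = (\<chi> i j. cnj (A $ j $ i))"

definition SU3 :: "cmat set" where
  "SU3 = {g. ctranspose g ** g = mat 1 \<and> g ** ctranspose g = mat 1 \<and> det g = 1}"

definition torus :: "cmat set" where
  "torus = {h \<in> SU3. \<forall>i j. i \<noteq> j \<longrightarrow> h $ i $ j = 0}"

definition su3 :: "cmat set" where
  "su3 = {x. ctranspose x = - x \<and> trace x = 0}"

definition \<mm> :: "cmat set" where
  "\<mm> = {x \<in> su3. \<forall>i. x $ i $ i = 0}"

text \<open>The projection of \<open>su3\<close> onto \<open>\<mm>\<close> along the diagonal matrices.\<close>

definition proj_m :: "cmat \<Rightarrow> cmat" where
  "proj_m x = (\<chi> i j. if i = j then 0 else x $ i $ j)"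

definition lie :: "cmat \<Rightarrow> cmat \<Rightarrow> cmat" where
  "lie x y = x ** y - y ** x"

definition Ad :: "cmat \<Rightarrow> cmat \<Rightarrow> cmat" where
  "Ad g x = g ** x ** matrix_inv g"

definition mexp :: "cmat \<Rightarrow> cmat" where
  "mexp x = (\<Sum>n. (1 / fact n) *\<^sub>R ((\<lambda>y. x ** y) ^^ n) (mat 1))"

section \<open>The flag manifold \<open>SU(3)/T\<close>\<close>

type_synonym point = "cmat set"

definition coset :: "cmat \<Rightarrow> point" where
  "coset g = (\<lambda>h. g ** h) ` torus"

definition flag :: "point set" where
  "flag = coset ` SU3"

definition base :: point where
  "base = coset (mat 1)"

definition act :: "cmat \<Rightarrow> point \<Rightarrow> point" where
  "act a p = (\<lambda>g. a ** g) ` p"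

text \<open>The smooth structure is the one for which \<open>coset\<close> is a submersion. Values outside
  \<open>flag\<close> are irrelevant.\<close>

definition smooth_fun :: "(point \<Rightarrow> real) \<Rightarrow> bool" where
  "smooth_fun f \<longleftrightarrow> smooth_on_subset (\<lambda>g. f (coset g)) SU3"

text \<open>The isotropy algebra at \<open>p = gT\<close> is \<open>Ad g\<close> of the diagonal subalgebra, so every tangent
  vector at \<open>p\<close> is the velocity at \<open>t = 0\<close> of \<open>t \<mapsto> exp (t v) p\<close> for exactly one \<open>v\<close> in
  \<open>Ad g \<mm>\<close>. The tangent space at \<open>p\<close> is represented by this linear subspace, which depends only
  on \<open>p\<close>; at the base point it is \<open>\<mm>\<close>. A tangent vector acts on functions by differentiation
  along that curve.\<close>

definition tspace :: "point \<Rightarrow> cmat set" where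
  "tspace p = {Ad g x | g x. g \<in> p \<and> x \<in> \<mm>}"

definition dir_deriv :: "cmat \<Rightarrow> (point \<Rightarrow> real) \<Rightarrow> point \<Rightarrow> real" where
  "dir_deriv v f p = deriv (\<lambda>t. f (act (mexp (t *\<^sub>R v)) p)) 0"

section \<open>Vector fields\<close>

text \<open>Vector fields vanish outside \<open>flag\<close>, so that HOL equality is equality of vector fields.\<close>

type_synonym vfield = "point \<Rightarrow> cmat"

definition vector_field :: "vfield \<Rightarrow> bool" where
  "vector_field X \<longleftrightarrow> (\<forall>p\<in>flag. X p \<in> tspace p) \<and> (\<forall>p. p \<notin> flag \<longrightarrow> X p = 0) \<and>
     smooth_on_subset (\<lambda>g. X (coset g)) SU3"

definition vf_app :: "vfield \<Rightarrow> (point \<Rightarrow> real) \<Rightarrow> point \<Rightarrow> real" where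
  "vf_app X f p = dir_deriv (X p) f p"

definition vf_add :: "vfield \<Rightarrow> vfield \<Rightarrow> vfield" where
  "vf_add X Y = (\<lambda>p. X p + Y p)"

definition vf_smult :: "(point \<Rightarrow> real) \<Rightarrow> vfield \<Rightarrow> vfield" where
  "vf_smult f X = (\<lambda>p. f p *\<^sub>R X p)"

definition vf_bracket :: "vfield \<Rightarrow> vfield \<Rightarrow> vfield" where
  "vf_bracket X Y = (THE Z. vector_field Z \<and>
     (\<forall>f. smooth_fun f \<longrightarrow> (\<forall>p\<in>flag. vf_app Z f p = vf_app X (vf_app Y f) p - vf_app Y (vf_app X f) p)))"

text \<open>Push-forward by the diffeomorphism \<open>act a\<close>; it sends the velocity of \<open>t \<mapsto> exp (t v) q\<close> to
  that of \<open>t \<mapsto> a exp (t v) q = exp (t Ad a v) (a q)\<close>, i.e. to \<open>Ad a v\<close>.\<close>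

definition vf_push :: "cmat \<Rightarrow> vfield \<Rightarrow> vfield" where
  "vf_push a X = (\<lambda>p. Ad a (X (act (matrix_inv a) p)))"

text \<open>The vector field \<open>x\<^sup>#\<close>: its value at \<open>p\<close> is the velocity at \<open>t = 0\<close> of \<open>t \<mapsto> exp (t x) p\<close>, that
  is, the tangent vector with the same action on smooth functions.\<close>

definition fundamental :: "cmat \<Rightarrow> vfield" where
  "fundamental x = (\<lambda>p. if p \<in> flag then
       (THE v. v \<in> tspace p \<and>
          (\<forall>f. smooth_fun f \<longrightarrow> dir_deriv v f p = deriv (\<lambda>t. f (act (mexp (t *\<^sub>R x)) p)) 0))
     else 0)"

section \<open>Connections\<close>

text \<open>The last clause only fixes the values on arguments that are not vector fields.\<close>

definition connection :: "(vfield \<Rightarrow> vfield \<Rightarrow> vfield) \<Rightarrow> bool" where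
  "connection D \<longleftrightarrow>
     (\<forall>X Y. vector_field X \<longrightarrow> vector_field Y \<longrightarrow> vector_field (D X Y)) \<and>
     (\<forall>X X' Y. vector_field X \<longrightarrow> vector_field X' \<longrightarrow> vector_field Y \<longrightarrow>
        D (vf_add X X') Y = vf_add (D X Y) (D X' Y)) \<and>
     (\<forall>X Y Y'. vector_field X \<longrightarrow> vector_field Y \<longrightarrow> vector_field Y' \<longrightarrow>
        D X (vf_add Y Y') = vf_add (D X Y) (D X Y')) \<and>
     (\<forall>f X Y. smooth_fun f \<longrightarrow> vector_field X \<longrightarrow> vector_field Y \<longrightarrow>
        D (vf_smult f X) Y = vf_smult f (D X Y)) \<and>
     (\<forall>f X Y. smooth_fun f \<longrightarrow> vector_field X \<longrightarrow> vector_field Y \<longrightarrow>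
        D X (vf_smult f Y) = vf_add (vf_smult (vf_app X f) Y) (vf_smult f (D X Y))) \<and>
     (\<forall>X Y. \<not> (vector_field X \<and> vector_field Y) \<longrightarrow> D X Y = (\<lambda>_. 0))"

definition invariant_connection :: "(vfield \<Rightarrow> vfield \<Rightarrow> vfield) \<Rightarrow> bool" where
  "invariant_connection D \<longleftrightarrow> connection D \<and>
     (\<forall>a X Y. a \<in> SU3 \<longrightarrow> vector_field X \<longrightarrow> vector_field Y \<longrightarrow>
        D (vf_push a X) (vf_push a Y) = vf_push a (D X Y))"

definition torsion_free :: "(vfield \<Rightarrow> vfield \<Rightarrow> vfield) \<Rightarrow> bool" where
  "torsion_free D \<longleftrightarrow> (\<forall>X Y. vector_field X \<longrightarrow> vector_field Y \<longrightarrow>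
     (\<forall>p\<in>flag. D X Y p - D Y X p = vf_bracket X Y p))"

definition curvature :: "(vfield \<Rightarrow> vfield \<Rightarrow> vfield) \<Rightarrow> vfield \<Rightarrow> vfield \<Rightarrow> vfield \<Rightarrow> vfield" where
  "curvature D X Y Z = (\<lambda>p. D X (D Y Z) p - D Y (D X Z) p - D (vf_bracket X Y) Z p)"

text \<open>Trace of a linear endomorphism of a subspace \<open>V\<close> (independent of the basis).\<close>

definition trace_on :: "cmat set \<Rightarrow> (cmat \<Rightarrow> cmat) \<Rightarrow> real" where
  "trace_on V A = (let B = (SOME B. independent B \<and> span B = V)
                   in (\<Sum>b\<in>B. representation B (A b) b))"

text \<open>The curvature is tensorial, so the endomorphism of \<open>tspace p\<close> whose trace is taken can be
  computed with any vector field \<open>Z\<close> extending the tangent vector \<open>z\<close>.\<close>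

definition ricci :: "(vfield \<Rightarrow> vfield \<Rightarrow> vfield) \<Rightarrow> vfield \<Rightarrow> vfield \<Rightarrow> point \<Rightarrow> real" where
  "ricci D X Y p = trace_on (tspace p)
     (\<lambda>z. curvature D X (SOME Z. vector_field Z \<and> Z p = z) Y p)"

text \<open>Covariant derivative of a tensor field of type (0,2).\<close>

definition cov_deriv ::
  "(vfield \<Rightarrow> vfield \<Rightarrow> vfield) \<Rightarrow> (vfield \<Rightarrow> vfield \<Rightarrow> point \<Rightarrow> real)
     \<Rightarrow> vfield \<Rightarrow> vfield \<Rightarrow> vfield \<Rightarrow> point \<Rightarrow> real" where
  "cov_deriv D B X Y Z p = vf_app X (B Y Z) p - B (D X Y) Z p - B Y (D X Z) p"

definition tensor_parallel ::
  "(vfield \<Rightarrow> vfield \<Rightarrow> vfield) \<Rightarrow> (vfield \<Rightarrow> vfield \<Rightarrow> point \<Rightarrow> real) \<Rightarrow> bool" where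
  "tensor_parallel D B \<longleftrightarrow>
     (\<forall>X Y Z. vector_field X \<longrightarrow> vector_field Y \<longrightarrow> vector_field Z \<longrightarrow>
        (\<forall>p\<in>flag. cov_deriv D B X Y Z p = 0))"

definition ricci_parallel :: "(vfield \<Rightarrow> vfield \<Rightarrow> vfield) \<Rightarrow> bool" where
  "ricci_parallel D \<longleftrightarrow> tensor_parallel D (ricci D)"

definition preferred :: "(vfield \<Rightarrow> vfield \<Rightarrow> vfield) \<Rightarrow> bool" where
  "preferred D \<longleftrightarrow>
     (\<forall>X Y Z. vector_field X \<longrightarrow> vector_field Y \<longrightarrow> vector_field Z \<longrightarrow>
        (\<forall>p\<in>flag. cov_deriv D (ricci D) X Y Z p + cov_deriv D (ricci D) Z X Y p
               + cov_deriv D (ricci D) Y Z X p = 0))"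

section \<open>The symplectic form and the natural symplectic connection\<close>

definition X0 :: cmat where
  "X0 = (\<chi> i j. if i = j then (if i = 1 then \<i> else if i = 2 then - \<i> else 0) else 0)"

text \<open>The trace is real for skew-Hermitian arguments.\<close>

definition \<omega> :: "cmat \<Rightarrow> cmat \<Rightarrow> real" where
  "\<omega> x y = Re (trace (X0 ** lie y x))"

text \<open>The invariant form with value \<open>\<omega>\<close> at the base point; \<open>\<omega>\<close> is invariant under \<open>Ad\<close> of
  the torus, so all \<open>g \<in> p\<close> give the same value.\<close>

definition \<Omega> :: "vfield \<Rightarrow> vfield \<Rightarrow> point \<Rightarrow> real" where
  "\<Omega> X Y p = (THE r. \<forall>g\<in>p. r = \<omega> (Ad (matrix_inv g) (X p)) (Ad (matrix_inv g) (Y p)))"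

definition symplectic_connection :: "(vfield \<Rightarrow> vfield \<Rightarrow> vfield) \<Rightarrow> bool" where
  "symplectic_connection D \<longleftrightarrow> connection D \<and> torsion_free D \<and> tensor_parallel D \<Omega>"

text \<open>The product on \<open>\<mm>\<close> associated with a connection.\<close>

definition conn_product :: "(vfield \<Rightarrow> vfield \<Rightarrow> vfield) \<Rightarrow> cmat \<Rightarrow> cmat \<Rightarrow> cmat" where
  "conn_product D x y =
     D (fundamental x) (fundamental y) base - vf_bracket (fundamental x) (fundamental y) base"

definition natural_product :: "cmat \<Rightarrow> cmat \<Rightarrow> cmat" where
  "natural_product x y = (THE u. u \<in> \<mm> \<and>
     (\<forall>z\<in>\<mm>. \<omega> u z = 1/3 * \<omega> (proj_m (lie x y)) z + 1/3 * \<omega> (proj_m (lie x z)) y))"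

definition natural_connection :: "vfield \<Rightarrow> vfield \<Rightarrow> vfield" where
  "natural_connection = (THE D. invariant_connection D \<and>
     (\<forall>x\<in>\<mm>. \<forall>y\<in>\<mm>. conn_product D x y = natural_product x y))"

definition invariant_preferred_symplectic_connection :: "(vfield \<Rightarrow> vfield \<Rightarrow> vfield) \<Rightarrow> bool" where
  "invariant_preferred_symplectic_connection D \<longleftrightarrow>
     invariant_connection D \<and> symplectic_connection D \<and> preferred D"

end

theory Submission
  imports Defs
begin

text \<open>A vector field \<open>X\<close> on \<open>SU(3)/T\<close> is the same as a torus-equivariant map \<open>SU(3) \<rightarrow> \<mm>\<close>,
  \<open>g \<mapsto> Ad(g\<inverse>) X(gT)\<close>. On such maps, an invariant connection acts as the derivative along
  left-invariant fields plus an \<open>Ad(T)\<close>-invariant product \<open>L\<close> on \<open>\<mm>\<close>, and \<open>L\<close> is the product of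
  the paper. Torsion, \<open>\<nabla>\<Omega>\<close>, the Ricci tensor and its covariant derivative thus become algebraic
  expressions in \<open>L\<close>. By invariance under two elements of order 4 of the torus, the torsion-free
  symplectic products form a family with one complex parameter \<open>k\<close>, where \<open>k = 0\<close> is the natural
  product. The Ricci form is diagonal; evaluated on three root vectors, the preferred condition
  reads \<open>Re k (6 + 3/2 |k|\<^sup>2) = 0\<close> and \<open>Im k (4 + 3/2 |k|\<^sup>2) = 0\<close>, so \<open>k = 0\<close>, and for
  \<open>k = 0\<close> the Ricci form \<open>(-8, -4, -4)\<close> is parallel.\<close>

section \<open>Calculus of smooth maps\<close>

text \<open>The objects live on cosets, without charts: smoothness means local extension to open
  sets of matrices, while brackets, fundamental fields and the invariant form are definite
  descriptions. Hence the calculus uses Frechet derivatives of extensions, and explicit test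
  functions must separate tangent vectors to make the descriptions unique. The components of g X0
  g^-1 serve for this, since the diagonal entries of \<open>X0\<close> are distinct. Tensoriality
  comes from finitely many global fields that span every tangent space, in place of cutoff
  functions.

  The elements of order 4 are chosen so that their squares act on the three root spaces by signs. In
  a symmetric trilinear form only the component with one argument from each root space survives, and
  the elements themselves then turn the arguments by fourth roots of unity until a single complex
  number is left.\<close>

lemma frechet_derivative_apply:
  "(f has_derivative f') (at x) \<Longrightarrow> frechet_derivative f (at x) v = f' v"
  using frechet_derivative_at by metis

section \<open>Iterated differentiability and its closure properties\<close>

lemma C_diff_on_SucD:
  "C_diff_on (Suc k) f S \<Longrightarrow> x \<in> S \<Longrightarrow> (f has_derivative frechet_derivative f (at x)) (at x)"
  by (simp add: frechet_derivative_works[symmetric])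

lemma C_diff_on_cong:
  assumes "open S" "\<And>x. x \<in> S \<Longrightarrow> f x = g x" "C_diff_on k f S"
  shows "C_diff_on k g S"
  using assms(2,3)
proof (induction k arbitrary: f g)
  case 0
  then show ?case using continuous_on_cong by fastforce
next
  case (Suc k)
  have d: "(g has_derivative frechet_derivative f (at x)) (at x)" if "x \<in> S" for x
    using has_derivative_transform_within_open[OF C_diff_on_SucD[OF Suc.prems(2) that] assms(1) that]
      Suc.prems(1) by blast
  have "C_diff_on k (\<lambda>x. frechet_derivative g (at x) v) S" for v
    by (rule Suc.IH[of "\<lambda>x. frechet_derivative f (at x) v"])
      (use frechet_derivative_apply[OF d] Suc.prems in auto)
  moreover have "\<forall>x\<in>S. g differentiable at x"
    using d differentiable_def by blast
  ultimately show ?case by simp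
qed

text \<open>The recursive definition speaks of the derivative picked by
  \<open>frechet_derivative\<close>; this form accepts any explicit derivative, so that each closure
  property below is a derivative rule plus induction.\<close>

lemma C_diff_on_SucI:
  assumes "open S" "\<And>x. x \<in> S \<Longrightarrow> (f has_derivative f' x) (at x)" "\<And>v. C_diff_on k (\<lambda>x. f' x v) S"
  shows "C_diff_on (Suc k) f S"
proof -
  have "C_diff_on k (\<lambda>x. frechet_derivative f (at x) v) S" for v
    by (rule C_diff_on_cong[OF assms(1) _ assms(3)[of v]])
      (simp add: frechet_derivative_apply[OF assms(2)])
  then show ?thesis using assms(2) differentiable_def by fastforce
qed

text \<open>Product rules pair the derivative of one factor, of order \<open>k\<close>, with the
  other factor itself, which is known at order \<open>Suc k\<close>.\<close>

lemma C_diff_on_Suc_le: "C_diff_on (Suc k) f S \<Longrightarrow> C_diff_on k f S"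
proof (induction k arbitrary: f)
  case 0
  then show ?case
    by (auto intro!: continuous_at_imp_continuous_on differentiable_imp_continuous_within)
qed auto

lemma C_diff_on_subset: "C_diff_on k f S \<Longrightarrow> T \<subseteq> S \<Longrightarrow> C_diff_on k f T"
  by (induction k arbitrary: f) (auto intro: continuous_on_subset)

lemma C_diff_on_const: "open S \<Longrightarrow> C_diff_on k (\<lambda>_. c) S"
proof (induction k arbitrary: c)
  case (Suc k)
  show ?case by (rule C_diff_on_SucI[where f' = "\<lambda>_ _. 0"]) (use Suc in auto)
qed simp

lemma C_diff_on_add:
  "open S \<Longrightarrow> C_diff_on k f S \<Longrightarrow> C_diff_on k g S \<Longrightarrow> C_diff_on k (\<lambda>x. f x + g x) S"
proof (induction k arbitrary: f g)
  case (Suc k)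
  show ?case
    by (rule C_diff_on_SucI[OF Suc.prems(1) has_derivative_add[OF C_diff_on_SucD[OF Suc.prems(2)]
            C_diff_on_SucD[OF Suc.prems(3)]]])
      (use Suc in auto)
qed (auto intro: continuous_on_add)

lemma C_diff_on_bilinear:
  assumes "bounded_bilinear B"
  shows "open S \<Longrightarrow> C_diff_on k f S \<Longrightarrow> C_diff_on k g S \<Longrightarrow> C_diff_on k (\<lambda>x. B (f x) (g x)) S"
proof (induction k arbitrary: f g)
  case 0
  then show ?case by (simp add: bounded_bilinear.continuous_on[OF assms])
next
  case (Suc k)
  show ?case
    by (rule C_diff_on_SucI[OF Suc.prems(1) bounded_bilinear.FDERIV[OF assms
            C_diff_on_SucD[OF Suc.prems(2)] C_diff_on_SucD[OF Suc.prems(3)]]])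
      (use Suc C_diff_on_Suc_le[OF Suc.prems(2)] C_diff_on_Suc_le[OF Suc.prems(3)] in
        \<open>auto intro!: C_diff_on_add\<close>)
qed

lemma C_diff_on_linear:
  assumes "bounded_linear A"
  shows "open S \<Longrightarrow> C_diff_on k f S \<Longrightarrow> C_diff_on k (\<lambda>x. A (f x)) S"
proof (induction k arbitrary: f)
  case 0
  then show ?case by (simp add: bounded_linear.continuous_on[OF assms])
next
  case (Suc k)
  show ?case
    by (rule C_diff_on_SucI[OF Suc.prems(1) bounded_linear.has_derivative[OF assms
            C_diff_on_SucD[OF Suc.prems(2)]]])
      (use Suc in auto)
qed

lemma C_diff_on_id: "open S \<Longrightarrow> C_diff_on k (\<lambda>x. x) S"
proof (cases k)
  case (Suc n)
  assume "open S"
  then show ?thesis unfolding Suc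
    by (intro C_diff_on_SucI[where f' = "\<lambda>_ v. v"]) (auto intro: C_diff_on_const)
qed (simp add: continuous_on_id)

lemma C_diff_on_compose_linear:
  assumes "bounded_linear A"
  shows "C_diff_on k f S \<Longrightarrow> open S \<Longrightarrow> C_diff_on k (\<lambda>x. f (A x)) (A -` S)"
proof (induction k arbitrary: f)
  case 0
  then show ?case
    using continuous_on_compose2[OF _ linear_continuous_on[OF assms], of S f "A -` S"] by auto
next
  case (Suc k)
  have op: "open (A -` S)"
    using Suc.prems(2) linear_continuous_on[OF assms] open_vimage by blast
  show ?case
  proof (rule C_diff_on_SucI[OF op])
    fix x assume "x \<in> A -` S"
    then show "((\<lambda>x. f (A x)) has_derivative (\<lambda>v. frechet_derivative f (at (A x)) (A v))) (at x)"
      by (intro has_derivative_compose[OF bounded_linear_imp_has_derivative[OF assms]])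
        (use C_diff_on_SucD[OF Suc.prems(1)] in auto)
  next
    fix v
    show "C_diff_on k (\<lambda>x. frechet_derivative f (at (A x)) (A v)) (A -` S)"
      by (rule Suc.IH) (use Suc.prems in auto)
  qed
qed

lemma smooth_on_open_imp_open: "smooth_on_open f S \<Longrightarrow> open S"
  by (simp add: smooth_on_open_def)

lemma smooth_on_open_const: "open S \<Longrightarrow> smooth_on_open (\<lambda>_. c) S"
  by (simp add: smooth_on_open_def C_diff_on_const)

lemma smooth_on_open_add:
  "smooth_on_open f S \<Longrightarrow> smooth_on_open g S \<Longrightarrow> smooth_on_open (\<lambda>x. f x + g x) S"
  by (simp add: smooth_on_open_def C_diff_on_add)

lemma smooth_on_open_sum:
  "finite I \<Longrightarrow> open S \<Longrightarrow> (\<And>i. i \<in> I \<Longrightarrow> smooth_on_open (f i) S) \<Longrightarrow>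
    smooth_on_open (\<lambda>x. \<Sum>i\<in>I. f i x) S"
  by (induction rule: finite_induct) (auto intro: smooth_on_open_add smooth_on_open_const)

lemma smooth_on_open_bilinear:
  "bounded_bilinear B \<Longrightarrow> smooth_on_open f S \<Longrightarrow> smooth_on_open g S \<Longrightarrow>
    smooth_on_open (\<lambda>x. B (f x) (g x)) S"
  by (simp add: smooth_on_open_def C_diff_on_bilinear)

lemma smooth_on_open_linear:
  "bounded_linear A \<Longrightarrow> smooth_on_open f S \<Longrightarrow> smooth_on_open (\<lambda>x. A (f x)) S"
  by (simp add: smooth_on_open_def C_diff_on_linear)

lemma smooth_on_open_compose_linear:
  assumes "bounded_linear A" "smooth_on_open f S"
  shows "smooth_on_open (\<lambda>x. f (A x)) (A -` S)"
  using assms linear_continuous_on[OF assms(1)] open_vimage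
  by (auto simp: smooth_on_open_def C_diff_on_compose_linear)

lemma smooth_on_open_subset: "smooth_on_open f S \<Longrightarrow> open T \<Longrightarrow> T \<subseteq> S \<Longrightarrow> smooth_on_open f T"
  by (auto simp: smooth_on_open_def intro: C_diff_on_subset)

lemma smooth_on_open_has_derivative:
  "smooth_on_open f S \<Longrightarrow> x \<in> S \<Longrightarrow> (f has_derivative frechet_derivative f (at x)) (at x)"
  using C_diff_on_SucD smooth_on_open_def by blast

lemma smooth_on_open_derivative:
  "smooth_on_open f S \<Longrightarrow> smooth_on_open (\<lambda>x. frechet_derivative f (at x) v) S"
  unfolding smooth_on_open_def using C_diff_on.simps(2) by blast

lemma smooth_on_open_continuous: "smooth_on_open f S \<Longrightarrow> continuous_on S f"
  unfolding smooth_on_open_def using C_diff_on.simps(1) by blast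

lemma frechet_derivative_Basis:
  fixes f :: "'a::euclidean_space \<Rightarrow> 'b::real_normed_vector"
  assumes "(f has_derivative f') (at x)"
  shows "f' v = (\<Sum>b\<in>Basis. (v \<bullet> b) *\<^sub>R f' b)"
proof -
  interpret bounded_linear f' using assms by (rule has_derivative_bounded_linear)
  have "f' v = f' (\<Sum>b\<in>Basis. (v \<bullet> b) *\<^sub>R b)" by (simp add: euclidean_representation)
  then show ?thesis by (simp only: sum scaleR)
qed

text \<open>Smoothness is defined through derivatives in fixed directions. A direction that moves
  with the point is expanded in \<open>Basis\<close>, which leaves finitely many fixed directions
  with smooth coefficients.\<close>

lemma smooth_on_open_derivative_along:
  fixes F :: "'a::euclidean_space \<Rightarrow> 'b::real_normed_vector"
  assumes F: "smooth_on_open F S" and u: "smooth_on_open u S"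
  shows "smooth_on_open (\<lambda>x. frechet_derivative F (at x) (u x)) S"
proof -
  have "smooth_on_open (\<lambda>x. \<Sum>b\<in>Basis. (u x \<bullet> b) *\<^sub>R frechet_derivative F (at x) b) S"
    using F by (intro smooth_on_open_sum smooth_on_open_bilinear[OF bounded_bilinear_scaleR]
        smooth_on_open_linear[OF bounded_linear_inner_left u] smooth_on_open_derivative)
      (auto simp: smooth_on_open_imp_open)
  moreover have "(\<Sum>b\<in>Basis. (u x \<bullet> b) *\<^sub>R frechet_derivative F (at x) b)
      = frechet_derivative F (at x) (u x)" if "x \<in> S" for x
    using frechet_derivative_Basis[OF smooth_on_open_has_derivative[OF F that]] by metis
  ultimately show ?thesis
    unfolding smooth_on_open_def
    using C_diff_on_cong[OF smooth_on_open_imp_open[OF F],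
        where f = "\<lambda>x. \<Sum>b\<in>Basis. (u x \<bullet> b) *\<^sub>R frechet_derivative F (at x) b"]
    by simp
qed

text \<open>Product rule for evaluating the derivative at a moving direction: one term from the
  direction, one from the base point with the direction frozen.\<close>

lemma has_derivative_along:
  fixes F :: "'a::euclidean_space \<Rightarrow> 'b::real_normed_vector"
  assumes F: "smooth_on_open F S" and x: "x \<in> S" and u: "(u has_derivative u') (at x)"
  shows "((\<lambda>y. frechet_derivative F (at y) (u y)) has_derivative
    (\<lambda>h. frechet_derivative F (at x) (u' h) +
         frechet_derivative (\<lambda>y. frechet_derivative F (at y) (u x)) (at x) h)) (at x)"
proof -
  define D where "D v y = frechet_derivative F (at y) v" for v y
  define D2 where "D2 v = frechet_derivative (D v) (at x)" for v
  have FD: "(F has_derivative (\<lambda>v. D v y)) (at y)" if "y \<in> S" for y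
    using smooth_on_open_has_derivative[OF F that] by (simp add: D_def)
  have DB: "D v y = (\<Sum>b\<in>Basis. (v \<bullet> b) *\<^sub>R D b y)" if "y \<in> S" for v y
    using frechet_derivative_Basis[OF FD[OF that], of v] by (simp add: D_def)
  have DD: "(D v has_derivative D2 v) (at x)" for v
    using smooth_on_open_has_derivative[OF smooth_on_open_derivative[OF F] x]
    by (simp add: D_def[abs_def] D2_def)
  have D2B: "D2 v h = (\<Sum>b\<in>Basis. (v \<bullet> b) *\<^sub>R D2 b h)" for v h
  proof -
    have "((\<lambda>y. \<Sum>b\<in>Basis. (v \<bullet> b) *\<^sub>R D b y) has_derivative
        (\<lambda>h. \<Sum>b\<in>Basis. (v \<bullet> b) *\<^sub>R D2 b h)) (at x)"
      by (intro has_derivative_sum has_derivative_scaleR_right DD)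
    then have "(D v has_derivative (\<lambda>h. \<Sum>b\<in>Basis. (v \<bullet> b) *\<^sub>R D2 b h)) (at x)"
      by (rule has_derivative_transform_within_open[OF _ smooth_on_open_imp_open[OF F] x])
        (use DB in metis)
    then show ?thesis using has_derivative_unique[OF DD] by metis
  qed
  have "((\<lambda>y. \<Sum>b\<in>Basis. (u y \<bullet> b) *\<^sub>R D b y) has_derivative
      (\<lambda>h. \<Sum>b\<in>Basis. (u x \<bullet> b) *\<^sub>R D2 b h + (u' h \<bullet> b) *\<^sub>R D b x)) (at x)"
    by (intro has_derivative_sum has_derivative_scaleR has_derivative_inner_left u DD)
  moreover have "(\<lambda>h. \<Sum>b\<in>Basis. (u x \<bullet> b) *\<^sub>R D2 b h + (u' h \<bullet> b) *\<^sub>R D b x)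
      = (\<lambda>h. D (u' h) x + D2 (u x) h)"
    unfolding D2B[of "u x"] DB[OF x, of "u' _"] by (simp add: sum.distrib add.commute)
  ultimately have "((\<lambda>y. \<Sum>b\<in>Basis. (u y \<bullet> b) *\<^sub>R D b y) has_derivative
      (\<lambda>h. D (u' h) x + D2 (u x) h)) (at x)" by simp
  then have "((\<lambda>y. D (u y) y) has_derivative (\<lambda>h. D (u' h) x + D2 (u x) h)) (at x)"
    by (rule has_derivative_transform_within_open[OF _ smooth_on_open_imp_open[OF F] x])
      (use DB in metis)
  then show ?thesis by (simp add: D_def[abs_def] D2_def)
qed

section \<open>Symmetry of second derivatives\<close>

text \<open>Two applications of the mean value theorem: along \<open>u\<close> to the difference of
  \<open>F\<close> on the two sides of the parallelogram parallel to \<open>u\<close>, then along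
  \<open>v\<close> to \<open>Fu\<close> at the intermediate point.\<close>

lemma second_difference_mvt:
  fixes F :: "'a::euclidean_space \<Rightarrow> real"
  assumes F: "smooth_on_open F (ball g r)" and s: "s > 0" "s * (norm u + norm v) < r"
  shows "\<exists>p\<in>cball g (s * (norm u + norm v)).
    F (g + s *\<^sub>R u + s *\<^sub>R v) - F (g + s *\<^sub>R u) - F (g + s *\<^sub>R v) + F g
      = s * s * frechet_derivative (\<lambda>y. frechet_derivative F (at y) u) (at p) v"
proof -
  define Fu where "Fu y = frechet_derivative F (at y) u" for y
  have Fus: "smooth_on_open Fu (ball g r)"
    using smooth_on_open_derivative[OF F] by (simp add: Fu_def[abs_def])
  have inb: "g + t *\<^sub>R u + t' *\<^sub>R v \<in> cball g (s * (norm u + norm v))"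
    if "0 \<le> t" "t \<le> s" "0 \<le> t'" "t' \<le> s" for t t'
  proof -
    have "norm (t *\<^sub>R u + t' *\<^sub>R v) \<le> t * norm u + t' * norm v"
      using norm_triangle_ineq[of "t *\<^sub>R u" "t' *\<^sub>R v"] that by simp
    also have "\<dots> \<le> s * (norm u + norm v)"
      using that by (simp add: distrib_left add_mono mult_right_mono)
    finally show ?thesis by (simp add: dist_norm norm_minus_commute algebra_simps)
  qed
  have inb': "g + t *\<^sub>R u + t' *\<^sub>R v \<in> ball g r"
    if "0 \<le> t" "t \<le> s" "0 \<le> t'" "t' \<le> s" for t t'
    using inb[OF that] s(2) by auto
  \<comment> \<open>The term \<open>0 *\<^sub>R v\<close> is kept so that both summands are
    instances of \<open>cu\<close>.\<close>
  define \<phi> where "\<phi> t = F (g + t *\<^sub>R u + s *\<^sub>R v) - F (g + t *\<^sub>R u + 0 *\<^sub>R v)" for t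
  have cu: "((\<lambda>t. F (g + t *\<^sub>R u + t' *\<^sub>R v)) has_real_derivative Fu (g + t *\<^sub>R u + t' *\<^sub>R v)) (at t)"
    if "0 \<le> t" "t \<le> s" "0 \<le> t'" "t' \<le> s" for t t'
  proof -
    have "((\<lambda>t. g + t *\<^sub>R u + t' *\<^sub>R v) has_derivative (\<lambda>h. h *\<^sub>R u)) (at t)"
      by (auto intro!: derivative_eq_intros)
    from has_derivative_compose[OF this smooth_on_open_has_derivative[OF F inb'[OF that]]]
    show ?thesis
      unfolding has_field_derivative_def Fu_def
      using linear_scale[OF has_derivative_linear[OF smooth_on_open_has_derivative[OF F inb'[OF that]]]]
      by (simp add: mult_commute_abs)
  qed
  have "\<exists>z. 0 < z \<and> z < s \<and> \<phi> s - \<phi> 0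
      = (s - 0) * (Fu (g + z *\<^sub>R u + s *\<^sub>R v) - Fu (g + z *\<^sub>R u + 0 *\<^sub>R v))"
    unfolding \<phi>_def
    by (rule MVT2[OF s(1)]) (intro DERIV_diff cu, use s in auto)
  then obtain z where z: "0 < z" "z < s" and e1: "\<phi> s - \<phi> 0
      = s * (Fu (g + z *\<^sub>R u + s *\<^sub>R v) - Fu (g + z *\<^sub>R u + 0 *\<^sub>R v))" by auto
  have cv: "((\<lambda>t. Fu (g + z *\<^sub>R u + t *\<^sub>R v)) has_real_derivative
      frechet_derivative Fu (at (g + z *\<^sub>R u + t *\<^sub>R v)) v) (at t)" if "0 \<le> t" "t \<le> s" for t
  proof -
    have m: "g + z *\<^sub>R u + t *\<^sub>R v \<in> ball g r" by (rule inb') (use that z in auto)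
    have "((\<lambda>t. g + z *\<^sub>R u + t *\<^sub>R v) has_derivative (\<lambda>h. h *\<^sub>R v)) (at t)"
      by (auto intro!: derivative_eq_intros)
    from has_derivative_compose[OF this smooth_on_open_has_derivative[OF Fus m]]
    show ?thesis
      unfolding has_field_derivative_def
      using linear_scale[OF has_derivative_linear[OF smooth_on_open_has_derivative[OF Fus m]]]
      by (simp add: mult_commute_abs)
  qed
  have "\<exists>w. 0 < w \<and> w < s \<and> Fu (g + z *\<^sub>R u + s *\<^sub>R v) - Fu (g + z *\<^sub>R u + 0 *\<^sub>R v)
      = (s - 0) * frechet_derivative Fu (at (g + z *\<^sub>R u + w *\<^sub>R v)) v"
    by (rule MVT2[OF s(1)]) (use cv in auto)
  then obtain w where w: "0 < w" "w < s" and e2: "Fu (g + z *\<^sub>R u + s *\<^sub>R v) - Fu (g + z *\<^sub>R u + 0 *\<^sub>R v)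
      = s * frechet_derivative Fu (at (g + z *\<^sub>R u + w *\<^sub>R v)) v" by auto
  show ?thesis
  proof (rule bexI)
    show "g + z *\<^sub>R u + w *\<^sub>R v \<in> cball g (s * (norm u + norm v))"
      by (rule inb) (use z w in auto)
    show "F (g + s *\<^sub>R u + s *\<^sub>R v) - F (g + s *\<^sub>R u) - F (g + s *\<^sub>R v) + F g = s * s *
      frechet_derivative (\<lambda>y. frechet_derivative F (at y) u) (at (g + z *\<^sub>R u + w *\<^sub>R v)) v"
      using e1 unfolding e2 by (simp add: \<phi>_def Fu_def[abs_def] mult.assoc)
  qed
qed

text \<open>The second difference is symmetric in \<open>u\<close> and \<open>v\<close>, so the two
  mixed derivatives agree at two points arbitrarily close to \<open>g\<close>; continuity gives
  equality at \<open>g\<close>.\<close>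

lemma second_derivative_symmetric_real:
  fixes F :: "'a::euclidean_space \<Rightarrow> real"
  assumes F: "smooth_on_open F S" and g: "g \<in> S"
  shows "frechet_derivative (\<lambda>y. frechet_derivative F (at y) u) (at g) v
    = frechet_derivative (\<lambda>y. frechet_derivative F (at y) v) (at g) u"
proof -
  define A where "A u v p = frechet_derivative (\<lambda>y. frechet_derivative F (at y) u) (at p) v" for u v p
  obtain r where r: "r > 0" "ball g r \<subseteq> S"
    using smooth_on_open_imp_open[OF F] g open_contains_ball by blast
  have Fb: "smooth_on_open F (ball g r)"
    using smooth_on_open_subset[OF F open_ball r(2)] .
  have contA: "isCont (A u v) g" for u v
  proof -
    have "continuous_on S (A u v)"
      using smooth_on_open_continuous[OF smooth_on_open_derivative[OF smooth_on_open_derivative[OF F]]]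
      by (simp add: A_def[abs_def])
    then show ?thesis
      using continuous_on_eq_continuous_at smooth_on_open_imp_open[OF F] g by blast
  qed
  have "\<bar>A u v g - A v u g\<bar> < e" if e: "e > 0" for e
  proof -
    obtain d1 where d1: "d1 > 0" "\<And>p. dist p g < d1 \<Longrightarrow> dist (A u v p) (A u v g) < e/2"
      using contA[of u v] e unfolding continuous_at_eps_delta by (metis half_gt_zero)
    obtain d2 where d2: "d2 > 0" "\<And>p. dist p g < d2 \<Longrightarrow> dist (A v u p) (A v u g) < e/2"
      using contA[of v u] e unfolding continuous_at_eps_delta by (metis half_gt_zero)
    define d where "d = min r (min d1 d2)"
    \<comment> \<open>The summand 1 keeps the denominator positive for \<open>u = v = 0\<close> and
      makes \<open>s * (norm u + norm v)\<close> strictly less than \<open>d\<close>.\<close>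
    define s where "s = d / (norm u + norm v + 1)"
    have n: "norm u + norm v + 1 > 0" by (smt (verit) norm_ge_zero)
    have d0: "d > 0" using r d1 d2 by (simp add: d_def)
    have s0: "s > 0" using n d0 by (simp add: s_def)
    have sd: "s * (norm u + norm v) < d"
      using n d0 by (simp add: s_def divide_simps)
    have "s * (norm u + norm v) < r" using sd by (simp add: d_def)
    from second_difference_mvt[OF Fb s0 this]
    obtain p where p: "p \<in> cball g (s * (norm u + norm v))"
      and ep: "F (g + s *\<^sub>R u + s *\<^sub>R v) - F (g + s *\<^sub>R u) - F (g + s *\<^sub>R v) + F g = s * s * A u v p"
      unfolding A_def by blast
    have "s * (norm v + norm u) < r" using sd by (simp add: d_def add.commute)
    from second_difference_mvt[OF Fb s0 this]
    obtain q where q: "q \<in> cball g (s * (norm u + norm v))"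
      and eq: "F (g + s *\<^sub>R v + s *\<^sub>R u) - F (g + s *\<^sub>R v) - F (g + s *\<^sub>R u) + F g = s * s * A v u q"
      unfolding A_def by (auto simp: add.commute)
    have "s * s * A u v p = s * s * A v u q"
      using ep eq by (simp add: algebra_simps)
    then have pq: "A u v p = A v u q" using s0 by simp
    have "dist (A u v p) (A u v g) < e/2"
      by (rule d1(2)) (use p sd in \<open>auto simp: d_def dist_commute\<close>)
    moreover have "dist (A v u q) (A v u g) < e/2"
      by (rule d2(2)) (use q sd in \<open>auto simp: d_def dist_commute\<close>)
    ultimately show ?thesis using pq unfolding dist_real_def by linarith
  qed
  then have "A u v g = A v u g"
    using zero_less_abs_iff[of "A u v g - A v u g"] by (metis eq_iff_diff_eq_0 less_irrefl)
  then show ?thesis by (simp add: A_def)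
qed

lemma second_derivative_symmetric:
  fixes F :: "'a::euclidean_space \<Rightarrow> 'b::euclidean_space"
  assumes F: "smooth_on_open F S" and g: "g \<in> S"
  shows "frechet_derivative (\<lambda>y. frechet_derivative F (at y) u) (at g) v
    = frechet_derivative (\<lambda>y. frechet_derivative F (at y) v) (at g) u"
proof (rule euclidean_eqI)
  fix b :: 'b
  assume "b \<in> Basis"
  have Fb: "smooth_on_open (\<lambda>y. F y \<bullet> b) S"
    by (rule smooth_on_open_linear[OF bounded_linear_inner_left F])
  have 1: "frechet_derivative (\<lambda>y. F y \<bullet> b) (at y) w = frechet_derivative F (at y) w \<bullet> b"
    if "y \<in> S" for y w
    by (rule frechet_derivative_apply)
      (intro has_derivative_inner_left smooth_on_open_has_derivative[OF F that])
  have 2: "frechet_derivative (\<lambda>y. frechet_derivative (\<lambda>y. F y \<bullet> b) (at y) w) (at g) z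
      = frechet_derivative (\<lambda>y. frechet_derivative F (at y) w) (at g) z \<bullet> b" for w z
  proof (rule frechet_derivative_apply)
    have "((\<lambda>y. frechet_derivative F (at y) w \<bullet> b) has_derivative
        (\<lambda>z. frechet_derivative (\<lambda>y. frechet_derivative F (at y) w) (at g) z \<bullet> b)) (at g)"
      by (intro has_derivative_inner_left smooth_on_open_has_derivative[OF smooth_on_open_derivative[OF F] g])
    then show "((\<lambda>y. frechet_derivative (\<lambda>y. F y \<bullet> b) (at y) w) has_derivative
        (\<lambda>z. frechet_derivative (\<lambda>y. frechet_derivative F (at y) w) (at g) z \<bullet> b)) (at g)"
      by (rule has_derivative_transform_within_open[OF _ smooth_on_open_imp_open[OF F] g])
        (simp add: 1)
  qed
  show "frechet_derivative (\<lambda>y. frechet_derivative F (at y) u) (at g) v \<bullet> b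
    = frechet_derivative (\<lambda>y. frechet_derivative F (at y) v) (at g) u \<bullet> b"
    using second_derivative_symmetric_real[OF Fb g, of u v] unfolding 2 .
qed

subsection \<open>Smooth maps on a subset\<close>

lemma smooth_on_subsetE:
  assumes "smooth_on_subset f S" "x \<in> S"
  obtains U F where "x \<in> U" "smooth_on_open F U" "\<And>y. y \<in> U \<inter> S \<Longrightarrow> F y = f y"
  using assms unfolding smooth_on_subset_def by metis

lemma smooth_on_subset_cong:
  "(\<And>x. x \<in> S \<Longrightarrow> f x = g x) \<Longrightarrow> smooth_on_subset f S \<Longrightarrow> smooth_on_subset g S"
  unfolding smooth_on_subset_def by fastforce

lemma smooth_on_subset_restrict: "smooth_on_open f UNIV \<Longrightarrow> smooth_on_subset f S"
  unfolding smooth_on_subset_def by blast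

lemma smooth_on_subset_const: "smooth_on_subset (\<lambda>_. c) S"
  by (simp add: smooth_on_subset_restrict smooth_on_open_const)

lemma smooth_on_subset_id: "smooth_on_subset (\<lambda>x. x) S"
  by (rule smooth_on_subset_restrict) (simp add: smooth_on_open_def C_diff_on_id)

lemma smooth_on_subset_linear:
  assumes "bounded_linear A" "smooth_on_subset f S"
  shows "smooth_on_subset (\<lambda>x. A (f x)) S"
  unfolding smooth_on_subset_def
proof
  fix x assume "x \<in> S"
  then obtain U F where "x \<in> U" "smooth_on_open F U" "\<And>y. y \<in> U \<inter> S \<Longrightarrow> F y = f y"
    using smooth_on_subsetE[OF assms(2)] by metis
  then show "\<exists>U F. x \<in> U \<and> smooth_on_open F U \<and> (\<forall>y\<in>U \<inter> S. F y = A (f y))"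
    using smooth_on_open_linear[OF assms(1)]
    by (intro exI[of _ U] exI[of _ "\<lambda>x. A (F x)"]) auto
qed

lemma smooth_on_subset_bilinear:
  assumes "bounded_bilinear B" "smooth_on_subset f S" "smooth_on_subset g S"
  shows "smooth_on_subset (\<lambda>x. B (f x) (g x)) S"
  unfolding smooth_on_subset_def
proof
  fix x assume x: "x \<in> S"
  obtain U F where U: "x \<in> U" "smooth_on_open F U" "\<And>y. y \<in> U \<inter> S \<Longrightarrow> F y = f y"
    using smooth_on_subsetE[OF assms(2) x] by metis
  obtain V G where V: "x \<in> V" "smooth_on_open G V" "\<And>y. y \<in> V \<inter> S \<Longrightarrow> G y = g y"
    using smooth_on_subsetE[OF assms(3) x] by metis
  have op: "open (U \<inter> V)"
    by (rule open_Int[OF smooth_on_open_imp_open[OF U(2)] smooth_on_open_imp_open[OF V(2)]])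
  show "\<exists>U F. x \<in> U \<and> smooth_on_open F U \<and> (\<forall>y\<in>U \<inter> S. F y = B (f y) (g y))"
    using U(1,3) V(1,3) smooth_on_open_bilinear[OF assms(1)
        smooth_on_open_subset[OF U(2) op Int_lower1] smooth_on_open_subset[OF V(2) op Int_lower2]]
    by (intro exI[of _ "U \<inter> V"] exI[of _ "\<lambda>x. B (F x) (G x)"]) auto
qed

lemma smooth_on_subset_add:
  assumes "smooth_on_subset f S" "smooth_on_subset g S"
  shows "smooth_on_subset (\<lambda>x. f x + g x) S"
  unfolding smooth_on_subset_def
proof
  fix x assume x: "x \<in> S"
  obtain U F where U: "x \<in> U" "smooth_on_open F U" "\<And>y. y \<in> U \<inter> S \<Longrightarrow> F y = f y"
    using smooth_on_subsetE[OF assms(1) x] by metis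
  obtain V G where V: "x \<in> V" "smooth_on_open G V" "\<And>y. y \<in> V \<inter> S \<Longrightarrow> G y = g y"
    using smooth_on_subsetE[OF assms(2) x] by metis
  have op: "open (U \<inter> V)"
    by (rule open_Int[OF smooth_on_open_imp_open[OF U(2)] smooth_on_open_imp_open[OF V(2)]])
  show "\<exists>U F. x \<in> U \<and> smooth_on_open F U \<and> (\<forall>y\<in>U \<inter> S. F y = f y + g y)"
    using U(1,3) V(1,3) smooth_on_open_add[OF
        smooth_on_open_subset[OF U(2) op Int_lower1] smooth_on_open_subset[OF V(2) op Int_lower2]]
    by (intro exI[of _ "U \<inter> V"] exI[of _ "\<lambda>x. F x + G x"]) auto
qed

lemma smooth_on_subset_diff:
  fixes f :: "'a::euclidean_space \<Rightarrow> 'b::real_normed_vector"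
  assumes "smooth_on_subset f S" "smooth_on_subset g S"
  shows "smooth_on_subset (\<lambda>x. f x - g x) S"
  using smooth_on_subset_add[OF assms(1) smooth_on_subset_linear[OF
      bounded_linear_minus[OF bounded_linear_ident] assms(2)]] by simp

lemma smooth_on_subset_compose_linear:
  assumes "bounded_linear A" "A ` S \<subseteq> S" "smooth_on_subset f S"
  shows "smooth_on_subset (\<lambda>x. f (A x)) S"
  unfolding smooth_on_subset_def
proof
  fix x assume "x \<in> S"
  then obtain U F where "A x \<in> U" "smooth_on_open F U" "\<And>y. y \<in> U \<inter> S \<Longrightarrow> F y = f y"
    using smooth_on_subsetE[OF assms(3), of "A x"] assms(2) by blast
  then show "\<exists>U F. x \<in> U \<and> smooth_on_open F U \<and> (\<forall>y\<in>U \<inter> S. F y = f (A y))"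
    using smooth_on_open_compose_linear[OF assms(1)] assms(2)
    by (intro exI[of _ "A -` U"] exI[of _ "\<lambda>x. F (A x)"]) auto
qed

section \<open>Matrices, the groups and the exponential\<close>

lemma mm_nth: "(A ** B) $ i $ j = (\<Sum>k\<in>UNIV. A $ i $ k * B $ k $ j)"
  by (simp add: matrix_matrix_mult_def)

lemma bounded_bilinear_mm: "bounded_bilinear ((**) :: cmat \<Rightarrow> cmat \<Rightarrow> cmat)"
  unfolding bilinear_conv_bounded_bilinear[symmetric] bilinear_def
  by (auto intro!: linearI simp: vec_eq_iff mm_nth algebra_simps sum.distrib scaleR_sum_right)

lemmas mm_add_left = bounded_bilinear.add_left[OF bounded_bilinear_mm]
  and mm_add_right = bounded_bilinear.add_right[OF bounded_bilinear_mm]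
  and mm_diff_left = bounded_bilinear.diff_left[OF bounded_bilinear_mm]
  and mm_diff_right = bounded_bilinear.diff_right[OF bounded_bilinear_mm]
  and mm_minus_left = bounded_bilinear.minus_left[OF bounded_bilinear_mm]
  and mm_minus_right = bounded_bilinear.minus_right[OF bounded_bilinear_mm]
  and mm_scaleR_left = bounded_bilinear.scaleR_left[OF bounded_bilinear_mm]
  and mm_scaleR_right = bounded_bilinear.scaleR_right[OF bounded_bilinear_mm]
  and mm_zero_left = bounded_bilinear.zero_left[OF bounded_bilinear_mm]
  and mm_zero_right = bounded_bilinear.zero_right[OF bounded_bilinear_mm]

lemmas mm_simps = mm_add_left mm_add_right mm_diff_left mm_diff_right mm_minus_left mm_minus_right
  mm_scaleR_left mm_scaleR_right mm_zero_left mm_zero_right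

lemma scaleR_mat_nth: "(r *\<^sub>R A) $ i $ j = of_real r * (A :: cmat) $ i $ j"
  by (simp add: scaleR_conv_of_real[symmetric])

lemma ct_nth [simp]: "ctranspose A $ i $ j = cnj (A $ j $ i)"
  by (simp add: ctranspose_def)

lemma ct_ct [simp]: "ctranspose (ctranspose A) = A"
  by (simp add: vec_eq_iff)

lemma ct_mm: "ctranspose (A ** B) = ctranspose B ** ctranspose A"
  by (simp add: vec_eq_iff mm_nth mult.commute)

lemma bounded_linear_ct: "bounded_linear ctranspose"
  unfolding linear_conv_bounded_linear[symmetric]
  by (auto intro!: linearI simp: vec_eq_iff)

lemmas ct_simps = linear_add[OF bounded_linear.linear[OF bounded_linear_ct]]
  linear_diff[OF bounded_linear.linear[OF bounded_linear_ct]]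
  linear_neg[OF bounded_linear.linear[OF bounded_linear_ct]]
  linear_scale[OF bounded_linear.linear[OF bounded_linear_ct]]
  linear_0[OF bounded_linear.linear[OF bounded_linear_ct]]

lemma ct_mat1 [simp]: "ctranspose (mat 1) = mat 1"
  by (auto simp: vec_eq_iff mat_def)

lemma det_ct: "det (ctranspose (A :: cmat)) = cnj (det A)"
  by (simp add: det_3 algebra_simps)

lemma SU3_ct_mm: "g \<in> SU3 \<Longrightarrow> ctranspose g ** g = mat 1"
  and SU3_mm_ct: "g \<in> SU3 \<Longrightarrow> g ** ctranspose g = mat 1"
  by (simp_all add: SU3_def)

lemma SU3_mm_ct_cancel: "g \<in> SU3 \<Longrightarrow> g ** (ctranspose g ** x) = x"
  by (simp add: matrix_mul_assoc SU3_mm_ct)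

lemma SU3_one [simp]: "mat 1 \<in> SU3"
  by (simp add: SU3_def)

lemma SU3_mult: assumes "g \<in> SU3" "h \<in> SU3" shows "g ** h \<in> SU3"
proof -
  have "ctranspose (g ** h) ** (g ** h) = ctranspose h ** (ctranspose g ** g) ** h"
    by (simp add: ct_mm matrix_mul_assoc)
  moreover have "(g ** h) ** ctranspose (g ** h) = g ** (h ** ctranspose h) ** ctranspose g"
    by (simp add: ct_mm matrix_mul_assoc)
  ultimately show ?thesis
    using assms by (simp add: SU3_def det_mul)
qed

lemma SU3_ct: "g \<in> SU3 \<Longrightarrow> ctranspose g \<in> SU3"
  by (simp add: SU3_def det_ct)

lemma SU3_inv: assumes "g \<in> SU3" shows "matrix_inv g = ctranspose g"
proof -
  have "g ** matrix_inv g = mat 1 \<and> matrix_inv g ** g = mat 1"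
    unfolding matrix_inv_def
    by (rule someI[of _ "ctranspose g"]) (simp add: SU3_ct_mm SU3_mm_ct assms)
  then have "matrix_inv g = (ctranspose g ** g) ** matrix_inv g"
    by (simp add: SU3_ct_mm assms)
  also have "\<dots> = ctranspose g"
    by (simp add: matrix_mul_assoc[symmetric] \<open>g ** matrix_inv g = mat 1 \<and> _\<close>)
  finally show ?thesis .
qed

lemma torus_SU3: "h \<in> torus \<Longrightarrow> h \<in> SU3"
  by (simp add: torus_def)

lemma torus_one [simp]: "mat 1 \<in> torus"
  by (simp add: torus_def) (simp add: mat_def)

lemma torus_mm_nth: "h \<in> torus \<Longrightarrow> (h ** A) $ i $ j = h $ i $ i * A $ i $ j"
  unfolding mm_nth by (subst sum.remove[of _ i]) (auto simp: torus_def intro!: sum.neutral)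

lemma mm_torus_nth: "h \<in> torus \<Longrightarrow> (A ** h) $ i $ j = A $ i $ j * h $ j $ j"
  unfolding mm_nth by (subst sum.remove[of _ j]) (auto simp: torus_def intro!: sum.neutral)

lemma torus_ct: "h \<in> torus \<Longrightarrow> ctranspose h \<in> torus"
  by (auto simp: torus_def SU3_ct)

lemma torus_mult: "g \<in> torus \<Longrightarrow> h \<in> torus \<Longrightarrow> g ** h \<in> torus"
  using torus_mm_nth[of g h] by (auto simp: torus_def SU3_mult)

lemma torus_norm: assumes "h \<in> torus" shows "cnj (h $ i $ i) * h $ i $ i = 1"
proof -
  have "(ctranspose h ** h) $ i $ i = 1"
    using assms by (simp add: SU3_ct_mm torus_SU3 mat_def)
  then show ?thesis by (simp add: torus_mm_nth[OF torus_ct[OF assms]])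
qed

subsection \<open>The adjoint action\<close>

text \<open>This is \<open>Ad\<close> of the inverse for \<open>g\<close> in \<open>SU3\<close>,
  written with the conjugate transpose so that it is polynomial in the entries of \<open>g\<close>
  and their conjugates: no inverse has to be differentiated. It reverses products, see
  \<open>Adi_Adi\<close>.\<close>

definition Adi :: "cmat \<Rightarrow> cmat \<Rightarrow> cmat" where
  "Adi g x = ctranspose g ** x ** g"

lemma bounded_linear_Adi: "bounded_linear (Adi g)"
  unfolding Adi_def
  by (intro bounded_linear_compose[OF bounded_bilinear.bounded_linear_left[OF bounded_bilinear_mm]]
      bounded_bilinear.bounded_linear_right[OF bounded_bilinear_mm])

lemmas Adi_linear = bounded_linear.linear[OF bounded_linear_Adi]
lemmas Adi_simps = linear_add[OF Adi_linear] linear_diff[OF Adi_linear] linear_neg[OF Adi_linear]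
  linear_scale[OF Adi_linear] linear_0[OF Adi_linear]

lemma Ad_SU3: "g \<in> SU3 \<Longrightarrow> Ad g = Adi (ctranspose g)"
  by (simp add: fun_eq_iff Ad_def Adi_def SU3_inv)

lemma Ad_inv_SU3: "g \<in> SU3 \<Longrightarrow> Ad (matrix_inv g) = Adi g"
  by (simp add: SU3_inv Ad_SU3 SU3_ct)

lemma Adi_Adi: "Adi g (Adi h x) = Adi (h ** g) x"
  by (simp add: Adi_def ct_mm matrix_mul_assoc)

lemma Adi_one [simp]: "Adi (mat 1) x = x"
  by (simp add: Adi_def)

lemma Adi_cancel: "g \<in> SU3 \<Longrightarrow> Adi g (Adi (ctranspose g) x) = x"
  "g \<in> SU3 \<Longrightarrow> Adi (ctranspose g) (Adi g x) = x"
  by (simp_all add: Adi_Adi SU3_ct_mm SU3_mm_ct)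

lemma mm_Adi: "g \<in> SU3 \<Longrightarrow> g ** Adi g x = x ** g"
  by (simp add: Adi_def matrix_mul_assoc SU3_mm_ct)

lemma ct_Adi: "ctranspose (Adi g x) = Adi g (ctranspose x)"
  by (simp add: Adi_def ct_mm matrix_mul_assoc)

lemma trace_mm_commute: "trace ((A::cmat) ** B) = trace (B ** A)"
  unfolding trace_def mm_nth by (subst sum.swap) (simp add: mult.commute)

lemma trace_Adi: "g \<in> SU3 \<Longrightarrow> trace (Adi g x) = trace x"
  unfolding Adi_def by (subst trace_mm_commute) (simp add: matrix_mul_assoc SU3_mm_ct)

lemma Adi_torus_nth:
  "h \<in> torus \<Longrightarrow> Adi h x $ i $ j = cnj (h $ i $ i) * x $ i $ j * h $ j $ j"
  by (simp add: Adi_def mm_torus_nth torus_mm_nth[OF torus_ct])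

lemma lie_Adi: assumes "g \<in> SU3" shows "lie (Adi g x) (Adi g y) = Adi g (lie x y)"
proof -
  have "Adi g x ** Adi g y = Adi g (x ** y)" for x y
    unfolding Adi_def by (simp add: matrix_mul_assoc[symmetric] SU3_mm_ct_cancel assms)
  then show ?thesis by (simp add: lie_def Adi_simps)
qed

lemma bounded_bilinear_lie: "bounded_bilinear lie"
  unfolding bilinear_conv_bounded_bilinear[symmetric] bilinear_def lie_def
  by (auto intro!: linearI simp: mm_simps algebra_simps)

lemma subspace_su3: "subspace su3"
  unfolding subspace_def su3_def
  by (auto simp: ct_simps trace_add trace_def sum.distrib scaleR_sum_right[symmetric])

lemma subspace_m: "subspace \<mm>"
  using subspace_su3 unfolding subspace_def \<mm>_def by auto

lemma m_su3: "x \<in> \<mm> \<Longrightarrow> x \<in> su3"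
  by (simp add: \<mm>_def)

lemma m_iff: "x \<in> \<mm> \<longleftrightarrow> ctranspose x = - x \<and> (\<forall>i. x $ i $ i = 0)"
  by (auto simp: \<mm>_def su3_def trace_def)

lemma Adi_su3: "g \<in> SU3 \<Longrightarrow> x \<in> su3 \<Longrightarrow> Adi g x \<in> su3"
  by (simp add: su3_def ct_Adi trace_Adi Adi_simps)

lemma Adi_m: "h \<in> torus \<Longrightarrow> x \<in> \<mm> \<Longrightarrow> Adi h x \<in> \<mm>"
  by (simp add: m_iff ct_Adi Adi_simps Adi_torus_nth)

lemma lie_su3: "x \<in> su3 \<Longrightarrow> y \<in> su3 \<Longrightarrow> lie x y \<in> su3"
  by (auto simp: su3_def lie_def ct_simps ct_mm mm_simps trace_sub trace_mm_commute)

text \<open>Taking the skew-Hermitian part makes this a projection of the whole matrix space onto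
  \<open>\<mm>\<close>, equal to \<open>proj_m\<close> on \<open>su3\<close>. Linear algebra on
  \<open>\<mm>\<close> can thereby be done in the Euclidean space of all matrices.\<close>

definition m_part :: "cmat \<Rightarrow> cmat" where
  "m_part x = proj_m ((1/2) *\<^sub>R (x - ctranspose x))"

lemma m_part_nth: "m_part x $ i $ j = (if i = j then 0 else (x $ i $ j - cnj (x $ j $ i)) / 2)"
  by (auto simp: m_part_def proj_m_def scaleR_mat_nth field_simps simp del: vector_scaleR_component)

lemma bounded_linear_m_part: "bounded_linear m_part"
  unfolding linear_conv_bounded_linear[symmetric]
  by (auto intro!: linearI simp: vec_eq_iff m_part_nth scaleR_mat_nth field_simps
      simp del: vector_scaleR_component)

lemmas m_part_linear = bounded_linear.linear[OF bounded_linear_m_part]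

lemma m_part_in_m [simp]: "m_part x \<in> \<mm>"
  by (simp add: m_iff m_part_nth vec_eq_iff field_simps)

lemma m_part_su3: assumes "x \<in> su3" shows "m_part x = proj_m x"
proof -
  have "ctranspose x $ i $ j = (- x) $ i $ j" for i j using assms unfolding su3_def by simp
  then have "cnj (x $ j $ i) = - x $ i $ j" for i j by simp
  then show ?thesis by (simp add: vec_eq_iff m_part_nth proj_m_def)
qed

lemma m_part_id: assumes "x \<in> \<mm>" shows "m_part x = x"
  using m_part_su3[OF m_su3[OF assms]] assms by (auto simp: vec_eq_iff proj_m_def m_iff)

lemma m_part_Adi: "h \<in> torus \<Longrightarrow> m_part (Adi h x) = Adi h (m_part x)"
  by (simp add: vec_eq_iff m_part_nth Adi_torus_nth algebra_simps diff_divide_distrib)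

subsection \<open>The exponential\<close>

definition mpow :: "cmat \<Rightarrow> nat \<Rightarrow> cmat" where
  "mpow x n = ((\<lambda>y. x ** y) ^^ n) (mat 1)"

lemma mpow_0 [simp]: "mpow x 0 = mat 1" and mpow_Suc: "mpow x (Suc n) = x ** mpow x n"
  by (simp_all add: mpow_def)

lemma mpow_scaleR: "mpow (t *\<^sub>R x) n = t ^ n *\<^sub>R mpow x n"
  by (induction n) (simp_all add: mpow_Suc mm_simps)

lemma mpow_bound:
  assumes "\<And>i j. norm (x $ i $ j) \<le> M"
  shows "norm (mpow x n $ i $ j) \<le> (3 * M) ^ n"
proof (induction n arbitrary: i j)
  case 0
  then show ?case by (simp add: mat_def)
next
  case (Suc n)
  have "norm (mpow x (Suc n) $ i $ j) \<le> (\<Sum>k\<in>UNIV. norm (x $ i $ k * mpow x n $ k $ j))"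
    unfolding mpow_Suc mm_nth by (rule norm_sum)
  also have "\<dots> \<le> (\<Sum>k\<in>(UNIV::3 set). M * (3 * M) ^ n)"
    unfolding norm_mult using norm_ge_zero assms order_trans
    by (intro sum_mono mult_mono assms Suc.IH) blast+
  finally show ?case by simp
qed

definition ecoeff :: "cmat \<Rightarrow> 3 \<Rightarrow> 3 \<Rightarrow> nat \<Rightarrow> complex" where
  "ecoeff x i j n = mpow x n $ i $ j / fact n"

lemma summable_ecoeff: "summable (\<lambda>n. ecoeff x i j n * z ^ n)"
proof -
  define M where "M = (\<Sum>i\<in>UNIV. \<Sum>j\<in>UNIV. norm (x $ i $ j))"
  have M: "norm (x $ i $ j) \<le> M" for i j
  proof -
    have "norm (x $ i $ j) \<le> (\<Sum>j\<in>UNIV. norm (x $ i $ j))"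
      by (rule member_le_sum) auto
    also have "\<dots> \<le> M" unfolding M_def
      by (rule member_le_sum) (auto intro: sum_nonneg)
    finally show ?thesis .
  qed
  show ?thesis
  proof (rule summable_comparison_test')
    show "summable (\<lambda>n. (3 * M * norm z) ^ n / fact n)"
      using summable_exp[of "3 * M * norm z"] by (simp add: field_simps)
    show "norm (ecoeff x i j n * z ^ n) \<le> (3 * M * norm z) ^ n / fact n" for n
      using mult_right_mono[OF mpow_bound[OF M, of n i j], of "norm z ^ n"]
      by (simp add: ecoeff_def norm_mult norm_divide norm_power power_mult_distrib divide_right_mono)
  qed
qed

definition efun :: "cmat \<Rightarrow> 3 \<Rightarrow> 3 \<Rightarrow> complex \<Rightarrow> complex" where
  "efun x i j z = (\<Sum>n. ecoeff x i j n * z ^ n)"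

text \<open>Termwise differentiation shifts the coefficients, and \<open>mpow_Suc\<close> turns the
  shift into multiplication by \<open>x\<close>: entry by entry this is E' = x E.\<close>

lemma efun_deriv: "(efun x i j has_field_derivative (\<Sum>k\<in>UNIV. x $ i $ k * efun x k j z)) (at z)"
proof -
  have "diffs (ecoeff x i j) n * z ^ n = (\<Sum>k\<in>UNIV. x $ i $ k * (ecoeff x k j n * z ^ n))" for n
  proof -
    have "of_nat (Suc n) * (mpow x (Suc n) $ i $ j / fact (Suc n)) = mpow x (Suc n) $ i $ j / fact n"
      by (simp del: of_nat_Suc)
    then show ?thesis
      by (simp add: diffs_def ecoeff_def mpow_Suc mm_nth sum_distrib_right sum_divide_distrib
          sum_distrib_left ac_simps del: of_nat_Suc)
  qed
  moreover have "(\<lambda>n. \<Sum>k\<in>UNIV. x $ i $ k * (ecoeff x k j n * z ^ n)) sums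
      (\<Sum>k\<in>UNIV. x $ i $ k * efun x k j z)"
    unfolding efun_def by (intro sums_sum sums_mult summable_sums summable_ecoeff)
  ultimately have "(\<Sum>n. diffs (ecoeff x i j) n * z ^ n) = (\<Sum>k\<in>UNIV. x $ i $ k * efun x k j z)"
    by (simp add: sums_iff)
  then show ?thesis
    using termdiffs_strong_converges_everywhere[OF summable_ecoeff, of x i j z]
    by (simp add: efun_def[abs_def])
qed

lemma sums_vec:
  fixes f :: "nat \<Rightarrow> 'a::real_normed_vector ^ 'n"
  assumes "\<And>i. (\<lambda>n. f n $ i) sums (s $ i)"
  shows "f sums s"
  using assms unfolding sums_def by (intro vec_tendstoI) (simp add: sum_component)

lemma mexp_nth: "mexp (t *\<^sub>R x) $ i $ j = efun x i j (of_real t)"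
proof -
  define E :: cmat where "E = (\<chi> i j. efun x i j (of_real t))"
  have "(\<lambda>n. (1 / fact n) *\<^sub>R mpow (t *\<^sub>R x) n) sums E"
  proof (intro sums_vec)
    fix i j
    have "(\<lambda>n. ecoeff x i j n * of_real t ^ n) sums efun x i j (of_real t)"
      unfolding efun_def by (rule summable_sums[OF summable_ecoeff])
    moreover have "ecoeff x i j n * of_real t ^ n = ((1 / fact n) *\<^sub>R mpow (t *\<^sub>R x) n) $ i $ j" for n
      by (simp add: ecoeff_def mpow_scaleR scaleR_mat_nth del: vector_scaleR_component)
    ultimately show "(\<lambda>n. ((1 / fact n) *\<^sub>R mpow (t *\<^sub>R x) n) $ i $ j) sums E $ i $ j"
      by (simp add: E_def)
  qed
  then have "mexp (t *\<^sub>R x) = E"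
    unfolding mexp_def mpow_def[symmetric] by (simp add: sums_iff)
  then show ?thesis by (simp add: E_def)
qed

lemma has_vector_derivative_vec:
  fixes f :: "real \<Rightarrow> 'a::real_normed_vector ^ 'n"
  assumes "\<And>i. ((\<lambda>t. f t $ i) has_vector_derivative (f' $ i)) (at t)"
  shows "(f has_vector_derivative f') (at t)"
proof -
  have "((\<lambda>h. norm (f (t + h) $ i - f t $ i - h *\<^sub>R f' $ i) / norm h) \<longlongrightarrow> 0) (at 0)" for i
    using assms[of i] by (simp add: has_vector_derivative_def has_derivative_at)
  then have "((\<lambda>h. \<Sum>i\<in>UNIV. norm (f (t + h) $ i - f t $ i - h *\<^sub>R f' $ i) / norm h)
      \<longlongrightarrow> (\<Sum>i\<in>(UNIV::'n set). 0)) (at 0)"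
    by (intro tendsto_sum)
  then have *: "((\<lambda>h. (\<Sum>i\<in>UNIV. norm (f (t + h) $ i - f t $ i - h *\<^sub>R f' $ i)) / norm h)
      \<longlongrightarrow> 0) (at 0)"
    by (simp add: sum_divide_distrib)
  have "norm (f (t + h) - f t - h *\<^sub>R f') \<le> (\<Sum>i\<in>UNIV. norm (f (t + h) $ i - f t $ i - h *\<^sub>R f' $ i))" for h
    unfolding norm_vec_def using L2_set_le_sum[of UNIV "\<lambda>i. norm ((f (t + h) - f t - h *\<^sub>R f') $ i)"] by simp
  then have "((\<lambda>h. norm (f (t + h) - f t - h *\<^sub>R f') / norm h) \<longlongrightarrow> 0) (at 0)"
    by (intro tendsto_sandwich[OF _ _ tendsto_const *] always_eventually allI divide_right_mono) auto
  then show ?thesis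
    by (simp add: has_vector_derivative_def has_derivative_at bounded_linear_scaleR_left)
qed

lemma mexp_deriv: "((\<lambda>t. mexp (t *\<^sub>R x)) has_vector_derivative x ** mexp (t *\<^sub>R x)) (at t)"
  by (intro has_vector_derivative_vec, unfold mm_nth mexp_nth)
    (intro has_vector_derivative_real_field efun_deriv)

lemma mexp_zero: "mexp (0 *\<^sub>R x) = mat 1"
proof -
  have "efun x i j 0 = mat 1 $ i $ j" for i j
    unfolding efun_def using powser_zero[of "ecoeff x i j"] by (simp add: ecoeff_def)
  then show ?thesis using mexp_nth[of 0 x] by (simp add: vec_eq_iff)
qed

lemma has_vector_derivative_zero_imp_const:
  fixes f :: "real \<Rightarrow> 'a::real_normed_vector"
  assumes "\<And>t. (f has_vector_derivative 0) (at t)"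
  shows "f t = f 0"
proof -
  have "\<exists>c. \<forall>t\<in>UNIV. f t = c"
    using assms by (intro has_derivative_zero_constant) (auto simp: has_vector_derivative_def)
  then show ?thesis by auto
qed

text \<open>Two conservation laws: \<open>ctranspose (E t) ** E t\<close> has zero derivative
  because \<open>x\<close> is skew-Hermitian, and \<open>det (E t)\<close> because its derivative is
  \<open>trace x * det (E t)\<close>.\<close>

lemma mexp_SU3: assumes x: "x \<in> su3" shows "mexp (t *\<^sub>R x) \<in> SU3"
proof -
  define E where "E t = mexp (t *\<^sub>R x)" for t
  have D: "(E has_vector_derivative x ** E t) (at t)" for t
    using mexp_deriv by (simp add: E_def[abs_def])
  have E0: "E 0 = mat 1" using mexp_zero[of x] unfolding E_def by simp
  have cx: "ctranspose x = - x" and tx: "trace x = 0" using x by (auto simp: su3_def)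
  have "((\<lambda>t. ctranspose (E t) ** E t) has_vector_derivative 0) (at t)" for t
  proof -
    have "((\<lambda>t. ctranspose (E t) ** E t) has_vector_derivative
        ctranspose (E t) ** (x ** E t) + ctranspose (x ** E t) ** E t) (at t)"
      by (intro bounded_bilinear.has_vector_derivative[OF bounded_bilinear_mm]
          bounded_linear.has_vector_derivative[OF bounded_linear_ct] D)
    then show ?thesis by (simp add: ct_mm cx mm_simps matrix_mul_assoc)
  qed
  from has_vector_derivative_zero_imp_const[OF this] have u: "ctranspose (E t) ** E t = mat 1"
    by (simp add: E0)
  have Dn: "((\<lambda>t. E t $ i $ j) has_vector_derivative (x ** E t) $ i $ j) (at t)" for i j t
    by (intro bounded_linear.has_vector_derivative[OF bounded_linear_vec_nth] D)
  have "((\<lambda>t. det (E t)) has_vector_derivative 0) (at t)" for t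
  proof -
    have rhs: "(f has_vector_derivative a) (at t) \<Longrightarrow> a = b \<Longrightarrow> (f has_vector_derivative b) (at t)"
      for f :: "real \<Rightarrow> complex" and a b by simp
    have "((\<lambda>t. det (E t)) has_vector_derivative trace x * det (E t)) (at t)"
      unfolding det_3
      by (rule rhs, (rule has_vector_derivative_diff has_vector_derivative_add
            has_vector_derivative_mult Dn)+)
        (simp add: mm_nth sum_3 trace_def algebra_simps)
    then show ?thesis by (simp add: tx)
  qed
  from has_vector_derivative_zero_imp_const[OF this] have "det (E t) = 1"
    by (simp add: E0)
  then show ?thesis
    using u matrix_left_right_inverse[of "E t" "ctranspose (E t)"] by (auto simp: SU3_def E_def)
qed

lemma mexp_torus:
  assumes x: "x \<in> su3" "\<And>i j. i \<noteq> j \<Longrightarrow> x $ i $ j = 0"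
  shows "mexp (t *\<^sub>R x) \<in> torus"
proof -
  have "mpow x n $ i $ j = 0" if "i \<noteq> j" for n i j
    using that
  proof (induction n)
    case (Suc n)
    have "x $ i $ k * mpow x n $ k $ j = 0" for k
      using Suc x(2)[of i k] by (cases "k = i") auto
    then show ?case unfolding mpow_Suc mm_nth by (intro sum.neutral ballI)
  qed (simp add: mat_def)
  then have "efun x i j z = 0" if "i \<noteq> j" for i j z
    using that by (simp add: efun_def ecoeff_def)
  then show ?thesis
    using mexp_SU3[OF x(1)] by (simp add: torus_def mexp_nth)
qed

section \<open>Left-invariant derivatives on \<open>SU(3)\<close>\<close>

abbreviation smooth_SU3 :: "(cmat \<Rightarrow> 'a::real_normed_vector) \<Rightarrow> bool" where
  "smooth_SU3 F \<equiv> smooth_on_subset F SU3"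

text \<open>Derivative along the left-invariant field of \<open>x\<close>, which is why it commutes
  with left translations (\<open>Rd_left\<close>).\<close>

definition Rd :: "(cmat \<Rightarrow> 'a::real_normed_vector) \<Rightarrow> cmat \<Rightarrow> cmat \<Rightarrow> 'a" where
  "Rd F x g = vector_derivative (\<lambda>t. F (g ** mexp (t *\<^sub>R x))) (at 0)"

lemma exp_curve_SU3: "g \<in> SU3 \<Longrightarrow> x \<in> su3 \<Longrightarrow> g ** mexp (t *\<^sub>R x) \<in> SU3"
  by (simp add: SU3_mult mexp_SU3)

lemma exp_curve_deriv: "((\<lambda>t. (g :: cmat) ** mexp (t *\<^sub>R x)) has_vector_derivative g ** x) (at 0)"
  using bounded_linear.has_vector_derivative[OF
      bounded_bilinear.bounded_linear_right[OF bounded_bilinear_mm] mexp_deriv[of x 0], of g]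
    mexp_zero[of x] by simp

lemma exp_curve_deriv_left: "((\<lambda>t. mexp (t *\<^sub>R x) ** (g :: cmat)) has_vector_derivative x ** g) (at 0)"
  using bounded_linear.has_vector_derivative[OF
      bounded_bilinear.bounded_linear_left[OF bounded_bilinear_mm] mexp_deriv[of x 0], of g]
    mexp_zero[of x] by simp

lemma exp_curve_zero: "(g :: cmat) ** mexp (0 *\<^sub>R x) = g"
  by (simp only: mexp_zero matrix_mul_rid)

text \<open>Only the velocity of the curve matters: near time 0 the curve stays in the domain of the
  extension by continuity, and the chain rule applies there.\<close>

lemma deriv_along_curve:
  assumes F: "smooth_on_open Ft U" "\<forall>y\<in>U \<inter> SU3. Ft y = F y" and g: "g \<in> U"
    and \<gamma>: "\<And>t. \<gamma> t \<in> SU3" "\<gamma> 0 = g" "(\<gamma> has_vector_derivative v) (at 0)"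
  shows "((\<lambda>t. F (\<gamma> t)) has_vector_derivative frechet_derivative Ft (at g) v) (at 0)"
proof -
  have "((\<lambda>t. Ft (\<gamma> t)) has_derivative (\<lambda>h. frechet_derivative Ft (at (\<gamma> 0)) (h *\<^sub>R v))) (at 0)"
    by (rule has_derivative_compose[OF \<gamma>(3)[unfolded has_vector_derivative_def]])
      (use smooth_on_open_has_derivative[OF F(1) g] \<gamma>(2) in simp)
  moreover have "\<forall>\<^sub>F t in at 0. Ft (\<gamma> t) = F (\<gamma> t)"
  proof -
    have "(\<gamma> \<longlongrightarrow> g) (at 0)"
      using has_vector_derivative_continuous[OF \<gamma>(3)] \<gamma>(2) by (simp add: isCont_def)
    then have "\<forall>\<^sub>F t in at 0. \<gamma> t \<in> U"
      using topological_tendstoD[OF _ smooth_on_open_imp_open[OF F(1)] g] by blast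
    then show ?thesis by eventually_elim (use F \<gamma> in auto)
  qed
  ultimately have "((\<lambda>t. F (\<gamma> t)) has_derivative (\<lambda>h. frechet_derivative Ft (at (\<gamma> 0)) (h *\<^sub>R v))) (at 0)"
    by (rule has_derivative_transform_eventually) (use F g \<gamma> in auto)
  then show ?thesis
    using linear_scale[OF has_derivative_linear[OF smooth_on_open_has_derivative[OF F(1) g]]]
    by (simp add: has_vector_derivative_def \<gamma>(2))
qed

lemma Rd_eq_frechet:
  assumes "smooth_on_open Ft U" "\<forall>y\<in>U \<inter> SU3. Ft y = F y" "g \<in> U" "g \<in> SU3" "x \<in> su3"
  shows "Rd F x g = frechet_derivative Ft (at g) (g ** x)"
  unfolding Rd_def
  by (rule vector_derivative_at, rule deriv_along_curve[OF assms(1,2,3)])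
    (use assms exp_curve_SU3 exp_curve_deriv exp_curve_zero in auto)

text \<open>Lets \<open>Rd\<close> be read off along other curves, such as exp(tx) g and g exp(tx)
  h, once their velocity is written as the starting point times an element of
  \<open>su3\<close>.\<close>

lemma Rd_curve:
  assumes "smooth_SU3 F" "g \<in> SU3" "x \<in> su3"
    and "\<And>t. \<gamma> t \<in> SU3" "\<gamma> 0 = g" "(\<gamma> has_vector_derivative g ** x) (at 0)"
  shows "((\<lambda>t. F (\<gamma> t)) has_vector_derivative Rd F x g) (at 0)"
proof -
  obtain U Ft where U: "g \<in> U" "smooth_on_open Ft U" "\<forall>y\<in>U \<inter> SU3. Ft y = F y"
    using smooth_on_subsetE[OF assms(1,2)] by metis
  show ?thesis
    unfolding Rd_eq_frechet[OF U(2,3,1) assms(2,3)] by (rule deriv_along_curve[OF U(2,3,1) assms(4-6)])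
qed

lemma Rd_deriv:
  assumes "smooth_SU3 F" "g \<in> SU3" "x \<in> su3"
  shows "((\<lambda>t. F (g ** mexp (t *\<^sub>R x))) has_vector_derivative Rd F x g) (at 0)"
  by (rule Rd_curve[OF assms exp_curve_SU3[OF assms(2,3)] exp_curve_zero exp_curve_deriv])

lemma Rd_I: "((\<lambda>t. F (g ** mexp (t *\<^sub>R x))) has_vector_derivative d) (at 0) \<Longrightarrow> Rd F x g = d"
  unfolding Rd_def by (rule vector_derivative_at)

lemma Rd_cong:
  assumes "\<And>g. g \<in> SU3 \<Longrightarrow> F g = G g" "g \<in> SU3" "x \<in> su3"
  shows "Rd F x g = Rd G x g"
  unfolding Rd_def using assms exp_curve_SU3 by simp

lemma Rd_lin:
  assumes "smooth_SU3 F" "g \<in> SU3"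
  obtains f where "linear f" "\<And>x. x \<in> su3 \<Longrightarrow> Rd F x g = f x"
proof -
  obtain U Ft where U: "g \<in> U" "smooth_on_open Ft U" "\<forall>y\<in>U \<inter> SU3. Ft y = F y"
    using smooth_on_subsetE[OF assms] by metis
  have "linear (\<lambda>x. frechet_derivative Ft (at g) (g ** x))"
    using linear_compose[OF bounded_linear.linear[OF
        bounded_bilinear.bounded_linear_right[OF bounded_bilinear_mm, of g]]
        has_derivative_linear[OF smooth_on_open_has_derivative[OF U(2,1)]]]
    by (simp add: o_def)
  then show ?thesis using that Rd_eq_frechet[OF U(2,3,1) assms(2)] by blast
qed

lemma Rd_add_arg:
  assumes "smooth_SU3 F" "g \<in> SU3" "x \<in> su3" "y \<in> su3"
  shows "Rd F (x + y) g = Rd F x g + Rd F y g"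
  using Rd_lin[OF assms(1,2)] assms(3,4) subspace_add[OF subspace_su3 assms(3,4)]
  by (metis linear_add)

lemma Rd_diff_arg:
  assumes "smooth_SU3 F" "g \<in> SU3" "x \<in> su3" "y \<in> su3"
  shows "Rd F (x - y) g = Rd F x g - Rd F y g"
  using Rd_lin[OF assms(1,2)] assms(3,4) subspace_diff[OF subspace_su3 assms(3,4)]
  by (metis linear_diff)

lemma Rd_scaleR_arg:
  assumes "smooth_SU3 F" "g \<in> SU3" "x \<in> su3"
  shows "Rd F (c *\<^sub>R x) g = c *\<^sub>R Rd F x g"
  using Rd_lin[OF assms(1,2)] assms(3) subspace_scale[OF subspace_su3 assms(3), of c]
  by (metis linear_scale)

lemma Rd_const [simp]: "Rd (\<lambda>_. c) x g = 0"
  by (rule Rd_I) simp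

lemma Rd_linear:
  assumes "bounded_linear A" "smooth_SU3 F" "g \<in> SU3" "x \<in> su3"
  shows "Rd (\<lambda>g. A (F g)) x g = A (Rd F x g)"
  by (rule Rd_I) (rule bounded_linear.has_vector_derivative[OF assms(1) Rd_deriv[OF assms(2-4)]])

lemma Rd_add:
  assumes "smooth_SU3 F" "smooth_SU3 G" "g \<in> SU3" "x \<in> su3"
  shows "Rd (\<lambda>g. F g + G g) x g = Rd F x g + Rd G x g"
  by (rule Rd_I) (intro has_vector_derivative_add Rd_deriv assms)

lemma Rd_bilinear:
  assumes "bounded_bilinear B" "smooth_SU3 F" "smooth_SU3 G" "g \<in> SU3" "x \<in> su3"
  shows "Rd (\<lambda>g. B (F g) (G g)) x g = B (F g) (Rd G x g) + B (Rd F x g) (G g)"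
  using bounded_bilinear.has_vector_derivative[OF assms(1) Rd_deriv[OF assms(2,4,5)]
      Rd_deriv[OF assms(3,4,5)]]
  by (intro Rd_I) (simp only: exp_curve_zero)

text \<open>\<open>su3\<close> and \<open>\<mm>\<close> are cut out by linear equations, and
  derivatives inherit such equations; \<open>Rd_su3\<close> and \<open>Rd_m\<close> are the two
  applications.\<close>

lemma Rd_linear_zero:
  assumes "bounded_linear A" "smooth_SU3 F" "g \<in> SU3" "x \<in> su3" "\<And>g. g \<in> SU3 \<Longrightarrow> A (F g) = 0"
  shows "A (Rd F x g) = 0"
  using Rd_linear[OF assms(1-4)] Rd_cong[of "\<lambda>g. A (F g)" "\<lambda>_. 0" g x] assms by simp

lemma Rd_su3:
  assumes "smooth_SU3 F" "g \<in> SU3" "x \<in> su3" "\<And>g. g \<in> SU3 \<Longrightarrow> F g \<in> su3"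
  shows "Rd F x g \<in> su3"
proof -
  have "bounded_linear (\<lambda>y. ctranspose y + y)"
    by (intro bounded_linear_add bounded_linear_ct bounded_linear_ident)
  then have 1: "ctranspose (Rd F x g) + Rd F x g = 0"
    by (rule Rd_linear_zero[OF _ assms(1-3)]) (use assms(4) in \<open>auto simp: su3_def\<close>)
  have "bounded_linear (trace :: cmat \<Rightarrow> complex)"
    unfolding linear_conv_bounded_linear[symmetric]
    by (auto intro!: linearI simp: trace_def sum.distrib scaleR_sum_right)
  then have "trace (Rd F x g) = 0"
    by (rule Rd_linear_zero[OF _ assms(1-3)]) (use assms(4) in \<open>auto simp: su3_def\<close>)
  with 1 show ?thesis by (simp add: su3_def eq_neg_iff_add_eq_0)
qed

lemma Rd_m:
  assumes "smooth_SU3 F" "g \<in> SU3" "x \<in> su3" "\<And>g. g \<in> SU3 \<Longrightarrow> F g \<in> \<mm>"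
  shows "Rd F x g \<in> \<mm>"
proof -
  have "bounded_linear (\<lambda>y. y - m_part y)"
    by (intro bounded_linear_sub bounded_linear_m_part bounded_linear_ident)
  then have "Rd F x g - m_part (Rd F x g) = 0"
    by (rule Rd_linear_zero[OF _ assms(1-3)]) (use assms(4) m_part_id in auto)
  then show ?thesis by (metis eq_iff_diff_eq_0 m_part_in_m)
qed

lemma Rd_id: "Rd (\<lambda>g. g) x g = g ** x"
  by (rule Rd_I[OF exp_curve_deriv])

lemma smooth_SU3_ct: "smooth_SU3 ctranspose"
  using smooth_on_subset_linear[OF bounded_linear_ct smooth_on_subset_id] by simp

lemma smooth_SU3_left: "a \<in> SU3 \<Longrightarrow> smooth_SU3 F \<Longrightarrow> smooth_SU3 (\<lambda>g. F (a ** g))"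
  by (rule smooth_on_subset_compose_linear[OF
        bounded_bilinear.bounded_linear_right[OF bounded_bilinear_mm]]) (auto simp: SU3_mult)

lemma Rd_left: "Rd (\<lambda>g. F (a ** g)) x g = Rd F x (a ** g)"
  by (simp add: Rd_def matrix_mul_assoc)

text \<open>The curve g exp(tx) h leaves g h with velocity g x h = (g h)(h^-1 x h).\<close>

lemma Rd_right:
  assumes "h \<in> SU3" "smooth_SU3 F" "g \<in> SU3" "x \<in> su3"
  shows "Rd (\<lambda>g. F (g ** h)) x g = Rd F (Adi h x) (g ** h)"
proof (rule Rd_I)
  show "((\<lambda>t. F (g ** mexp (t *\<^sub>R x) ** h)) has_vector_derivative Rd F (Adi h x) (g ** h)) (at 0)"
  proof (rule Rd_curve)
    show "g ** mexp (0 *\<^sub>R x) ** h = g ** h" by (simp only: exp_curve_zero)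
    have "g ** h ** Adi h x = g ** x ** h"
      using mm_Adi[OF assms(1), of x] by (simp add: matrix_mul_assoc[symmetric])
    then show "((\<lambda>t. g ** mexp (t *\<^sub>R x) ** h) has_vector_derivative g ** h ** Adi h x) (at 0)"
      using bounded_linear.has_vector_derivative[OF
          bounded_bilinear.bounded_linear_left[OF bounded_bilinear_mm] exp_curve_deriv] by metis
  qed (use assms in \<open>auto simp: SU3_mult Adi_su3 mexp_SU3\<close>)
qed

lemma smooth_SU3_mm:
  fixes F G :: "cmat \<Rightarrow> cmat"
  shows "smooth_SU3 F \<Longrightarrow> smooth_SU3 G \<Longrightarrow> smooth_SU3 (\<lambda>g. F g ** G g)"
  by (rule smooth_on_subset_bilinear[OF bounded_bilinear_mm])

lemma smooth_on_open_mm_id: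
  fixes u :: "cmat \<Rightarrow> cmat"
  assumes "smooth_on_open u U" shows "smooth_on_open (\<lambda>y. y ** u y) U"
  using assms by (intro smooth_on_open_bilinear[OF bounded_bilinear_mm])
    (auto simp: smooth_on_open_def C_diff_on_id)

section \<open>Commutators of derivatives along variable fields\<close>

lemma Rd_smooth:
  assumes F: "smooth_SU3 F" and \<phi>: "smooth_SU3 \<phi>" "\<And>g. g \<in> SU3 \<Longrightarrow> \<phi> g \<in> su3"
  shows "smooth_SU3 (\<lambda>g. Rd F (\<phi> g) g)"
  unfolding smooth_on_subset_def
proof
  fix g assume g: "g \<in> SU3"
  obtain U Ft where U: "g \<in> U" "smooth_on_open Ft U" "\<forall>y\<in>U \<inter> SU3. Ft y = F y"
    using smooth_on_subsetE[OF F g] by metis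
  obtain V \<phi>t where V: "g \<in> V" "smooth_on_open \<phi>t V" "\<forall>y\<in>V \<inter> SU3. \<phi>t y = \<phi> y"
    using smooth_on_subsetE[OF \<phi>(1) g] by metis
  have op: "open (U \<inter> V)"
    by (rule open_Int[OF smooth_on_open_imp_open[OF U(2)] smooth_on_open_imp_open[OF V(2)]])
  have "smooth_on_open (\<lambda>y. frechet_derivative Ft (at y) (y ** \<phi>t y)) (U \<inter> V)"
    by (intro smooth_on_open_derivative_along smooth_on_open_mm_id
        smooth_on_open_subset[OF U(2) op Int_lower1] smooth_on_open_subset[OF V(2) op Int_lower2])
  moreover have "frechet_derivative Ft (at y) (y ** \<phi>t y) = Rd F (\<phi> y) y" if "y \<in> U \<inter> V \<inter> SU3" for y
    using Rd_eq_frechet[OF U(2,3), of y "\<phi> y"] \<phi>(2) V(3) that by auto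
  ultimately show "\<exists>U Fa. g \<in> U \<and> smooth_on_open Fa U \<and> (\<forall>y\<in>U \<inter> SU3. Fa y = Rd F (\<phi> y) y)"
    using U(1) V(1) by blast
qed

text \<open>In matrix space the field is y \<mapsto> y \<psi>(y). Differentiating its factor y gives
  the term \<open>g ** x ** \<psi> g\<close>, from which the matrix commutator will arise.\<close>

lemma Rd_Rd:
  fixes F :: "cmat \<Rightarrow> 'a::euclidean_space"
  assumes U: "smooth_on_open Ft U" "\<forall>y\<in>U \<inter> SU3. Ft y = F y" "g \<in> U"
    and g: "g \<in> SU3" and x: "x \<in> su3" and \<psi>: "smooth_SU3 \<psi>" "\<forall>g\<in>SU3. \<psi> g \<in> su3"
  shows "Rd (\<lambda>g. Rd F (\<psi> g) g) x g
    = frechet_derivative Ft (at g) (g ** Rd \<psi> x g + g ** x ** \<psi> g)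
      + frechet_derivative (\<lambda>y. frechet_derivative Ft (at y) (g ** \<psi> g)) (at g) (g ** x)"
proof -
  obtain V \<psi>t where V: "g \<in> V" "smooth_on_open \<psi>t V" "\<forall>y\<in>V \<inter> SU3. \<psi>t y = \<psi> y"
    using smooth_on_subsetE[OF \<psi>(1) g] by metis
  define W where "W = U \<inter> V"
  have op: "open W" unfolding W_def
    by (rule open_Int[OF smooth_on_open_imp_open[OF U(1)] smooth_on_open_imp_open[OF V(2)]])
  have W: "g \<in> W" "smooth_on_open Ft W" "smooth_on_open \<psi>t W"
    using smooth_on_open_subset[OF U(1) op] smooth_on_open_subset[OF V(2) op] U(3) V(1)
    by (auto simp: W_def)
  have \<psi>g: "\<psi>t g = \<psi> g" using V g by auto
  have sH: "smooth_on_open (\<lambda>y. frechet_derivative Ft (at y) (y ** \<psi>t y)) W"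
    by (intro smooth_on_open_derivative_along smooth_on_open_mm_id W)
  have "Rd (\<lambda>g. Rd F (\<psi> g) g) x g
      = frechet_derivative (\<lambda>y. frechet_derivative Ft (at y) (y ** \<psi>t y)) (at g) (g ** x)"
  proof (rule Rd_eq_frechet[OF sH _ W(1) g x], rule ballI)
    fix y assume "y \<in> W \<inter> SU3"
    then show "frechet_derivative Ft (at y) (y ** \<psi>t y) = Rd F (\<psi> y) y"
      using Rd_eq_frechet[OF U(1,2), of y "\<psi> y"] \<psi>(2) V(3) by (auto simp: W_def)
  qed
  also have "\<dots> = frechet_derivative Ft (at g) (g ** frechet_derivative \<psi>t (at g) (g ** x) + g ** x ** \<psi>t g)
      + frechet_derivative (\<lambda>y. frechet_derivative Ft (at y) (g ** \<psi>t g)) (at g) (g ** x)"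
    by (rule frechet_derivative_apply[OF has_derivative_along[OF U(1,3)
            bounded_bilinear.FDERIV[OF bounded_bilinear_mm has_derivative_ident
              smooth_on_open_has_derivative[OF V(2,1)]]]])
  also have "frechet_derivative \<psi>t (at g) (g ** x) = Rd \<psi> x g"
    by (rule Rd_eq_frechet[OF V(2,3,1) g x, symmetric])
  finally show ?thesis by (simp add: \<psi>g)
qed

text \<open>The pure second derivatives cancel by symmetry. The remaining first-order part is the
  Lie bracket of the two fields on the group: \<open>lie\<close> comes from the two products of
  values, the other terms from the variation of the fields.\<close>

lemma Rd_commutator:
  fixes F :: "cmat \<Rightarrow> 'a::euclidean_space"
  assumes F: "smooth_SU3 F" and g: "g \<in> SU3"
    and \<phi>: "smooth_SU3 \<phi>" "\<And>g. g \<in> SU3 \<Longrightarrow> \<phi> g \<in> su3"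
    and \<psi>: "smooth_SU3 \<psi>" "\<And>g. g \<in> SU3 \<Longrightarrow> \<psi> g \<in> su3"
  shows "Rd (\<lambda>g. Rd F (\<psi> g) g) (\<phi> g) g - Rd (\<lambda>g. Rd F (\<phi> g) g) (\<psi> g) g
    = Rd F (lie (\<phi> g) (\<psi> g) + Rd \<psi> (\<phi> g) g - Rd \<phi> (\<psi> g) g) g"
proof -
  obtain U Ft where U: "g \<in> U" "smooth_on_open Ft U" "\<forall>y\<in>U \<inter> SU3. Ft y = F y"
    using smooth_on_subsetE[OF F g] by metis
  define D where "D = frechet_derivative Ft (at g)"
  have D: "linear D"
    unfolding D_def by (rule has_derivative_linear[OF smooth_on_open_has_derivative[OF U(2,1)]])
  have \<phi>': "\<forall>g\<in>SU3. \<phi> g \<in> su3" and \<psi>': "\<forall>g\<in>SU3. \<psi> g \<in> su3"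
    using \<phi> \<psi> by auto
  have "lie (\<phi> g) (\<psi> g) + Rd \<psi> (\<phi> g) g - Rd \<phi> (\<psi> g) g \<in> su3"
    using g by (intro subspace_add subspace_diff subspace_su3 lie_su3 Rd_su3 \<phi> \<psi>)
  then have "Rd F (lie (\<phi> g) (\<psi> g) + Rd \<psi> (\<phi> g) g - Rd \<phi> (\<psi> g) g) g
      = D (g ** (lie (\<phi> g) (\<psi> g) + Rd \<psi> (\<phi> g) g - Rd \<phi> (\<psi> g) g))"
    unfolding D_def by (rule Rd_eq_frechet[OF U(2,3,1) g])
  moreover have "Rd (\<lambda>g. Rd F (\<psi> g) g) (\<phi> g) g - Rd (\<lambda>g. Rd F (\<phi> g) g) (\<psi> g) g
      = D (g ** Rd \<psi> (\<phi> g) g + g ** \<phi> g ** \<psi> g) - D (g ** Rd \<phi> (\<psi> g) g + g ** \<psi> g ** \<phi> g)"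
    unfolding Rd_Rd[OF U(2,3,1) g \<phi>(2)[OF g] \<psi>(1) \<psi>']
      Rd_Rd[OF U(2,3,1) g \<psi>(2)[OF g] \<phi>(1) \<phi>'] D_def
      second_derivative_symmetric[OF U(2,1), of "g ** \<psi> g"] by simp
  ultimately show ?thesis
    by (simp add: linear_diff[OF D, symmetric] lie_def mm_simps matrix_mul_assoc algebra_simps)
qed

section \<open>Vector fields on the flag manifold as equivariant maps\<close>

lemma mem_coset_self [simp]: "g \<in> coset g"
  unfolding coset_def using torus_one by (metis image_eqI matrix_mul_rid)

lemma coset_torus: assumes "h \<in> torus" shows "coset (g ** h) = coset g"
proof -
  have "coset (g ** h) \<subseteq> coset g" if "h \<in> torus" for g h
    using that by (auto simp: coset_def matrix_mul_assoc[symmetric] torus_mult)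
  from this[OF assms, of g] this[OF torus_ct[OF assms], of "g ** h"] show ?thesis
    by (simp add: matrix_mul_assoc[symmetric] SU3_mm_ct torus_SU3 assms)
qed

lemma coset_flag [simp]: "g \<in> SU3 \<Longrightarrow> coset g \<in> flag"
  by (simp add: flag_def)

lemma flagE: assumes "p \<in> flag" obtains g where "g \<in> SU3" "p = coset g"
  using assms by (auto simp: flag_def)

lemma mem_cosetE:
  assumes "k \<in> coset g" obtains h where "h \<in> torus" "k = g ** h"
  using assms by (auto simp: coset_def)

lemma act_coset [simp]: "act a (coset g) = coset (a ** g)"
  by (simp add: act_def coset_def image_image matrix_mul_assoc)

text \<open>Changing the representative of the coset changes the vector by \<open>Adi\<close> of a
  torus element, which preserves \<open>\<mm>\<close>; so the union over representatives in
  \<open>tspace\<close> is a single subspace.\<close>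

lemma tspace_coset: assumes "g \<in> SU3" shows "v \<in> tspace (coset g) \<longleftrightarrow> Adi g v \<in> \<mm>"
proof
  assume "v \<in> tspace (coset g)"
  then obtain k x where k: "k \<in> coset g" "x \<in> \<mm>" "v = Ad k x" by (auto simp: tspace_def)
  then obtain h where h: "h \<in> torus" "k = g ** h" by (auto elim: mem_cosetE)
  have "Adi g v = Adi (ctranspose h) x"
    using h assms k(3)
    by (simp add: Ad_SU3 SU3_mult torus_SU3 Adi_Adi ct_mm matrix_mul_assoc[symmetric] SU3_ct_mm)
  then show "Adi g v \<in> \<mm>" using k(2) h(1) by (simp add: Adi_m torus_ct)
next
  assume "Adi g v \<in> \<mm>"
  moreover have "v = Ad g (Adi g v)" using assms by (simp add: Ad_SU3 Adi_cancel)
  ultimately show "v \<in> tspace (coset g)" unfolding tspace_def using mem_coset_self by blast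
qed

definition lift :: "vfield \<Rightarrow> cmat \<Rightarrow> cmat" where
  "lift X g = Adi g (X (coset g))"

text \<open>Sections of the bundle associated with the adjoint representation of the torus on
  \<open>\<mm>\<close>, in the form of equivariant maps on the group.\<close>

definition mfield :: "(cmat \<Rightarrow> cmat) \<Rightarrow> bool" where
  "mfield \<phi> \<longleftrightarrow> smooth_SU3 \<phi> \<and> (\<forall>g\<in>SU3. \<phi> g \<in> \<mm>) \<and>
     (\<forall>g\<in>SU3. \<forall>h\<in>torus. \<phi> (g ** h) = Adi h (\<phi> g))"

text \<open>Inverse of \<open>lift\<close>. Equivariance makes the chosen representative irrelevant;
  the value 0 off \<open>flag\<close> is the convention for vector fields.\<close>

definition drop :: "(cmat \<Rightarrow> cmat) \<Rightarrow> vfield" where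
  "drop \<phi> p = (if p \<in> flag then Adi (ctranspose (SOME g. g \<in> p)) (\<phi> (SOME g. g \<in> p)) else 0)"

lemma mfield_smooth: "mfield \<phi> \<Longrightarrow> smooth_SU3 \<phi>"
  and mfield_m: "mfield \<phi> \<Longrightarrow> g \<in> SU3 \<Longrightarrow> \<phi> g \<in> \<mm>"
  and mfield_su3: "mfield \<phi> \<Longrightarrow> g \<in> SU3 \<Longrightarrow> \<phi> g \<in> su3"
  and mfield_torus: "mfield \<phi> \<Longrightarrow> g \<in> SU3 \<Longrightarrow> h \<in> torus \<Longrightarrow> \<phi> (g ** h) = Adi h (\<phi> g)"
  by (simp_all add: mfield_def m_su3)

lemma smooth_SU3_Adi: "smooth_SU3 F \<Longrightarrow> smooth_SU3 (\<lambda>g. Adi g (F g))"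
  "smooth_SU3 F \<Longrightarrow> smooth_SU3 (\<lambda>g. Adi (ctranspose g) (F g))"
  unfolding Adi_def ct_ct
  by (intro smooth_SU3_mm smooth_SU3_ct smooth_on_subset_id; assumption)+

lemma value_lift: "g \<in> SU3 \<Longrightarrow> X (coset g) = Adi (ctranspose g) (lift X g)"
  by (simp add: lift_def Adi_cancel)

lemma mfield_lift: assumes "vector_field X" shows "mfield (lift X)"
  unfolding mfield_def
proof (intro conjI ballI)
  show "smooth_SU3 (lift X)"
    unfolding lift_def using assms by (intro smooth_SU3_Adi) (auto simp: vector_field_def)
  show "lift X g \<in> \<mm>" if "g \<in> SU3" for g
    using assms tspace_coset[OF that] coset_flag[OF that] unfolding vector_field_def lift_def by blast
  show "lift X (g ** h) = Adi h (lift X g)" if "g \<in> SU3" "h \<in> torus" for g h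
    using that by (simp add: lift_def coset_torus Adi_Adi)
qed

lemmas lift_smooth = mfield_smooth[OF mfield_lift]
  and lift_m = mfield_m[OF mfield_lift]
  and lift_su3 = mfield_su3[OF mfield_lift]
  and lift_torus = mfield_torus[OF mfield_lift]

lemma drop_coset:
  assumes "mfield \<phi>" "g \<in> SU3"
  shows "drop \<phi> (coset g) = Adi (ctranspose g) (\<phi> g)"
proof -
  have "(SOME k. k \<in> coset g) \<in> coset g" by (rule someI[of _ g]) simp
  then obtain h where h: "h \<in> torus" "(SOME k. k \<in> coset g) = g ** h" by (rule mem_cosetE)
  then show ?thesis
    using assms by (simp add: drop_def mfield_torus Adi_Adi ct_mm matrix_mul_assoc SU3_mm_ct torus_SU3)
qed

lemma lift_drop: "mfield \<phi> \<Longrightarrow> g \<in> SU3 \<Longrightarrow> lift (drop \<phi>) g = \<phi> g"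
  by (simp add: lift_def drop_coset Adi_cancel)

lemma vector_field_drop: assumes "mfield \<phi>" shows "vector_field (drop \<phi>)"
  unfolding vector_field_def
proof (intro conjI ballI allI impI)
  fix p assume "p \<in> flag"
  then obtain g where "g \<in> SU3" "p = coset g" by (rule flagE)
  then show "drop \<phi> p \<in> tspace p"
    using assms by (simp add: tspace_coset drop_coset Adi_cancel mfield_m)
next
  show "smooth_SU3 (\<lambda>g. drop \<phi> (coset g))"
    by (rule smooth_on_subset_cong[OF _ smooth_SU3_Adi(2)[OF mfield_smooth[OF assms]]])
      (simp add: drop_coset[OF assms])
qed (simp add: drop_def)

lemma vector_field_eqI:
  assumes "vector_field X" "vector_field Y" "\<And>g. g \<in> SU3 \<Longrightarrow> lift X g = lift Y g"
  shows "X = Y"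
proof
  fix p
  show "X p = Y p"
  proof (cases "p \<in> flag")
    case True
    then obtain g where "g \<in> SU3" "p = coset g" by (rule flagE)
    then show ?thesis using assms(3) value_lift by metis
  qed (use assms in \<open>simp add: vector_field_def\<close>)
qed

lemma mfield_add: "mfield \<phi> \<Longrightarrow> mfield \<psi> \<Longrightarrow> mfield (\<lambda>g. \<phi> g + \<psi> g)"
  unfolding mfield_def by (auto simp: Adi_simps intro: smooth_on_subset_add subspace_add[OF subspace_m])

lemma mfield_diff: "mfield \<phi> \<Longrightarrow> mfield \<psi> \<Longrightarrow> mfield (\<lambda>g. \<phi> g - \<psi> g)"
  unfolding mfield_def by (auto simp: Adi_simps intro: smooth_on_subset_diff subspace_diff[OF subspace_m])

text \<open>Right translation by the torus turns the direction of differentiation by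
  \<open>Adi h\<close>, and \<psi> turns in the same way, so the result is again equivariant. This
  operation is the canonical connection of the reductive decomposition.\<close>

lemma mfield_Rd: assumes \<phi>: "mfield \<phi>" and \<psi>: "mfield \<psi>" shows "mfield (\<lambda>g. Rd \<phi> (\<psi> g) g)"
  unfolding mfield_def
proof (intro conjI ballI)
  show "smooth_SU3 (\<lambda>g. Rd \<phi> (\<psi> g) g)"
    by (rule Rd_smooth[OF mfield_smooth[OF \<phi>] mfield_smooth[OF \<psi>] mfield_su3[OF \<psi>]])
  show "Rd \<phi> (\<psi> g) g \<in> \<mm>" if "g \<in> SU3" for g
    by (rule Rd_m[OF mfield_smooth[OF \<phi>] that mfield_su3[OF \<psi> that] mfield_m[OF \<phi>]])
  fix g h assume g: "g \<in> SU3" and h: "h \<in> torus"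
  have "Rd \<phi> (\<psi> (g ** h)) (g ** h) = Rd (\<lambda>g. \<phi> (g ** h)) (\<psi> g) g"
    using Rd_right[OF torus_SU3[OF h] mfield_smooth[OF \<phi>] g mfield_su3[OF \<psi> g]]
    by (simp add: mfield_torus[OF \<psi> g h])
  also have "\<dots> = Rd (\<lambda>g. Adi h (\<phi> g)) (\<psi> g) g"
    by (rule Rd_cong[OF _ g mfield_su3[OF \<psi> g]]) (simp add: mfield_torus[OF \<phi> _ h])
  also have "\<dots> = Adi h (Rd \<phi> (\<psi> g) g)"
    by (rule Rd_linear[OF bounded_linear_Adi mfield_smooth[OF \<phi>] g mfield_su3[OF \<psi> g]])
  finally show "Rd \<phi> (\<psi> (g ** h)) (g ** h) = Adi h (Rd \<phi> (\<psi> g) g)" .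
qed

text \<open>Products on \<open>\<mm>\<close> are extended to all matrices, so that they are bounded bilinear maps in
  the sense of the library; only their values on \<open>\<mm>\<close> matter.\<close>

definition m_product :: "(cmat \<Rightarrow> cmat \<Rightarrow> cmat) \<Rightarrow> bool" where
  "m_product L \<longleftrightarrow> bounded_bilinear L \<and> (\<forall>x\<in>\<mm>. \<forall>y\<in>\<mm>. L x y \<in> \<mm>) \<and>
     (\<forall>h\<in>torus. \<forall>x\<in>\<mm>. \<forall>y\<in>\<mm>. L (Adi h x) (Adi h y) = Adi h (L x y))"

lemma mfield_product:
  assumes "m_product L" "mfield \<phi>" "mfield \<psi>" shows "mfield (\<lambda>g. L (\<phi> g) (\<psi> g))"
  using assms unfolding mfield_def m_product_def by (auto intro: smooth_on_subset_bilinear)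

lemma m_product_lie: "m_product (\<lambda>x y. m_part (lie x y))"
proof -
  have "bounded_bilinear (\<lambda>x y. m_part (lie x y))"
    unfolding bilinear_conv_bounded_bilinear[symmetric] bilinear_def
    using bounded_bilinear_lie unfolding bilinear_conv_bounded_bilinear[symmetric] bilinear_def
    by (auto intro: linear_compose[OF _ m_part_linear, unfolded o_def])
  then show ?thesis by (simp add: m_product_def lie_Adi torus_SU3 m_part_Adi)
qed

subsection \<open>Differentiating functions and fields along torus orbits\<close>

text \<open>exp(tx) g leaves g with velocity x g = g (g^-1 x g): the action from the left becomes a
  left-invariant derivative in the direction \<open>Adi g x\<close>.\<close>

lemma dir_deriv_coset:
  assumes f: "smooth_fun f" and g: "g \<in> SU3" and x: "x \<in> su3"
  shows "dir_deriv x f (coset g) = Rd (\<lambda>g. f (coset g)) (Adi g x) g"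
proof -
  have "((\<lambda>t. f (coset (mexp (t *\<^sub>R x) ** g))) has_vector_derivative Rd (\<lambda>g. f (coset g)) (Adi g x) g) (at 0)"
  proof (rule Rd_curve)
    show "mexp (0 *\<^sub>R x) ** g = g" by (simp only: mexp_zero matrix_mul_lid)
    show "((\<lambda>t. mexp (t *\<^sub>R x) ** g) has_vector_derivative g ** Adi g x) (at 0)"
      using exp_curve_deriv_left[of x g] by (simp add: mm_Adi[OF g])
  qed (use assms in \<open>auto simp: SU3_mult mexp_SU3 Adi_su3 smooth_fun_def\<close>)
  then show ?thesis
    unfolding dir_deriv_def act_coset has_real_derivative_iff_has_vector_derivative[symmetric]
    by (rule DERIV_imp_deriv)
qed

lemma vf_app_coset:
  assumes "vector_field X" "smooth_fun f" "g \<in> SU3"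
  shows "vf_app X f (coset g) = Rd (\<lambda>g. f (coset g)) (lift X g) g"
proof -
  have "X (coset g) \<in> su3"
    using value_lift[OF assms(3), of X] Adi_su3[OF SU3_ct[OF assms(3)] lift_su3[OF assms(1,3)]] by simp
  then show ?thesis unfolding vf_app_def by (simp add: dir_deriv_coset assms lift_def)
qed

lemma smooth_fun_vf_app:
  assumes "vector_field X" "smooth_fun f" shows "smooth_fun (vf_app X f)"
  unfolding smooth_fun_def
  by (rule smooth_on_subset_cong[OF vf_app_coset[OF assms, symmetric]], assumption,
      rule Rd_smooth[OF _ lift_smooth[OF assms(1)] lift_su3[OF assms(1)]])
    (use assms(2) in \<open>simp_all add: smooth_fun_def\<close>)

lemma diag_curve_torus:
  assumes "x \<in> su3" shows "mexp (t *\<^sub>R (x - m_part x)) \<in> torus"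
proof (rule mexp_torus)
  show "x - m_part x \<in> su3"
    by (intro subspace_diff subspace_su3 assms m_su3 m_part_in_m)
qed (simp add: m_part_su3 assms proj_m_def)

text \<open>Moving by the exponential of a diagonal matrix does not leave the coset, so functions on
  the flag manifold do not see the diagonal part.\<close>

lemma Rd_fun_m_part:
  assumes f: "smooth_fun f" and g: "g \<in> SU3" and x: "x \<in> su3"
  shows "Rd (\<lambda>g. f (coset g)) (m_part x) g = Rd (\<lambda>g. f (coset g)) x g"
proof -
  have "Rd (\<lambda>g. f (coset g)) (x - m_part x) g = 0"
    by (rule Rd_I) (simp add: coset_torus diag_curve_torus x)
  then show ?thesis
    using Rd_diff_arg[of "\<lambda>g. f (coset g)" g x "m_part x"] assms m_su3[OF m_part_in_m]
    by (simp add: smooth_fun_def)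
qed

text \<open>Unlike functions, equivariant maps turn along the torus: \<phi> at g exp(tw) is
  \<open>Adi\<close> of exp(tw) applied to \<open>\<phi> g\<close>, with derivative
  \<open>- lie w (\<phi> g)\<close>. This is the source of the isotropy term in the
  curvature.\<close>

lemma Rd_mfield_m_part:
  assumes \<phi>: "mfield \<phi>" and g: "g \<in> SU3" and x: "x \<in> su3"
  shows "Rd \<phi> x g = Rd \<phi> (m_part x) g - lie (x - m_part x) (\<phi> g)"
proof -
  let ?w = "x - m_part x"
  have w: "?w \<in> su3" by (intro subspace_diff subspace_su3 x m_su3 m_part_in_m)
  have e0: "mexp (0 *\<^sub>R ?w) = mat 1" by (rule mexp_zero)
  have "((\<lambda>t. mexp (t *\<^sub>R ?w)) has_vector_derivative ?w) (at 0)"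
    using exp_curve_deriv[of "mat 1" ?w] by simp
  then have "((\<lambda>t. (ctranspose (mexp (t *\<^sub>R ?w)) ** \<phi> g) ** mexp (t *\<^sub>R ?w)) has_vector_derivative
      (ctranspose (mexp (0 *\<^sub>R ?w)) ** \<phi> g) ** ?w + (ctranspose ?w ** \<phi> g) ** mexp (0 *\<^sub>R ?w)) (at 0)"
    by (intro bounded_bilinear.has_vector_derivative[OF bounded_bilinear_mm]
        bounded_linear.has_vector_derivative[OF bounded_bilinear.bounded_linear_left[OF bounded_bilinear_mm]]
        bounded_linear.has_vector_derivative[OF bounded_linear_ct])
  moreover have "ctranspose ?w = - ?w" using w by (simp add: su3_def)
  ultimately have "((\<lambda>t. Adi (mexp (t *\<^sub>R ?w)) (\<phi> g)) has_vector_derivative - lie ?w (\<phi> g)) (at 0)"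
    unfolding e0 Adi_def by (simp only: lie_def mm_simps ct_mat1 matrix_mul_lid matrix_mul_rid)
      (simp add: algebra_simps)
  then have "Rd \<phi> ?w g = - lie ?w (\<phi> g)"
    by (intro Rd_I) (simp add: mfield_torus[OF \<phi> g] diag_curve_torus x)
  then show ?thesis
    using Rd_diff_arg[OF mfield_smooth[OF \<phi>] g x m_su3[OF m_part_in_m]] by (simp add: algebra_simps)
qed

subsection \<open>Smooth functions separate tangent vectors\<close>

text \<open>Components of the map gT \<mapsto> g X0 g^-1 onto the adjoint orbit of
  \<open>X0\<close>, well defined because the torus commutes with \<open>X0\<close>.\<close>

definition orbit_fun :: "cmat \<Rightarrow> point \<Rightarrow> real" where
  "orbit_fun b p = Adi (ctranspose (SOME g. g \<in> p)) X0 \<bullet> b"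

lemma Adi_torus_X0: "h \<in> torus \<Longrightarrow> Adi h X0 = X0"
  using torus_norm[of h] by (auto simp: vec_eq_iff Adi_torus_nth X0_def mult.commute mult.left_commute)

lemma orbit_fun_coset: "g \<in> SU3 \<Longrightarrow> orbit_fun b (coset g) = Adi (ctranspose g) X0 \<bullet> b"
proof -
  assume g: "g \<in> SU3"
  have "(SOME k. k \<in> coset g) \<in> coset g" by (rule someI[of _ g]) simp
  then obtain h where h: "h \<in> torus" "(SOME k. k \<in> coset g) = g ** h" by (rule mem_cosetE)
  have "Adi (ctranspose (g ** h)) X0 = Adi (ctranspose g) (Adi (ctranspose h) X0)"
    by (simp add: Adi_Adi ct_mm)
  then show ?thesis by (simp add: orbit_fun_def h torus_ct Adi_torus_X0)
qed

lemma smooth_orbit: "smooth_SU3 (\<lambda>g. Adi (ctranspose g) X0)"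
  by (intro smooth_SU3_Adi smooth_on_subset_const)

lemma smooth_orbit_fun: "smooth_fun (orbit_fun b)"
  unfolding smooth_fun_def
  by (rule smooth_on_subset_cong[OF _ smooth_on_subset_linear[OF bounded_linear_inner_left smooth_orbit]])
    (simp add: orbit_fun_coset)

text \<open>The orbit map has derivative g [x, X0] g^-1 along \<open>x\<close>. Entry (i,j) of the
  bracket is \<open>x $ i $ j\<close> times a difference of two diagonal entries of
  \<open>X0\<close>, and these entries \<i>, -\<i>, 0 are distinct.\<close>

lemma separation:
  assumes x: "x \<in> \<mm>" and g: "g \<in> SU3"
    and z: "\<And>f. smooth_fun f \<Longrightarrow> Rd (\<lambda>g. f (coset g)) x g = 0"
  shows "x = 0"
proof -
  note xs = m_su3[OF x]
  have "Rd (\<lambda>g. Adi (ctranspose g) X0) x g = 0"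
  proof (rule euclidean_eqI)
    fix b :: cmat
    have "Rd (\<lambda>g. Adi (ctranspose g) X0) x g \<bullet> b = Rd (\<lambda>g. Adi (ctranspose g) X0 \<bullet> b) x g"
      by (rule Rd_linear[symmetric, OF bounded_linear_inner_left smooth_orbit g xs])
    also have "\<dots> = Rd (\<lambda>g. orbit_fun b (coset g)) x g"
      by (rule Rd_cong[OF _ g xs]) (simp add: orbit_fun_coset)
    finally show "Rd (\<lambda>g. Adi (ctranspose g) X0) x g \<bullet> b = 0 \<bullet> b"
      using z[OF smooth_orbit_fun] by simp
  qed
  moreover have "Rd (\<lambda>g. Adi (ctranspose g) X0) x g = Adi (ctranspose g) (lie x X0)"
  proof -
    have "Rd (\<lambda>g. (g ** X0) ** ctranspose g) x g
        = (g ** X0) ** ctranspose (g ** x) + (g ** x) ** X0 ** ctranspose g"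
      using g xs
      by (simp add: Rd_bilinear[OF bounded_bilinear_mm] Rd_linear[OF bounded_linear_ct] Rd_id
          smooth_SU3_ct smooth_SU3_mm smooth_on_subset_id smooth_on_subset_const mm_simps)
    also have "\<dots> = Adi (ctranspose g) (lie x X0)"
      using x by (simp add: m_iff Adi_def lie_def ct_mm mm_simps matrix_mul_assoc)
    finally show ?thesis by (simp add: Adi_def)
  qed
  ultimately have "Adi g (Adi (ctranspose g) (lie x X0)) = 0" by (simp add: Adi_simps)
  then have l: "lie x X0 = 0" by (simp add: Adi_cancel g)
  have "(x ** X0) $ i $ j = x $ i $ j * X0 $ j $ j" "(X0 ** x) $ i $ j = X0 $ i $ i * x $ i $ j" for i j
    using exhaust_3[of i] exhaust_3[of j] by (auto simp: mm_nth sum_3 X0_def)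
  then have "x $ i $ j * (X0 $ j $ j - X0 $ i $ i) = 0" for i j
    using arg_cong[OF l, of "\<lambda>m. m $ i $ j"] by (simp add: lie_def algebra_simps)
  moreover have "X0 $ j $ j - X0 $ i $ i \<noteq> 0" if "i \<noteq> j" for i j
    using that exhaust_3[of i] exhaust_3[of j] by (auto simp: X0_def complex_eq_iff)
  ultimately have "x $ i $ j = 0" for i j
    using x by (cases "i = j") (auto simp: m_iff)
  then show ?thesis by (simp add: vec_eq_iff)
qed

lemma separation_eq:
  assumes "x \<in> \<mm>" "y \<in> \<mm>" "g \<in> SU3"
    and "\<And>f. smooth_fun f \<Longrightarrow> Rd (\<lambda>g. f (coset g)) x g = Rd (\<lambda>g. f (coset g)) y g"
  shows "x = y"
proof -
  have "x - y = 0"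
    by (rule separation[of _ g])
      (use assms in \<open>auto simp: Rd_diff_arg m_su3 smooth_fun_def intro: subspace_diff[OF subspace_m]\<close>)
  then show ?thesis by simp
qed

subsection \<open>Brackets and fundamental fields\<close>

text \<open>The commutator of the two derivations is given by \<open>Rd_commutator\<close>;
  functions on the flag manifold see only the \<open>\<mm>\<close>-part of its \<open>lie\<close>
  term, and the other two terms lie in \<open>\<mm>\<close> already. By separation,
  \<open>drop \<phi>\<close> is then the only field that meets the definite description.\<close>

lemma
  assumes X: "vector_field X" and Y: "vector_field Y"
  shows vector_field_bracket: "vector_field (vf_bracket X Y)"
    and lift_bracket: "g \<in> SU3 \<Longrightarrow> lift (vf_bracket X Y) g =
      m_part (lie (lift X g) (lift Y g)) + Rd (lift Y) (lift X g) g - Rd (lift X) (lift Y g) g"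
proof -
  define \<phi> where "\<phi> g = m_part (lie (lift X g) (lift Y g)) + Rd (lift Y) (lift X g) g
    - Rd (lift X) (lift Y g) g" for g
  have \<phi>: "mfield \<phi>"
    unfolding \<phi>_def
    by (intro mfield_diff mfield_add mfield_Rd mfield_product[OF m_product_lie] mfield_lift X Y)
  have app2: "vf_app X (vf_app Y f) (coset g) = Rd (\<lambda>g. Rd (\<lambda>g. f (coset g)) (lift Y g) g) (lift X g) g"
    if "vector_field X" "vector_field Y" "smooth_fun f" "g \<in> SU3" for X Y f g
    unfolding vf_app_coset[OF that(1) smooth_fun_vf_app[OF that(2,3)] that(4)]
    by (rule Rd_cong[OF vf_app_coset[OF that(2,3)] that(4) lift_su3[OF that(1,4)]])
  have main: "vf_app X (vf_app Y f) (coset g) - vf_app Y (vf_app X f) (coset g)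
      = Rd (\<lambda>g. f (coset g)) (\<phi> g) g" if f: "smooth_fun f" and g: "g \<in> SU3" for f g
  proof -
    let ?l = "lie (lift X g) (lift Y g)"
    let ?r = "Rd (lift Y) (lift X g) g - Rd (lift X) (lift Y g) g"
    have fs: "smooth_SU3 (\<lambda>g. f (coset g))" using f by (simp add: smooth_fun_def)
    have l: "?l \<in> su3" by (intro lie_su3 lift_su3 X Y g)
    have r: "?r \<in> su3"
      by (intro subspace_diff subspace_su3 Rd_su3 lift_su3 lift_smooth X Y g)
    have "vf_app X (vf_app Y f) (coset g) - vf_app Y (vf_app X f) (coset g)
        = Rd (\<lambda>g. f (coset g)) (?l + Rd (lift Y) (lift X g) g - Rd (lift X) (lift Y g) g) g"
      unfolding app2[OF X Y f g] app2[OF Y X f g]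
      by (rule Rd_commutator[OF fs g lift_smooth[OF X] lift_su3[OF X] lift_smooth[OF Y] lift_su3[OF Y]])
    also have "\<dots> = Rd (\<lambda>g. f (coset g)) (?l + ?r) g" by (simp add: algebra_simps)
    also have "\<dots> = Rd (\<lambda>g. f (coset g)) (m_part ?l + ?r) g"
      by (simp add: Rd_add_arg[OF fs g] l r m_su3 Rd_fun_m_part[OF f g l])
    finally show ?thesis by (simp add: \<phi>_def algebra_simps)
  qed
  have "vf_bracket X Y = drop \<phi>"
    unfolding vf_bracket_def
  proof (rule the_equality)
    show "vector_field (drop \<phi>) \<and> (\<forall>f. smooth_fun f \<longrightarrow> (\<forall>p\<in>flag.
        vf_app (drop \<phi>) f p = vf_app X (vf_app Y f) p - vf_app Y (vf_app X f) p))"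
      by (auto simp: vector_field_drop[OF \<phi>] main vf_app_coset lift_drop[OF \<phi>] elim!: flagE)
    fix Z
    assume Z: "vector_field Z \<and> (\<forall>f. smooth_fun f \<longrightarrow> (\<forall>p\<in>flag.
        vf_app Z f p = vf_app X (vf_app Y f) p - vf_app Y (vf_app X f) p))"
    show "Z = drop \<phi>"
    proof (rule vector_field_eqI)
      fix g assume g: "g \<in> SU3"
      have "lift Z g = \<phi> g"
      proof (rule separation_eq[OF _ _ g])
        fix f assume "smooth_fun f"
        then show "Rd (\<lambda>g. f (coset g)) (lift Z g) g = Rd (\<lambda>g. f (coset g)) (\<phi> g) g"
          using Z g main[of f g] vf_app_coset[of Z f g] by simp
      qed (use Z g \<phi> lift_m mfield_m in auto)
      then show "lift Z g = lift (drop \<phi>) g" by (simp add: lift_drop \<phi> g)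
    qed (use Z \<phi> vector_field_drop in auto)
  qed
  then show "vector_field (vf_bracket X Y)" and "g \<in> SU3 \<Longrightarrow> lift (vf_bracket X Y) g =
      m_part (lie (lift X g) (lift Y g)) + Rd (lift Y) (lift X g) g - Rd (lift X) (lift Y g) g"
    using vector_field_drop[OF \<phi>] lift_drop[OF \<phi>] by (auto simp: \<phi>_def)
qed

lemma mfield_m_part_Adi: "mfield (\<lambda>g. m_part (Adi g x))"
  unfolding mfield_def
  by (auto intro!: smooth_on_subset_linear[OF bounded_linear_m_part] smooth_SU3_Adi smooth_on_subset_const
      simp: m_part_Adi[symmetric] Adi_Adi)

text \<open>Lifted form of the fundamental field, defined for every matrix so that \<open>x\<close>
  may run through \<open>Basis\<close>.\<close>

definition gen :: "cmat \<Rightarrow> vfield" where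
  "gen x = drop (\<lambda>g. m_part (Adi g x))"

lemma vector_field_gen [simp]: "vector_field (gen x)"
  by (simp add: gen_def vector_field_drop mfield_m_part_Adi)

lemma lift_gen: "g \<in> SU3 \<Longrightarrow> lift (gen x) g = m_part (Adi g x)"
  by (simp add: gen_def lift_drop mfield_m_part_Adi)

text \<open>On lifts, the derivative along a tangent vector \<open>v\<close> has direction
  \<open>Adi g v\<close>, the one along the orbit of exp(tx) has direction
  \<open>m_part (Adi g x)\<close>; separation makes the vector unique.\<close>

lemma fundamental_gen: assumes x: "x \<in> su3" shows "fundamental x = gen x"
proof
  fix p
  show "fundamental x p = gen x p"
  proof (cases "p \<in> flag")
    case True
    then obtain g where g: "g \<in> SU3" and p: "p = coset g" by (rule flagE)
    have d: "deriv (\<lambda>t. f (act (mexp (t *\<^sub>R x)) p)) 0 = Rd (\<lambda>g. f (coset g)) (m_part (Adi g x)) g"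
      if f: "smooth_fun f" for f
      using dir_deriv_coset[OF f g x] Rd_fun_m_part[OF f g Adi_su3[OF g x]]
      by (simp add: dir_deriv_def p)
    have dv: "dir_deriv v f p = Rd (\<lambda>g. f (coset g)) (Adi g v) g" "Adi g v \<in> \<mm>"
      if f: "smooth_fun f" and v: "v \<in> tspace p" for f v
    proof -
      show m: "Adi g v \<in> \<mm>" using v tspace_coset[OF g] by (simp add: p)
      have "v \<in> su3" using Adi_su3[OF SU3_ct[OF g] m_su3[OF m]] by (simp add: Adi_cancel g)
      then show "dir_deriv v f p = Rd (\<lambda>g. f (coset g)) (Adi g v) g"
        unfolding p by (rule dir_deriv_coset[OF f g])
    qed
    have gm: "Adi g (gen x p) = m_part (Adi g x)"
      using lift_gen[OF g, of x] by (simp add: lift_def p)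
    have t: "gen x p \<in> tspace p"
      using tspace_coset[OF g] gm by (simp add: p)
    have "(THE v. v \<in> tspace p \<and>
        (\<forall>f. smooth_fun f \<longrightarrow> dir_deriv v f p = deriv (\<lambda>t. f (act (mexp (t *\<^sub>R x)) p)) 0)) = gen x p"
    proof (rule the_equality)
      fix v assume v: "v \<in> tspace p \<and>
        (\<forall>f. smooth_fun f \<longrightarrow> dir_deriv v f p = deriv (\<lambda>t. f (act (mexp (t *\<^sub>R x)) p)) 0)"
      have "Adi g v = m_part (Adi g x)"
        by (rule separation_eq[OF dv(2)[OF smooth_orbit_fun] m_part_in_m g]) (use v d dv in auto)
      then have "Adi (ctranspose g) (Adi g v) = Adi (ctranspose g) (Adi g (gen x p))"
        by (simp add: gm)
      then show "v = gen x p" by (simp add: Adi_cancel g)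
    qed (use t d dv gm in auto)
    then show ?thesis using True by (simp add: fundamental_def)
  qed (simp add: fundamental_def gen_def drop_def)
qed

subsection \<open>Module operations\<close>

lemma lift_add: "lift (vf_add X Y) g = lift X g + lift Y g"
  by (simp add: lift_def vf_add_def Adi_simps)

lemma lift_smult: "lift (vf_smult f X) g = f (coset g) *\<^sub>R lift X g"
  by (simp add: lift_def vf_smult_def Adi_simps)

lemma tspace_subspace: assumes "p \<in> flag" shows "subspace (tspace p)"
proof -
  obtain g where g: "g \<in> SU3" "p = coset g" using assms by (rule flagE)
  then have "tspace p = Adi g -` \<mm>" using tspace_coset by blast
  then show ?thesis by (simp add: linear_subspace_vimage[OF Adi_linear subspace_m])
qed

lemma vector_field_add:
  "vector_field X \<Longrightarrow> vector_field Y \<Longrightarrow> vector_field (vf_add X Y)"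
  unfolding vector_field_def vf_add_def
  by (auto intro: smooth_on_subset_add subspace_add[OF tspace_subspace])

lemma vector_field_smult:
  "smooth_fun f \<Longrightarrow> vector_field X \<Longrightarrow> vector_field (vf_smult f X)"
  unfolding vector_field_def vf_smult_def smooth_fun_def
  by (auto intro: smooth_on_subset_bilinear[OF bounded_bilinear_scaleR] subspace_scale[OF tspace_subspace])

lemma act_flag: "a \<in> SU3 \<Longrightarrow> act a p \<in> flag \<longleftrightarrow> p \<in> flag"
proof -
  assume a: "a \<in> SU3"
  have "p \<in> flag \<Longrightarrow> act b p \<in> flag" if "b \<in> SU3" for b p
    using that by (auto elim!: flagE simp: SU3_mult)
  moreover have "act (ctranspose a) (act a p) = p"
    by (simp add: act_def image_image matrix_mul_assoc SU3_ct_mm a)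
  ultimately show ?thesis using a SU3_ct by metis
qed

lemma lift_push: "a \<in> SU3 \<Longrightarrow> lift (vf_push a X) g = lift X (ctranspose a ** g)"
  by (simp add: lift_def vf_push_def SU3_inv Ad_SU3 Adi_Adi)

lemma vector_field_push:
  assumes a: "a \<in> SU3" and X: "vector_field X" shows "vector_field (vf_push a X)"
proof -
  have m: "mfield (\<lambda>g. lift X (ctranspose a ** g))"
    unfolding mfield_def
    using smooth_SU3_left[OF SU3_ct[OF a] lift_smooth[OF X]] lift_m[OF X] lift_torus[OF X] SU3_mult[OF SU3_ct[OF a]]
    by (auto simp: matrix_mul_assoc)
  have "vf_push a X = drop (\<lambda>g. lift X (ctranspose a ** g))"
  proof
    fix p
    show "vf_push a X p = drop (\<lambda>g. lift X (ctranspose a ** g)) p"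
    proof (cases "p \<in> flag")
      case True
      then obtain g where g: "g \<in> SU3" "p = coset g" by (rule flagE)
      then show ?thesis
        using drop_coset[OF m g(1)] lift_push[OF a, of X g] value_lift[OF g(1), of "vf_push a X"] by simp
    next
      case False
      then have "X (act (matrix_inv a) p) = 0"
        using X act_flag[OF SU3_ct[OF a]] by (simp add: vector_field_def SU3_inv a)
      then show ?thesis using False by (simp add: vf_push_def drop_def Ad_SU3 a Adi_simps)
    qed
  qed
  then show ?thesis by (simp add: vector_field_drop m)
qed

text \<open>At each point of the flag manifold, \<open>gen\<close> is a linear projection of the
  matrix space onto the tangent space and so fixes \<open>X p\<close>. The fields
  \<open>gen b\<close> thus form an overcomplete global frame.\<close>

lemma field_expansion:
  assumes X: "vector_field X"
  shows "X = (\<lambda>p. \<Sum>b\<in>Basis. (X p \<bullet> b) *\<^sub>R gen b p)"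
proof
  fix p
  show "X p = (\<Sum>b\<in>Basis. (X p \<bullet> b) *\<^sub>R gen b p)"
  proof (cases "p \<in> flag")
    case True
    then obtain g where g: "g \<in> SU3" "p = coset g" by (rule flagE)
    define Q where "Q x = Adi (ctranspose g) (m_part (Adi g x))" for x
    have "linear Q"
      unfolding Q_def using linear_compose[OF linear_compose[OF Adi_linear m_part_linear] Adi_linear]
      by (simp add: o_def)
    moreover have "Q (X p) = X p"
      using lift_m[OF X g(1)] by (simp add: Q_def g lift_def m_part_id Adi_cancel)
    moreover have "gen b p = Q b" for b
      using value_lift[OF g(1), of "gen b"] by (simp add: lift_gen g Q_def)
    ultimately show ?thesis
      using euclidean_representation[of "X p"] by (metis (no_types, lifting) linear_scale linear_sum sum.cong)
  qed (use X in \<open>simp add: vector_field_def gen_def drop_def\<close>)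
qed

lemma smooth_fun_component: "vector_field X \<Longrightarrow> smooth_fun (\<lambda>p. X p \<bullet> b)"
  unfolding smooth_fun_def vector_field_def by (auto intro: smooth_on_subset_linear[OF bounded_linear_inner_left])

text \<open>The components of \<open>X\<close> in the global frame are smooth functions on the whole
  flag manifold; homogeneity evaluates them at \<open>p\<close>.\<close>

lemma tensorial:
  fixes T :: "vfield \<Rightarrow> 'a::real_vector"
  assumes add: "\<And>X Y. vector_field X \<Longrightarrow> vector_field Y \<Longrightarrow> T (vf_add X Y) = T X + T Y"
    and smult: "\<And>f X. smooth_fun f \<Longrightarrow> vector_field X \<Longrightarrow> T (vf_smult f X) = f p *\<^sub>R T X"
    and X: "vector_field X"
  shows "T X = (\<Sum>b\<in>Basis. (X p \<bullet> b) *\<^sub>R T (gen b))"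
proof -
  have "vector_field (\<lambda>p. \<Sum>b\<in>A. (X p \<bullet> b) *\<^sub>R gen b p) \<and>
      T (\<lambda>p. \<Sum>b\<in>A. (X p \<bullet> b) *\<^sub>R gen b p) = (\<Sum>b\<in>A. (X p \<bullet> b) *\<^sub>R T (gen b))" if "finite A" for A
    using that
  proof (induction A rule: finite_induct)
    case empty
    \<comment> \<open>Homogeneity with the zero function gives the value of \<open>T\<close> at the
      zero field.\<close>
    have "smooth_fun (\<lambda>_. 0)" by (simp add: smooth_fun_def smooth_on_subset_const)
    then show ?case
      using smult[of "\<lambda>_. 0" X] vector_field_smult[of "\<lambda>_. 0" X] X by (simp add: vf_smult_def)
  next
    case (insert b A)
    have "(\<lambda>p. \<Sum>b\<in>insert b A. (X p \<bullet> b) *\<^sub>R gen b p)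
        = vf_add (vf_smult (\<lambda>p. X p \<bullet> b) (gen b)) (\<lambda>p. \<Sum>b\<in>A. (X p \<bullet> b) *\<^sub>R gen b p)"
      using insert by (simp add: vf_add_def vf_smult_def fun_eq_iff)
    then show ?case
      using insert add smult smooth_fun_component[OF X, of b]
      by (simp add: vector_field_add vector_field_smult)
  qed
  from this[of Basis] show ?thesis using field_expansion[OF X] by simp
qed

lemma tensorial_cong:
  fixes T :: "vfield \<Rightarrow> 'a::real_vector"
  assumes "\<And>X Y. vector_field X \<Longrightarrow> vector_field Y \<Longrightarrow> T (vf_add X Y) = T X + T Y"
    and "\<And>f X. smooth_fun f \<Longrightarrow> vector_field X \<Longrightarrow> T (vf_smult f X) = f p *\<^sub>R T X"
    and "vector_field X" "vector_field Y" "X p = Y p"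
  shows "T X = T Y"
  using tensorial[of T p X] tensorial[of T p Y] assms by simp

section \<open>Invariant connections and products on \<open>\<mm>\<close>\<close>

text \<open>\<open>Rd\<close> alone is the canonical connection, and \<open>L\<close> is the tensor
  added to it. The default zero field is the value that \<open>connection\<close> prescribes on
  arguments that are not vector fields.\<close>

definition conn :: "(cmat \<Rightarrow> cmat \<Rightarrow> cmat) \<Rightarrow> vfield \<Rightarrow> vfield \<Rightarrow> vfield" where
  "conn L X Y = (if vector_field X \<and> vector_field Y
     then drop (\<lambda>g. Rd (lift Y) (lift X g) g + L (lift X g) (lift Y g)) else (\<lambda>_. 0))"

lemma m_product_bilinear: "m_product L \<Longrightarrow> bounded_bilinear L"
  and m_product_m: "m_product L \<Longrightarrow> x \<in> \<mm> \<Longrightarrow> y \<in> \<mm> \<Longrightarrow> L x y \<in> \<mm>"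
  by (simp_all add: m_product_def)

lemma m_product_zero: "m_product (\<lambda>_ _. 0)"
  unfolding m_product_def bilinear_conv_bounded_bilinear[symmetric] bilinear_def linear_iff
  by (simp add: Adi_simps subspace_0[OF subspace_m])

lemma mfield_conn:
  "m_product L \<Longrightarrow> vector_field X \<Longrightarrow> vector_field Y \<Longrightarrow>
    mfield (\<lambda>g. Rd (lift Y) (lift X g) g + L (lift X g) (lift Y g))"
  by (rule mfield_add[OF mfield_Rd[OF mfield_lift mfield_lift] mfield_product[OF _ mfield_lift mfield_lift]])

lemma vector_field_conn:
  "m_product L \<Longrightarrow> vector_field X \<Longrightarrow> vector_field Y \<Longrightarrow> vector_field (conn L X Y)"
  by (simp add: conn_def vector_field_drop mfield_conn)

lemma lift_conn:
  "m_product L \<Longrightarrow> vector_field X \<Longrightarrow> vector_field Y \<Longrightarrow> g \<in> SU3 \<Longrightarrow>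
    lift (conn L X Y) g = Rd (lift Y) (lift X g) g + L (lift X g) (lift Y g)"
  by (simp add: conn_def lift_drop[OF mfield_conn])

lemma conn_cong:
  assumes "\<And>x y. x \<in> \<mm> \<Longrightarrow> y \<in> \<mm> \<Longrightarrow> L x y = L' x y" "m_product L" "m_product L'"
  shows "conn L = conn L'"
proof (intro ext)
  fix X Y p
  have "conn L X Y = conn L' X Y" if "vector_field X" "vector_field Y"
    by (rule vector_field_eqI) (use that assms in \<open>simp_all add: vector_field_conn lift_conn lift_m\<close>)
  then show "conn L X Y p = conn L' X Y p" by (auto simp: conn_def)
qed

lemma lift_push_fun: "a \<in> SU3 \<Longrightarrow> lift (vf_push a X) = (\<lambda>g. lift X (ctranspose a ** g))"
  by (simp add: fun_eq_iff lift_push)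

lemma connection_conn: assumes L: "m_product L" shows "connection (conn L)"
proof -
  interpret L: bounded_bilinear L by (rule m_product_bilinear[OF L])
  note vf = vector_field_conn[OF L] vector_field_add vector_field_smult smooth_fun_vf_app
  show ?thesis
    unfolding connection_def
  proof (intro conjI allI impI)
    fix X X' Y assume v: "vector_field X" "vector_field X'" "vector_field Y"
    show "conn L (vf_add X X') Y = vf_add (conn L X Y) (conn L X' Y)"
      by (rule vector_field_eqI)
        (use v in \<open>simp_all add: vf lift_conn[OF L] lift_add Rd_add_arg lift_smooth lift_su3 L.add_left\<close>)
  next
    fix X Y Y' assume v: "vector_field X" "vector_field Y" "vector_field Y'"
    show "conn L X (vf_add Y Y') = vf_add (conn L X Y) (conn L X Y')"
      by (rule vector_field_eqI)
        (use v in \<open>simp_all add: vf lift_conn[OF L] lift_add[abs_def] Rd_add lift_smooth lift_su3 L.add_right\<close>)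
  next
    fix f X Y assume v: "smooth_fun f" "vector_field X" "vector_field Y"
    show "conn L (vf_smult f X) Y = vf_smult f (conn L X Y)"
      by (rule vector_field_eqI)
        (use v in \<open>simp_all add: vf lift_conn[OF L] lift_smult Rd_scaleR_arg lift_smooth lift_su3
          L.scaleR_left scaleR_add_right\<close>)
    show "conn L X (vf_smult f Y) = vf_add (vf_smult (vf_app X f) Y) (vf_smult f (conn L X Y))"
    proof (rule vector_field_eqI)
      fix g assume g: "g \<in> SU3"
      have "Rd (\<lambda>g. f (coset g) *\<^sub>R lift Y g) (lift X g) g
          = f (coset g) *\<^sub>R Rd (lift Y) (lift X g) g + Rd (\<lambda>g. f (coset g)) (lift X g) g *\<^sub>R lift Y g"
        by (rule Rd_bilinear[OF bounded_bilinear_scaleR])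
          (use v g in \<open>simp_all add: smooth_fun_def lift_smooth lift_su3\<close>)
      then show "lift (conn L X (vf_smult f Y)) g
          = lift (vf_add (vf_smult (vf_app X f) Y) (vf_smult f (conn L X Y))) g"
        using v g by (simp add: vf lift_conn[OF L] lift_add lift_smult[abs_def] vf_app_coset
            L.scaleR_right scaleR_add_right)
    qed (use v in \<open>simp_all add: vf\<close>)
  qed (use vf in \<open>auto simp: conn_def\<close>)
qed

lemma invariant_connection_conn: assumes L: "m_product L" shows "invariant_connection (conn L)"
  unfolding invariant_connection_def
proof (intro conjI allI impI connection_conn L)
  fix a X Y assume v: "a \<in> SU3" "vector_field X" "vector_field Y"
  show "conn L (vf_push a X) (vf_push a Y) = vf_push a (conn L X Y)"
    by (rule vector_field_eqI)
      (use v in \<open>simp_all add: vector_field_conn[OF L] vector_field_push lift_conn[OF L] lift_push_fun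
        SU3_mult SU3_ct Rd_left\<close>)
qed

lemma connection_vector_field:
  "connection D \<Longrightarrow> vector_field X \<Longrightarrow> vector_field Y \<Longrightarrow> vector_field (D X Y)"
  by (simp add: connection_def)

lemma invariant_connection_connection: "invariant_connection D \<Longrightarrow> connection D"
  by (simp add: invariant_connection_def)

lemma invariant_connection_push:
  "invariant_connection D \<Longrightarrow> a \<in> SU3 \<Longrightarrow> vector_field X \<Longrightarrow> vector_field Y \<Longrightarrow>
    D (vf_push a X) (vf_push a Y) = vf_push a (D X Y)"
  by (simp add: invariant_connection_def)

lemma value_base: "X base = lift X (mat 1)"
  using value_lift[OF SU3_one, of X] by (simp add: base_def)

lemma gen_base: "x \<in> \<mm> \<Longrightarrow> gen x base = x"
  by (simp add: value_base lift_gen m_part_id)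

lemma Rd_Adi:
  assumes "g \<in> SU3" "y \<in> su3" shows "Rd (\<lambda>g. Adi g x) y g = lie (Adi g x) y"
proof -
  have "Rd (\<lambda>g. (ctranspose g ** x) ** g) y g
      = (ctranspose g ** x) ** (g ** y) + (ctranspose (g ** y) ** x) ** g"
    using assms
    by (simp add: Rd_bilinear[OF bounded_bilinear_mm] Rd_linear[OF bounded_linear_ct] Rd_id
        smooth_SU3_ct smooth_SU3_mm smooth_on_subset_id smooth_on_subset_const mm_simps)
  then show ?thesis
    using assms by (simp add: Adi_def lie_def su3_def ct_mm mm_simps matrix_mul_assoc)
qed

lemma Rd_lift_gen:
  assumes "g \<in> SU3" "y \<in> su3" shows "Rd (lift (gen x)) y g = m_part (lie (Adi g x) y)"
proof -
  have "Rd (lift (gen x)) y g = Rd (\<lambda>g. m_part (Adi g x)) y g"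
    by (rule Rd_cong[OF lift_gen assms])
  also have "\<dots> = m_part (Rd (\<lambda>g. Adi g x) y g)"
    by (rule Rd_linear[OF bounded_linear_m_part _ assms]) (intro smooth_SU3_Adi smooth_on_subset_const)
  finally show ?thesis by (simp add: Rd_Adi assms)
qed

text \<open>At the base point the derivative term of the connection is
  \<open>m_part (lie y x)\<close>. In the bracket, \<open>m_part (lie x y)\<close> cancels against
  one derivative term and the same \<open>m_part (lie y x)\<close> remains, so the difference is
  \<open>L x y\<close>.\<close>

lemma conn_product_conn:
  assumes L: "m_product L" and x: "x \<in> \<mm>" and y: "y \<in> \<mm>"
  shows "conn_product (conn L) x y = L x y"
  unfolding conn_product_def fundamental_gen[OF m_su3[OF x]] fundamental_gen[OF m_su3[OF y]] value_base
  using x y by (simp add: lift_conn[OF L] lift_bracket lift_gen Rd_lift_gen m_su3 m_part_id)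

section \<open>Invariant connections correspond to products\<close>

text \<open>By transitivity: the lift of \<open>D X Y\<close> at \<open>g\<close> is the value at
  the base point of \<open>D\<close> on the fields pushed forward by the inverse of
  \<open>g\<close>.\<close>

lemma invariant_connection_eqI:
  assumes D: "invariant_connection D" and D': "invariant_connection D'"
    and base: "\<And>X Y. vector_field X \<Longrightarrow> vector_field Y \<Longrightarrow> D X Y base = D' X Y base"
  shows "D = D'"
proof (intro ext)
  fix X Y p
  show "D X Y p = D' X Y p"
  proof (cases "vector_field X \<and> vector_field Y")
    case True
    have DD: "lift (D X Y) g = D (vf_push (ctranspose g) X) (vf_push (ctranspose g) Y) base"
      if "invariant_connection D" "g \<in> SU3" for D g
    proof -
      have "D (vf_push (ctranspose g) X) (vf_push (ctranspose g) Y) = vf_push (ctranspose g) (D X Y)"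
        using that True SU3_ct by (simp add: invariant_connection_push)
      then show ?thesis using lift_push[OF SU3_ct[OF that(2)]] by (simp add: value_base)
    qed
    have "D X Y = D' X Y"
    proof (rule vector_field_eqI)
      show "vector_field (D X Y)" "vector_field (D' X Y)"
        using D D' True by (simp_all add: connection_vector_field invariant_connection_connection)
      show "lift (D X Y) g = lift (D' X Y) g" if g: "g \<in> SU3" for g
        unfolding DD[OF D g] DD[OF D' g]
        by (intro base vector_field_push SU3_ct g) (use True in auto)
    qed
    then show ?thesis by simp
  next
    case False
    then have "D X Y = (\<lambda>_. 0)" "D' X Y = (\<lambda>_. 0)"
      using D D' by (simp_all add: invariant_connection_def connection_def)
    then show ?thesis by simp
  qed
qed

lemma gen_add: "gen (x + y) = vf_add (gen x) (gen y)"
  by (rule vector_field_eqI)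
    (simp_all add: vector_field_add lift_gen lift_add Adi_simps linear_add[OF m_part_linear])

lemma gen_scaleR: "gen (c *\<^sub>R x) = vf_smult (\<lambda>_. c) (gen x)"
  by (rule vector_field_eqI)
    (simp_all add: vector_field_smult lift_gen lift_smult Adi_simps linear_scale[OF m_part_linear]
      smooth_fun_def smooth_on_subset_const)

text \<open>The difference from the connection of the zero product is a tensor, hence given by a
  product on the tangent space at the base point.\<close>

lemma invariant_connection_conn_ex:
  assumes D: "invariant_connection D"
  obtains L where "m_product L" "D = conn L"
proof -
  define D0 where "D0 = conn (\<lambda>_ _. 0)"
  have D0: "invariant_connection D0" unfolding D0_def by (intro invariant_connection_conn m_product_zero)
  have c: "connection D" "connection D0" using D D0 by (auto simp: invariant_connection_def)
  define S where "S X Y = D X Y base - D0 X Y base" for X Y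
  have cl: "S (vf_add X X') Y = S X Y + S X' Y" "S Y (vf_add X X') = S Y X + S Y X'"
    if "vector_field X" "vector_field X'" "vector_field Y" for X X' Y
    using that c unfolding connection_def S_def by (simp_all add: vf_add_def)
  have cs: "S (vf_smult f X) Y = f base *\<^sub>R S X Y" "S Y (vf_smult f X) = f base *\<^sub>R S Y X"
    if "smooth_fun f" "vector_field X" "vector_field Y" for f X Y
    using that c unfolding connection_def S_def
    by (simp_all add: vf_add_def vf_smult_def scaleR_diff_right)
  \<comment> \<open>In the difference of two connections the Leibniz terms cancel, so
    \<open>S\<close> is linear over functions in both slots and depends only on values at
    \<open>base\<close>.\<close>
  have Scong: "S X Y = S X' Y'"
    if v: "vector_field X" "vector_field X'" "vector_field Y" "vector_field Y'"
      and b: "X base = X' base" "Y base = Y' base" for X X' Y Y'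
  proof -
    have "S X Y = S X' Y"
      by (rule tensorial_cong[where p = base and T = "\<lambda>X. S X Y"]) (use cl cs v b in auto)
    also have "\<dots> = S X' Y'"
      by (rule tensorial_cong[where p = base and T = "S X'"]) (use cl cs v b in auto)
    finally show ?thesis .
  qed
  define L where "L x y = S (gen x) (gen y)" for x y
  have cf: "smooth_fun (\<lambda>_. c)" for c by (simp add: smooth_fun_def smooth_on_subset_const)
  have bil: "bounded_bilinear L"
    unfolding bilinear_conv_bounded_bilinear[symmetric] bilinear_def L_def
    by (auto intro!: linearI simp: gen_add gen_scaleR cl cs cf)
  have vfD: "vector_field (D X Y)" "vector_field (D0 X Y)" if "vector_field X" "vector_field Y" for X Y
    using that c by (simp_all add: connection_vector_field)
  have Lm: "L x y \<in> \<mm>" for x y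
    unfolding L_def S_def value_base
    by (intro subspace_diff subspace_m lift_m vfD vector_field_gen SU3_one)
  \<comment> \<open>The torus fixes \<open>base\<close>: there \<open>gen (Adi h x)\<close> has the
    same value as the push-forward of \<open>gen x\<close> by the inverse of \<open>h\<close>, and
    the invariance of both connections applies.\<close>
  have inv: "L (Adi h x) (Adi h y) = Adi h (L x y)" if h: "h \<in> torus" for h x y
  proof -
    let ?k = "ctranspose h"
    have k: "?k \<in> SU3" and h': "h \<in> SU3" using h by (simp_all add: torus_SU3 SU3_ct)
    have gb: "gen (Adi h x) base = vf_push ?k (gen x) base" for x
      by (simp add: value_base lift_gen lift_push k h')
    have "L (Adi h x) (Adi h y) = S (vf_push ?k (gen x)) (vf_push ?k (gen y))"
      unfolding L_def by (rule Scong) (simp_all add: vector_field_push k gb)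
    also have "\<dots> = vf_push ?k (D (gen x) (gen y)) base - vf_push ?k (D0 (gen x) (gen y)) base"
      unfolding S_def using D D0 k by (simp add: invariant_connection_def)
    also have "\<dots> = lift (D (gen x) (gen y)) h - lift (D0 (gen x) (gen y)) h"
      by (simp add: value_base lift_push k)
    also have "\<dots> = Adi h (L x y)"
      using lift_torus[OF vfD(1)[of "gen x" "gen y"] SU3_one h]
        lift_torus[OF vfD(2)[of "gen x" "gen y"] SU3_one h]
      by (simp add: L_def S_def value_base Adi_simps)
    finally show ?thesis .
  qed
  have L: "m_product L" unfolding m_product_def using bil Lm inv by blast
  have "D = conn L"
  proof (rule invariant_connection_eqI[OF D invariant_connection_conn[OF L]])
    fix X Y assume v: "vector_field X" "vector_field Y"
    have m: "X base \<in> \<mm>" "Y base \<in> \<mm>" using v by (simp_all add: value_base lift_m)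
    have "S X Y = L (X base) (Y base)"
      unfolding L_def by (rule Scong) (use v m gen_base in auto)
    then show "D X Y base = conn L X Y base"
      using v by (simp add: S_def D0_def value_base lift_conn L m_product_zero algebra_simps)
  qed
  then show ?thesis using that L by blast
qed

lemma natural_connection_eqI:
  assumes L: "m_product L" "\<And>x y. x \<in> \<mm> \<Longrightarrow> y \<in> \<mm> \<Longrightarrow> natural_product x y = L x y"
  shows "natural_connection = conn L"
  unfolding natural_connection_def
proof (rule the_equality)
  show "invariant_connection (conn L) \<and>
      (\<forall>x\<in>\<mm>. \<forall>y\<in>\<mm>. conn_product (conn L) x y = natural_product x y)"
    using L by (simp add: invariant_connection_conn conn_product_conn)
  fix D assume D: "invariant_connection D \<and> (\<forall>x\<in>\<mm>. \<forall>y\<in>\<mm>. conn_product D x y = natural_product x y)"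
  then obtain L' where L': "m_product L'" "D = conn L'" using invariant_connection_conn_ex by metis
  show "D = conn L"
    unfolding L'(2) by (rule conn_cong[OF _ L'(1) L(1)]) (use D L L' in \<open>metis conn_product_conn\<close>)
qed

section \<open>Torsion and invariant tensors\<close>

text \<open>In \<open>conn L X Y - conn L Y X\<close> the derivative terms are exactly those of the
  bracket. One direction evaluates fields \<open>gen\<close> at the base point, the other uses that
  lifts take values in \<open>\<mm>\<close> everywhere.\<close>

lemma torsion_free_conn_iff:
  assumes L: "m_product L"
  shows "torsion_free (conn L) \<longleftrightarrow> (\<forall>x\<in>\<mm>. \<forall>y\<in>\<mm>. L x y - L y x = m_part (lie x y))"
proof
  assume t: "torsion_free (conn L)"
  show "\<forall>x\<in>\<mm>. \<forall>y\<in>\<mm>. L x y - L y x = m_part (lie x y)"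
  proof (intro ballI)
    fix x y assume x: "x \<in> \<mm>" and y: "y \<in> \<mm>"
    have "base \<in> flag" by (simp add: base_def)
    then have "conn L (gen x) (gen y) base - conn L (gen y) (gen x) base = vf_bracket (gen x) (gen y) base"
      using t unfolding torsion_free_def by simp
    then show "L x y - L y x = m_part (lie x y)"
      using x y by (simp add: value_base lift_conn[OF L] lift_bracket lift_gen m_part_id algebra_simps)
  qed
next
  assume t: "\<forall>x\<in>\<mm>. \<forall>y\<in>\<mm>. L x y - L y x = m_part (lie x y)"
  show "torsion_free (conn L)"
    unfolding torsion_free_def
  proof (intro allI impI ballI)
    fix X Y p assume v: "vector_field X" "vector_field Y" and "p \<in> flag"
    then obtain g where g: "g \<in> SU3" "p = coset g" by (auto elim: flagE)
    have "lift (conn L X Y) g - lift (conn L Y X) g = lift (vf_bracket X Y) g"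
      using t[rule_format, of "lift X g" "lift Y g"] v g
      by (simp add: lift_conn[OF L] lift_bracket lift_m algebra_simps)
    then have "Adi (ctranspose g) (lift (conn L X Y) g) - Adi (ctranspose g) (lift (conn L Y X) g)
        = Adi (ctranspose g) (lift (vf_bracket X Y) g)"
      by (simp only: Adi_simps[symmetric])
    then show "conn L X Y p - conn L Y X p = vf_bracket X Y p"
      by (simp only: value_lift[OF g(1)] g(2))
  qed
qed

text \<open>The form has constant coefficients on lifts, so the Leibniz terms of its derivative
  cancel against the derivative parts of the connection and only the action of \<open>L\<close>
  remains.\<close>

lemma cov_deriv_conn:
  assumes L: "m_product L" and \<beta>: "bounded_bilinear (\<beta> :: cmat \<Rightarrow> cmat \<Rightarrow> real)"
    and B: "\<And>X Y g. vector_field X \<Longrightarrow> vector_field Y \<Longrightarrow> g \<in> SU3 \<Longrightarrow>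
      B X Y (coset g) = \<beta> (lift X g) (lift Y g)"
    and v: "vector_field X" "vector_field Y" "vector_field Z" and g: "g \<in> SU3"
  shows "cov_deriv (conn L) B X Y Z (coset g) =
    - \<beta> (L (lift X g) (lift Y g)) (lift Z g) - \<beta> (lift Y g) (L (lift X g) (lift Z g))"
proof -
  interpret \<beta>: bounded_bilinear \<beta> by (rule \<beta>)
  have s: "smooth_SU3 (\<lambda>g. \<beta> (lift Y g) (lift Z g))"
    by (intro smooth_on_subset_bilinear[OF \<beta>] lift_smooth v)
  have "smooth_fun (B Y Z)"
    unfolding smooth_fun_def by (rule smooth_on_subset_cong[OF _ s]) (simp add: B v)
  then have "vf_app X (B Y Z) (coset g) = Rd (\<lambda>g. B Y Z (coset g)) (lift X g) g"
    by (rule vf_app_coset[OF v(1) _ g])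
  also have "\<dots> = Rd (\<lambda>g. \<beta> (lift Y g) (lift Z g)) (lift X g) g"
    by (rule Rd_cong[OF B[OF v(2,3)] g lift_su3[OF v(1) g]])
  also have "\<dots> = \<beta> (lift Y g) (Rd (lift Z) (lift X g) g) + \<beta> (Rd (lift Y) (lift X g) g) (lift Z g)"
    by (intro Rd_bilinear \<beta> lift_smooth lift_su3 v g)
  finally show ?thesis
    unfolding cov_deriv_def
    by (simp add: B v g vector_field_conn[OF L] lift_conn[OF L] \<beta>.add_left \<beta>.add_right)
qed

lemma tensor_parallel_conn_iff:
  assumes L: "m_product L" and \<beta>: "bounded_bilinear (\<beta> :: cmat \<Rightarrow> cmat \<Rightarrow> real)"
    and B: "\<And>X Y g. vector_field X \<Longrightarrow> vector_field Y \<Longrightarrow> g \<in> SU3 \<Longrightarrow>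
      B X Y (coset g) = \<beta> (lift X g) (lift Y g)"
  shows "tensor_parallel (conn L) B \<longleftrightarrow>
    (\<forall>x\<in>\<mm>. \<forall>y\<in>\<mm>. \<forall>z\<in>\<mm>. \<beta> (L x y) z + \<beta> y (L x z) = 0)"
proof
  assume t: "tensor_parallel (conn L) B"
  show "\<forall>x\<in>\<mm>. \<forall>y\<in>\<mm>. \<forall>z\<in>\<mm>. \<beta> (L x y) z + \<beta> y (L x z) = 0"
  proof (intro ballI)
    fix x y z assume "x \<in> \<mm>" "y \<in> \<mm>" "z \<in> \<mm>"
    then show "\<beta> (L x y) z + \<beta> y (L x z) = 0"
      using t[unfolded tensor_parallel_def, rule_format, of "gen x" "gen y" "gen z" "coset (mat 1)"]
      by (simp add: cov_deriv_conn[OF L \<beta> B] lift_gen m_part_id)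
  qed
next
  assume "\<forall>x\<in>\<mm>. \<forall>y\<in>\<mm>. \<forall>z\<in>\<mm>. \<beta> (L x y) z + \<beta> y (L x z) = 0"
  then have "- \<beta> (L x y) z - \<beta> y (L x z) = 0" if "x \<in> \<mm>" "y \<in> \<mm>" "z \<in> \<mm>" for x y z
    using that by (smt (verit))
  then show "tensor_parallel (conn L) B"
    unfolding tensor_parallel_def by (auto elim!: flagE simp: cov_deriv_conn[OF L \<beta> B] lift_m)
qed

section \<open>The symplectic form in lifted terms\<close>

lemma omega_torus: assumes h: "h \<in> torus" shows "\<omega> (Adi h x) (Adi h y) = \<omega> x y"
proof -
  have "X0 ** Adi h z = Adi h (X0 ** z)" for z
    using h Adi_torus_X0[OF torus_ct[OF h]]
    by (subst Adi_torus_X0[OF h, symmetric])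
      (simp add: Adi_def matrix_mul_assoc[symmetric] SU3_mm_ct_cancel torus_SU3)
  then show ?thesis by (simp add: \<omega>_def lie_Adi trace_Adi torus_SU3 h)
qed

lemma bounded_bilinear_omega: "bounded_bilinear \<omega>"
  unfolding bilinear_conv_bounded_bilinear[symmetric] bilinear_def
proof (intro conjI allI linearI)
  show "\<omega> x (y + z) = \<omega> x y + \<omega> x z" "\<omega> (y + z) x = \<omega> y x + \<omega> z x" for x y z
    by (simp_all add: \<omega>_def lie_def mm_simps trace_add trace_sub algebra_simps)
  have tr: "trace (c *\<^sub>R A) = c *\<^sub>R trace A" for c and A :: cmat
    by (simp add: trace_def scaleR_sum_right)
  show "\<omega> x (c *\<^sub>R y) = c *\<^sub>R \<omega> x y" "\<omega> (c *\<^sub>R y) x = c *\<^sub>R \<omega> y x" for c x y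
    by (simp_all add: \<omega>_def lie_def mm_simps trace_sub tr right_diff_distrib)
qed

lemma Omega_coset:
  assumes "vector_field X" "vector_field Y" and g: "g \<in> SU3"
  shows "\<Omega> X Y (coset g) = \<omega> (lift X g) (lift Y g)"
  unfolding \<Omega>_def
proof (rule the_equality)
  show "\<forall>k\<in>coset g. \<omega> (lift X g) (lift Y g) =
      \<omega> (Ad (matrix_inv k) (X (coset g))) (Ad (matrix_inv k) (Y (coset g)))"
  proof
    fix k assume "k \<in> coset g"
    then obtain h where h: "h \<in> torus" "k = g ** h" by (rule mem_cosetE)
    have "Ad (matrix_inv k) Z = Adi h (Adi g Z)" for Z
      using h g by (simp add: Ad_inv_SU3 SU3_mult torus_SU3 Adi_Adi)
    then show "\<omega> (lift X g) (lift Y g) =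
        \<omega> (Ad (matrix_inv k) (X (coset g))) (Ad (matrix_inv k) (Y (coset g)))"
      by (simp add: omega_torus[OF h(1)] lift_def)
  qed
  fix r assume "\<forall>k\<in>coset g. r = \<omega> (Ad (matrix_inv k) (X (coset g))) (Ad (matrix_inv k) (Y (coset g)))"
  then have "r = \<omega> (Ad (matrix_inv g) (X (coset g))) (Ad (matrix_inv g) (Y (coset g)))"
    using mem_coset_self by blast
  then show "r = \<omega> (lift X g) (lift Y g)" by (simp add: lift_def Ad_inv_SU3 g)
qed

lemma symplectic_conn_iff:
  assumes L: "m_product L"
  shows "symplectic_connection (conn L) \<longleftrightarrow>
    (\<forall>x\<in>\<mm>. \<forall>y\<in>\<mm>. L x y - L y x = m_part (lie x y)) \<and>
    (\<forall>x\<in>\<mm>. \<forall>y\<in>\<mm>. \<forall>z\<in>\<mm>. \<omega> (L x y) z + \<omega> y (L x z) = 0)"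
  unfolding symplectic_connection_def
  by (simp add: connection_conn L torsion_free_conn_iff
      tensor_parallel_conn_iff[OF L bounded_bilinear_omega Omega_coset])

section \<open>Curvature and Ricci tensor\<close>

text \<open>Nomizu's curvature formula for invariant connections. The last term is the isotropy
  action of the diagonal part of \<open>lie x y\<close>.\<close>

definition curv :: "(cmat \<Rightarrow> cmat \<Rightarrow> cmat) \<Rightarrow> cmat \<Rightarrow> cmat \<Rightarrow> cmat \<Rightarrow> cmat" where
  "curv L x y z = L x (L y z) - L y (L x z) - L (m_part (lie x y)) z - lie (lie x y - m_part (lie x y)) z"

lemma lift_conn_conn:
  assumes L: "m_product L" and v: "vector_field X" "vector_field Y" "vector_field Z" and g: "g \<in> SU3"
  shows "lift (conn L X (conn L Y Z)) g =
    Rd (\<lambda>g. Rd (lift Z) (lift Y g) g) (lift X g) g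
    + L (lift Y g) (Rd (lift Z) (lift X g) g) + L (Rd (lift Y) (lift X g) g) (lift Z g)
    + L (lift X g) (Rd (lift Z) (lift Y g) g) + L (lift X g) (L (lift Y g) (lift Z g))"
proof -
  interpret L: bounded_bilinear L by (rule m_product_bilinear[OF L])
  have x: "lift X g \<in> su3" by (rule lift_su3[OF v(1) g])
  have "Rd (lift (conn L Y Z)) (lift X g) g
      = Rd (\<lambda>g. Rd (lift Z) (lift Y g) g + L (lift Y g) (lift Z g)) (lift X g) g"
    by (rule Rd_cong[OF lift_conn[OF L v(2,3)] g x])
  also have "\<dots> = Rd (\<lambda>g. Rd (lift Z) (lift Y g) g) (lift X g) g
      + Rd (\<lambda>g. L (lift Y g) (lift Z g)) (lift X g) g"
    by (rule Rd_add[OF mfield_smooth[OF mfield_Rd[OF mfield_lift[OF v(3)] mfield_lift[OF v(2)]]]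
          smooth_on_subset_bilinear[OF m_product_bilinear[OF L] lift_smooth[OF v(2)] lift_smooth[OF v(3)]] g x])
  also have "Rd (\<lambda>g. L (lift Y g) (lift Z g)) (lift X g) g
      = L (lift Y g) (Rd (lift Z) (lift X g) g) + L (Rd (lift Y) (lift X g) g) (lift Z g)"
    by (rule Rd_bilinear[OF m_product_bilinear[OF L] lift_smooth[OF v(2)] lift_smooth[OF v(3)] g x])
  finally show ?thesis
    using v g by (simp add: lift_conn[OF L] vector_field_conn[OF L] L.add_right algebra_simps)
qed

text \<open>\<open>Rd_commutator\<close> yields the derivative along the full Lie bracket on the
  group, whereas the connection along \<open>vf_bracket X Y\<close> uses its
  \<open>\<mm>\<close>-part. The discrepancy is a torus direction, evaluated by
  \<open>Rd_mfield_m_part\<close>; all other derivative terms cancel.\<close>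

lemma lift_curvature:
  assumes L: "m_product L" and v: "vector_field X" "vector_field Y" "vector_field Z" and g: "g \<in> SU3"
  shows "lift (curvature (conn L) X Y Z) g = curv L (lift X g) (lift Y g) (lift Z g)"
proof -
  interpret L: bounded_bilinear L by (rule m_product_bilinear[OF L])
  let ?x = "lift X g" and ?y = "lift Y g" and ?z = "lift Z g"
  let ?r = "Rd (lift Y) ?x g - Rd (lift X) ?y g"
  have sm: "smooth_SU3 (lift Z)" by (rule lift_smooth[OF v(3)])
  have x: "?x \<in> su3" and y: "?y \<in> su3" by (intro lift_su3 v g)+
  have l: "lie ?x ?y \<in> su3" by (intro lie_su3 x y)
  have r: "?r \<in> su3" by (intro subspace_diff subspace_su3 Rd_su3 lift_su3 lift_smooth v g)
  have ml: "m_part (lie ?x ?y) \<in> su3" by (intro m_su3 m_part_in_m)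
  have "Rd (\<lambda>g. Rd (lift Z) (lift Y g) g) ?x g - Rd (\<lambda>g. Rd (lift Z) (lift X g) g) ?y g
      = Rd (lift Z) (lie ?x ?y + Rd (lift Y) ?x g - Rd (lift X) ?y g) g"
    by (rule Rd_commutator[OF sm g lift_smooth[OF v(1)] lift_su3[OF v(1)] lift_smooth[OF v(2)] lift_su3[OF v(2)]])
  also have "\<dots> = Rd (lift Z) (lie ?x ?y + ?r) g" by (simp add: algebra_simps)
  also have "\<dots> = Rd (lift Z) (m_part (lie ?x ?y) + ?r) g - lie (lie ?x ?y - m_part (lie ?x ?y)) ?z"
    using Rd_add_arg[OF sm g l r] Rd_add_arg[OF sm g ml r] Rd_mfield_m_part[OF mfield_lift[OF v(3)] g l]
    by simp
  finally have c: "Rd (\<lambda>g. Rd (lift Z) (lift Y g) g) ?x g = Rd (\<lambda>g. Rd (lift Z) (lift X g) g) ?y g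
      + (Rd (lift Z) (m_part (lie ?x ?y) + ?r) g - lie (lie ?x ?y - m_part (lie ?x ?y)) ?z)"
    by (simp add: algebra_simps)
  have b: "lift (vf_bracket X Y) g = m_part (lie ?x ?y) + ?r"
    using v g by (simp add: lift_bracket)
  have "lift (curvature (conn L) X Y Z) g = lift (conn L X (conn L Y Z)) g - lift (conn L Y (conn L X Z)) g
      - lift (conn L (vf_bracket X Y) Z) g"
    by (simp add: lift_def curvature_def Adi_simps)
  also have "lift (conn L (vf_bracket X Y) Z) g
      = Rd (lift Z) (m_part (lie ?x ?y) + ?r) g + L (m_part (lie ?x ?y) + ?r) ?z"
    using v g by (simp add: lift_conn[OF L] vector_field_bracket b)
  finally show ?thesis
    unfolding lift_conn_conn[OF L v(1,2,3) g] lift_conn_conn[OF L v(2,1,3) g] curv_def c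
    by (simp add: L.add_left L.diff_left algebra_simps)
qed

section \<open>Traces and the Ricci form\<close>

text \<open>\<open>trace_on\<close> uses an unspecified basis of \<open>V\<close> and a map
  controlled only on \<open>V\<close>. Composing the linear map \<open>A'\<close> with the
  projection \<open>P\<close> gives an endomorphism of the whole space with image in
  \<open>V\<close>, whose trace is that of \<open>A\<close> on \<open>V\<close>.\<close>

lemma trace_on_eq:
  assumes V: "subspace V" and P: "linear P" "\<And>z. P z \<in> V" "\<And>z. z \<in> V \<Longrightarrow> P z = z"
    and A': "linear A'" "\<And>z. z \<in> V \<Longrightarrow> A' z \<in> V" "\<And>z. z \<in> V \<Longrightarrow> A z = A' z"
  shows "trace_on V A = (\<Sum>b\<in>Basis. A' (P b) \<bullet> b)"
proof -
  define B where "B = (SOME B. independent B \<and> span B = V)"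
  have "\<exists>B. independent B \<and> span B = V"
    using basis_exists[of V] span_minimal[OF _ V] by (metis subset_antisym)
  then have B: "independent B" "span B = V"
    unfolding B_def by (rule someI2_ex, simp)+
  have fin: "finite B" by (rule independent_imp_finite[OF B(1)])
  define f where "f \<beta> w = representation B (A' (P w)) \<beta>" for \<beta> w
  have inV: "A' (P w) \<in> span B" for w using A' P B by simp
  have "linear (f \<beta>)" for \<beta>
    unfolding f_def
    by (auto intro!: linearI simp: linear_add[OF P(1)] linear_add[OF A'(1)] linear_scale[OF P(1)]
        linear_scale[OF A'(1)] representation_add[OF B(1)] representation_scale[OF B(1)] inV)
  have "(\<Sum>b\<in>Basis. A' (P b) \<bullet> b) = (\<Sum>b\<in>Basis. \<Sum>\<beta>\<in>B. f \<beta> b * (\<beta> \<bullet> b))"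
  proof (rule sum.cong[OF refl])
    fix b :: cmat
    have "A' (P b) = (\<Sum>\<beta>\<in>B. f \<beta> b *\<^sub>R \<beta>)"
      unfolding f_def by (rule sum_representation_eq[OF B(1) inV fin subset_refl, symmetric])
    then show "A' (P b) \<bullet> b = (\<Sum>\<beta>\<in>B. f \<beta> b * (\<beta> \<bullet> b))"
      by (simp add: inner_sum_left)
  qed
  also have "\<dots> = (\<Sum>\<beta>\<in>B. \<Sum>b\<in>Basis. f \<beta> b * (\<beta> \<bullet> b))" by (rule sum.swap)
  also have "\<dots> = (\<Sum>\<beta>\<in>B. representation B (A \<beta>) \<beta>)"
  proof (rule sum.cong[OF refl])
    fix \<beta> assume "\<beta> \<in> B"
    then have \<beta>: "\<beta> \<in> V" using B(2) span_base by blast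
    have "(\<Sum>b\<in>Basis. f \<beta> b * (\<beta> \<bullet> b)) = f \<beta> (\<Sum>b\<in>Basis. (\<beta> \<bullet> b) *\<^sub>R b)"
      unfolding linear_sum[OF \<open>\<And>\<beta>. linear (f \<beta>)\<close>] linear_scale[OF \<open>\<And>\<beta>. linear (f \<beta>)\<close>]
      by (simp add: mult.commute)
    also have "\<dots> = f \<beta> \<beta>" by (simp add: euclidean_representation)
    finally show "(\<Sum>b\<in>Basis. f \<beta> b * (\<beta> \<bullet> b)) = representation B (A \<beta>) \<beta>"
      using P(3)[OF \<beta>] A'(3)[OF \<beta>] by (simp add: f_def)
  qed
  finally show ?thesis by (simp add: trace_on_def B_def[symmetric])
qed

text \<open>Used to conjugate the Ricci endomorphism from the tangent space at gT back to
  \<open>\<mm>\<close>.\<close>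

lemma trace_commute:
  fixes F G :: "'a::euclidean_space \<Rightarrow> 'a"
  assumes F: "linear F" and G: "linear G"
  shows "(\<Sum>b\<in>Basis. F (G b) \<bullet> b) = (\<Sum>b\<in>Basis. G (F b) \<bullet> b)"
proof -
  have e: "H (K b) \<bullet> b = (\<Sum>c\<in>Basis. (K b \<bullet> c) * (H c \<bullet> b))" if "linear H" for H K :: "'a \<Rightarrow> 'a" and b
  proof -
    have "H (K b) = H (\<Sum>c\<in>Basis. (K b \<bullet> c) *\<^sub>R c)" by (simp add: euclidean_representation)
    then show ?thesis
      unfolding linear_sum[OF that] linear_scale[OF that] by (simp add: inner_sum_left)
  qed
  show ?thesis
    unfolding e[OF F, of G] e[OF G, of F] by (subst sum.swap) (simp add: mult.commute)
qed

definition ric :: "(cmat \<Rightarrow> cmat \<Rightarrow> cmat) \<Rightarrow> cmat \<Rightarrow> cmat \<Rightarrow> real" where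
  "ric L x y = (\<Sum>b\<in>Basis. curv L x (m_part b) y \<bullet> b)"

lemma curv_linear:
  assumes L: "bounded_bilinear L"
  shows "linear (\<lambda>x. curv L x y z)" "linear (\<lambda>y. curv L x y z)" "linear (\<lambda>z. curv L x y z)"
proof -
  interpret L: bounded_bilinear L by (rule L)
  interpret lie: bounded_bilinear lie by (rule bounded_bilinear_lie)
  note s = L.add_left L.add_right L.scaleR_left L.scaleR_right lie.add_left lie.add_right
    lie.scaleR_left lie.scaleR_right lie.diff_left linear_add[OF m_part_linear] linear_scale[OF m_part_linear]
  show "linear (\<lambda>x. curv L x y z)" "linear (\<lambda>y. curv L x y z)" "linear (\<lambda>z. curv L x y z)"
    unfolding curv_def by (auto intro!: linearI simp: s scaleR_diff_right)
qed

lemma bounded_bilinear_ric: assumes L: "bounded_bilinear L" shows "bounded_bilinear (ric L)"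
  unfolding bilinear_conv_bounded_bilinear[symmetric] bilinear_def ric_def
  by (auto intro!: linearI simp: linear_add[OF curv_linear(1)[OF L]] linear_scale[OF curv_linear(1)[OF L]]
      linear_add[OF curv_linear(3)[OF L]] linear_scale[OF curv_linear(3)[OF L]]
      inner_add_left sum.distrib sum_distrib_left)

lemma ricci_conn:
  assumes L: "m_product L" and v: "vector_field X" "vector_field Y" and g: "g \<in> SU3"
  shows "ricci (conn L) X Y (coset g) = ric L (lift X g) (lift Y g)"
proof -
  note Lb = m_product_bilinear[OF L]
  let ?V = "tspace (coset g)" and ?x = "lift X g" and ?y = "lift Y g" and ?c = "ctranspose g"
  define P where "P z = Adi ?c (m_part (Adi g z))" for z
  define F where "F z = Adi ?c (curv L ?x (m_part z) ?y)" for z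
  have linP: "linear P"
    unfolding P_def
    using linear_compose[OF linear_compose[OF Adi_linear m_part_linear] Adi_linear] by (simp add: o_def)
  have linF: "linear F"
    unfolding F_def
    using linear_compose[OF linear_compose[OF m_part_linear curv_linear(2)[OF Lb]] Adi_linear]
    by (simp add: o_def)
  have curvz: "curvature (conn L) X (SOME Z. vector_field Z \<and> Z (coset g) = z) Y (coset g) = F (Adi g z)
      \<and> F (Adi g z) \<in> ?V"
    if z: "z \<in> ?V" for z
  proof -
    have zm: "Adi g z \<in> \<mm>" using z tspace_coset[OF g] by simp
    \<comment> \<open>The chosen field is arbitrary, but \<open>gen z\<close> shows that one exists,
      and \<open>lift_curvature\<close> depends only on its value at the point.\<close>
    let ?Z = "SOME Z. vector_field Z \<and> Z (coset g) = z"
    have "gen z (coset g) = z"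
      using value_lift[OF g, of "gen z"] by (simp add: lift_gen g m_part_id zm Adi_cancel)
    then have Z: "vector_field ?Z \<and> ?Z (coset g) = z"
      by (intro someI[where P = "\<lambda>Z. vector_field Z \<and> Z (coset g) = z" and x = "gen z"]) simp
    then have lZ: "lift ?Z g = Adi g z" by (simp add: lift_def)
    have c: "lift (curvature (conn L) X ?Z Y) g = curv L ?x (Adi g z) ?y"
      using lift_curvature[OF L v(1) _ v(2) g, of ?Z] Z lZ by simp
    then have e: "curvature (conn L) X ?Z Y (coset g) = F (Adi g z)"
      using value_lift[OF g, of "curvature (conn L) X ?Z Y"] by (simp add: F_def m_part_id zm)
    have "curvature (conn L) X ?Z Y (coset g) \<in> ?V"
      unfolding curvature_def
      by (intro subspace_diff[OF tspace_subspace[OF coset_flag[OF g]]])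
        (use v Z g vector_field_conn[OF L] vector_field_bracket in \<open>auto simp: vector_field_def\<close>)
    then show ?thesis using e by simp
  qed
  have "ricci (conn L) X Y (coset g) = (\<Sum>b\<in>Basis. (\<lambda>z. F (Adi g z)) (P b) \<bullet> b)"
    unfolding ricci_def
  proof (rule trace_on_eq[OF tspace_subspace[OF coset_flag[OF g]] linP])
    show "P z \<in> ?V" for z using tspace_coset[OF g] by (simp add: P_def Adi_cancel g)
    show "P z = z" if "z \<in> ?V" for z
      using that tspace_coset[OF g] by (simp add: P_def m_part_id Adi_cancel g)
    show "linear (\<lambda>z. F (Adi g z))"
      using linear_compose[OF Adi_linear linF] by (simp add: o_def)
  qed (use curvz in auto)
  \<comment> \<open>The projection \<open>P\<close> is absorbed because \<open>F\<close> already
    contains \<open>m_part\<close>.\<close>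
  also have "\<dots> = (\<Sum>b\<in>Basis. F (Adi g b) \<bullet> b)"
    by (simp add: P_def F_def Adi_cancel g m_part_id)
  also have "\<dots> = (\<Sum>b\<in>Basis. Adi g (F b) \<bullet> b)"
    by (rule trace_commute[OF linF Adi_linear])
  finally show ?thesis by (simp add: F_def Adi_cancel g ric_def)
qed

lemma ricci_parallel_conn_iff:
  assumes L: "m_product L"
  shows "ricci_parallel (conn L) \<longleftrightarrow>
    (\<forall>x\<in>\<mm>. \<forall>y\<in>\<mm>. \<forall>z\<in>\<mm>. ric L (L x y) z + ric L y (L x z) = 0)"
  unfolding ricci_parallel_def
  by (rule tensor_parallel_conn_iff[OF L bounded_bilinear_ric[OF m_product_bilinear[OF L]] ricci_conn[OF L]])

lemma preferred_conn_base:
  assumes L: "m_product L" and p: "preferred (conn L)" and m: "x \<in> \<mm>" "y \<in> \<mm>" "z \<in> \<mm>"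
  shows "ric L (L x y) z + ric L y (L x z) + ric L (L z x) y + ric L x (L z y)
    + ric L (L y z) x + ric L z (L y x) = 0"
  using p[unfolded preferred_def, rule_format, of "gen x" "gen y" "gen z" "coset (mat 1)"] m
  by (simp add: cov_deriv_conn[OF L bounded_bilinear_ric[OF m_product_bilinear[OF L]] ricci_conn[OF L]]
      lift_gen m_part_id)

lemma ricci_parallel_imp_preferred: "ricci_parallel D \<Longrightarrow> preferred D"
  by (simp add: ricci_parallel_def tensor_parallel_def preferred_def)

section \<open>Coordinates on \<open>\<mm>\<close>\<close>

text \<open>Coordinates in the root spaces at positions (1,2), (2,3), (1,3). The third root is the
  sum of the first two, which governs the shape of all products below.\<close>

definition mk :: "complex \<Rightarrow> complex \<Rightarrow> complex \<Rightarrow> cmat" where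
  "mk a b c = (\<chi> i j. if i = 1 \<and> j = 2 then a else if i = 2 \<and> j = 1 then - cnj a
     else if i = 2 \<and> j = 3 then b else if i = 3 \<and> j = 2 then - cnj b
     else if i = 1 \<and> j = 3 then c else if i = 3 \<and> j = 1 then - cnj c else 0)"

lemma mk_nth [simp]:
  "mk a b c $ 1 $ 1 = 0" "mk a b c $ 1 $ 2 = a" "mk a b c $ 1 $ 3 = c"
  "mk a b c $ 2 $ 1 = - cnj a" "mk a b c $ 2 $ 2 = 0" "mk a b c $ 2 $ 3 = b"
  "mk a b c $ 3 $ 1 = - cnj c" "mk a b c $ 3 $ 2 = - cnj b" "mk a b c $ 3 $ 3 = 0"
  by (simp_all add: mk_def)

lemma mk_in_m [simp]: "mk a b c \<in> \<mm>"
  by (simp add: m_iff vec_eq_iff forall_3)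

lemma m_eq_mk: assumes "x \<in> \<mm>" shows "x = mk (x $ 1 $ 2) (x $ 2 $ 3) (x $ 1 $ 3)"
proof -
  have "cnj (x $ j $ i) = - x $ i $ j" for i j
    using assms ct_nth[of x i j] by (simp add: m_iff)
  from this[of 1 2] this[of 2 3] this[of 1 3] show ?thesis
    using assms by (simp add: m_iff vec_eq_iff forall_3)
qed

lemma mE: assumes "x \<in> \<mm>" obtains a b c where "x = mk a b c"
  using m_eq_mk[OF assms] by blast

lemma mk_eq_iff: "mk a b c = mk a' b' c' \<longleftrightarrow> a = a' \<and> b = b' \<and> c = c'"
  by (metis mk_nth(2,3,6))

lemma mk_add: "mk a b c + mk a' b' c' = mk (a + a') (b + b') (c + c')"
  and mk_diff: "mk a b c - mk a' b' c' = mk (a - a') (b - b') (c - c')"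
  and mk_scaleR: "r *\<^sub>R mk a b c = mk (of_real r * a) (of_real r * b) (of_real r * c)"
  by (simp_all add: vec_eq_iff forall_3 scaleR_mat_nth del: vector_scaleR_component)

lemma m_part_lie_mk: "m_part (lie (mk a b c) (mk a' b' c')) =
    mk (c' * cnj b - c * cnj b') (cnj a' * c - cnj a * c') (a * b' - a' * b)"
  by (simp add: vec_eq_iff forall_3 m_part_nth lie_def mm_nth sum_3 field_simps)

text \<open>A diagonal matrix acts on each root space by a scalar, the difference of two of its
  entries; here the matrix is the diagonal part of the bracket.\<close>

lemma lie_diag_mk: "lie (lie (mk a b c) (mk a' b' c') - m_part (lie (mk a b c) (mk a' b' c'))) (mk a'' b'' c'') =
    mk ((2 * (a' * cnj a - a * cnj a') + (c' * cnj c - c * cnj c') - (b' * cnj b - b * cnj b')) * a'')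
       ((2 * (b' * cnj b - b * cnj b') + (c' * cnj c - c * cnj c') - (a' * cnj a - a * cnj a')) * b'')
       ((2 * (c' * cnj c - c * cnj c') + (a' * cnj a - a * cnj a') + (b' * cnj b - b * cnj b')) * c'')"
  unfolding m_part_lie_mk
  by (simp add: vec_eq_iff forall_3 lie_def mm_nth sum_3 algebra_simps)

lemma omega_mk: "\<omega> (mk a b c) (mk a' b' c') = Im (4 * (cnj a * a') - 2 * (cnj b * b') + 2 * (cnj c * c'))"
  by (simp add: \<omega>_def trace_def lie_def mm_nth sum_3 X0_def algebra_simps)

text \<open>The weights 4, -2, 2 in \<open>omega_mk\<close> are nonzero, and testing with 1 and \<i>
  in each slot recovers imaginary and real parts.\<close>

lemma omega_nondegenerate:
  assumes "x \<in> \<mm>" "y \<in> \<mm>" "\<And>z. z \<in> \<mm> \<Longrightarrow> \<omega> x z = \<omega> y z" shows "x = y"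
proof -
  obtain a b c where x: "x = mk a b c" using mE[OF assms(1)] .
  obtain a' b' c' where y: "y = mk a' b' c'" using mE[OF assms(2)] .
  have "\<omega> x (mk u v w) = \<omega> y (mk u v w)" for u v w using assms(3) by simp
  from this[of 1 0 0] this[of \<i> 0 0] this[of 0 1 0] this[of 0 \<i> 0] this[of 0 0 1] this[of 0 0 \<i>]
  show ?thesis unfolding x y by (simp add: omega_mk mk_eq_iff complex_eq_iff)
qed

text \<open>The invariant torsion-free symplectic connections form a family with one complex
  parameter \<open>k\<close>: two of them differ by an invariant symmetric trilinear form on \<open>\<mm>\<close>, and these
  forms are the imaginary parts of multiples of \<open>cnj a * cnj b * c\<close>.\<close>

definition Lk :: "complex \<Rightarrow> cmat \<Rightarrow> cmat \<Rightarrow> cmat" where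
  "Lk k x y =
    (let a = x $ 1 $ 2; b = x $ 2 $ 3; c = x $ 1 $ 3; a' = y $ 1 $ 2; b' = y $ 2 $ 3; c' = y $ 1 $ 3 in
     mk ((cnj b * c' - c * cnj b') / 2 - k * (cnj b * c' + cnj b' * c) / 4)
        (c * cnj a' + k * (cnj a * c' + cnj a' * c) / 2)
        (- (b * a') + cnj k * (a * b' + a' * b) / 2))"

lemma Lk_mk: "Lk k (mk a b c) (mk a' b' c') =
     mk ((cnj b * c' - c * cnj b') / 2 - k * (cnj b * c' + cnj b' * c) / 4)
        (c * cnj a' + k * (cnj a * c' + cnj a' * c) / 2)
        (- (b * a') + cnj k * (a * b' + a' * b) / 2)"
  by (simp add: Lk_def)

lemma Adi_torus_mk:
  assumes "h \<in> torus"
  shows "Adi h (mk a b c) = mk (cnj (h $ 1 $ 1) * a * h $ 2 $ 2) (cnj (h $ 2 $ 2) * b * h $ 3 $ 3)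
    (cnj (h $ 1 $ 1) * c * h $ 3 $ 3)"
  by (simp add: vec_eq_iff forall_3 Adi_torus_nth[OF assms] mult.commute mult.left_commute)

lemma m_product_Lk: "m_product (Lk k)"
  unfolding m_product_def
proof (intro conjI ballI)
  show "bounded_bilinear (Lk k)"
    unfolding bilinear_conv_bounded_bilinear[symmetric] bilinear_def Lk_def Let_def
    by (auto intro!: linearI simp: mk_add mk_scaleR mk_eq_iff field_simps scaleR_mat_nth simp del: vector_scaleR_component)
  show "Lk k x y \<in> \<mm>" for x y by (simp add: Lk_def Let_def)
  fix h x y assume h: "h \<in> torus" and xy: "x \<in> \<mm>" "y \<in> \<mm>"
  obtain a b c where x: "x = mk a b c" using mE[OF xy(1)] .
  obtain a' b' c' where y: "y = mk a' b' c'" using mE[OF xy(2)] .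
  define u v w where "u = h $ 1 $ 1" and "v = h $ 2 $ 2" and "w = h $ 3 $ 3"
  have "cnj u * u = 1" "cnj v * v = 1" "cnj w * w = 1"
    using torus_norm[OF h] by (simp_all add: u_def v_def w_def)
  \<comment> \<open>Conjugates of torus entries become reciprocals, which turns equivariance into an
    identity of rational functions.\<close>
  then have n: "u \<noteq> 0" "v \<noteq> 0" "w \<noteq> 0" "cnj u = 1 / u" "cnj v = 1 / v" "cnj w = 1 / w"
    by (auto simp: eq_divide_eq)
  show "Lk k (Adi h x) (Adi h y) = Adi h (Lk k x y)"
    unfolding x y Lk_mk Adi_torus_mk[OF h] u_def[symmetric] v_def[symmetric] w_def[symmetric] mk_eq_iff
    by (simp add: n field_simps)
qed

lemma natural_product_Lk:
  assumes "x \<in> \<mm>" "y \<in> \<mm>" shows "natural_product x y = Lk 0 x y"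
  unfolding natural_product_def
proof (rule the_equality)
  obtain a b c where x: "x = mk a b c" using mE[OF assms(1)] .
  obtain a' b' c' where y: "y = mk a' b' c'" using mE[OF assms(2)] .
  have p: "proj_m (lie u v) = m_part (lie u v)" if "u \<in> \<mm>" "v \<in> \<mm>" for u v
    using that by (simp add: m_part_su3 lie_su3 m_su3)
  have "\<omega> (Lk 0 x y) z = 1/3 * \<omega> (proj_m (lie x y)) z + 1/3 * \<omega> (proj_m (lie x z)) y" if z: "z \<in> \<mm>" for z
  proof -
    obtain a'' b'' c'' where z': "z = mk a'' b'' c''" using mE[OF z] .
    show ?thesis
      unfolding p[OF assms] p[OF assms(1) z] unfolding x y z' Lk_mk m_part_lie_mk omega_mk
      by (simp add: field_simps)
  qed
  then show "Lk 0 x y \<in> \<mm> \<and> (\<forall>z\<in>\<mm>. \<omega> (Lk 0 x y) z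
      = 1/3 * \<omega> (proj_m (lie x y)) z + 1/3 * \<omega> (proj_m (lie x z)) y)"
    using m_product_m[OF m_product_Lk assms] by simp
  then show "u = Lk 0 x y" if "u \<in> \<mm> \<and> (\<forall>z\<in>\<mm>. \<omega> u z
      = 1/3 * \<omega> (proj_m (lie x y)) z + 1/3 * \<omega> (proj_m (lie x z)) y)" for u
    using that by (intro omega_nondegenerate) auto
qed

lemma natural_connection_conn: "natural_connection = conn (Lk 0)"
  by (rule natural_connection_eqI[OF m_product_Lk natural_product_Lk])

lemma Lk_torsion:
  assumes "x \<in> \<mm>" "y \<in> \<mm>" shows "Lk k x y - Lk k y x = m_part (lie x y)"
proof -
  obtain a b c where x: "x = mk a b c" using mE[OF assms(1)] .
  obtain a' b' c' where y: "y = mk a' b' c'" using mE[OF assms(2)] .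
  show ?thesis unfolding x y Lk_mk m_part_lie_mk mk_diff mk_eq_iff by (simp add: field_simps)
qed

text \<open>Under \<omega>, the \<open>k\<close>-terms are dual to the polarisation of Im
  (\<open>k * cnj a * cnj b * c\<close>), which is totally symmetric and so drops out of the torsion
  and of this identity. The denominators 4, 2, 2 of the \<open>k\<close>-terms come from division by
  the weights 4, -2, 2 of \<omega>.\<close>

lemma Lk_omega:
  assumes "x \<in> \<mm>" "y \<in> \<mm>" "z \<in> \<mm>" shows "\<omega> (Lk k x y) z + \<omega> y (Lk k x z) = 0"
proof -
  obtain a b c where x: "x = mk a b c" using mE[OF assms(1)] .
  obtain a' b' c' where y: "y = mk a' b' c'" using mE[OF assms(2)] .
  obtain a'' b'' c'' where z: "z = mk a'' b'' c''" using mE[OF assms(3)] .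
  show ?thesis unfolding x y z Lk_mk omega_mk by (simp add: field_simps)
qed

section \<open>The Ricci form of the family\<close>

lemma sum_Basis_vec:
  "(\<Sum>b\<in>(Basis :: ('a::euclidean_space ^ 'n) set). f b) = (\<Sum>i\<in>UNIV. \<Sum>u\<in>Basis. f (axis i u))"
proof -
  have "inj_on (\<lambda>(i, u). axis i u) (UNIV \<times> (Basis :: 'a set))"
    by (auto simp: inj_on_def axis_eq_axis)
  moreover have "(\<lambda>(i, u). axis i u) ` (UNIV \<times> (Basis :: 'a set)) = (Basis :: ('a ^ 'n) set)"
    by (auto simp: Basis_vec_def)
  ultimately show ?thesis
    using sum.reindex[of "\<lambda>(i, u). axis i u" "UNIV \<times> (Basis :: 'a set)" f]
    by (simp add: sum.cartesian_product o_def case_prod_unfold)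
qed

lemma m_part_axis:
  "m_part (axis 1 (axis 2 u)) = mk (u / 2) 0 0" "m_part (axis 2 (axis 1 u)) = mk (- cnj u / 2) 0 0"
  "m_part (axis 2 (axis 3 u)) = mk 0 (u / 2) 0" "m_part (axis 3 (axis 2 u)) = mk 0 (- cnj u / 2) 0"
  "m_part (axis 1 (axis 3 u)) = mk 0 0 (u / 2)" "m_part (axis 3 (axis 1 u)) = mk 0 0 (- cnj u / 2)"
  "m_part (axis i (axis i u)) = 0"
  by (auto simp: vec_eq_iff forall_3 m_part_nth axis_def)

lemma curv_m:
  assumes L: "m_product L" and m: "x \<in> \<mm>" "y \<in> \<mm>" "z \<in> \<mm>"
  shows "curv L x y z \<in> \<mm>"
proof -
  have "lie (lie x y - m_part (lie x y)) z \<in> \<mm>"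
    using mE[OF m(1)] mE[OF m(2)] mE[OF m(3)] by (metis lie_diag_mk mk_in_m)
  then show ?thesis
    unfolding curv_def by (intro subspace_diff[OF subspace_m] m_product_m[OF L] m m_part_in_m)
qed

text \<open>\<open>m_part\<close> splits an off-diagonal matrix unit evenly between two mirrored
  positions. The two units of a mirrored pair contribute equal halves, so the trace reduces to the
  vectors 1 and \<i> in the three coordinates.\<close>

lemma ric_eq:
  assumes L: "m_product L" and m: "x \<in> \<mm>" "y \<in> \<mm>"
  shows "ric L x y =
    Re (curv L x (mk 1 0 0) y $ 1 $ 2) + Im (curv L x (mk \<i> 0 0) y $ 1 $ 2) +
    Re (curv L x (mk 0 1 0) y $ 2 $ 3) + Im (curv L x (mk 0 \<i> 0) y $ 2 $ 3) +
    Re (curv L x (mk 0 0 1) y $ 1 $ 3) + Im (curv L x (mk 0 0 \<i>) y $ 1 $ 3)"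
proof -
  note lin = curv_linear(2)[OF m_product_bilinear[OF L]]
  have low: "curv L x (mk a b c) y $ 2 $ 1 = - cnj (curv L x (mk a b c) y $ 1 $ 2)"
    "curv L x (mk a b c) y $ 3 $ 2 = - cnj (curv L x (mk a b c) y $ 2 $ 3)"
    "curv L x (mk a b c) y $ 3 $ 1 = - cnj (curv L x (mk a b c) y $ 1 $ 3)" for a b c
    using m_eq_mk[OF curv_m[OF L m(1) mk_in_m m(2), of a b c]] by (metis mk_nth)+
  have s: "curv L x (mk (u / 2) 0 0) y = (1/2) *\<^sub>R curv L x (mk u 0 0) y"
    "curv L x (mk 0 (u / 2) 0) y = (1/2) *\<^sub>R curv L x (mk 0 u 0) y"
    "curv L x (mk 0 0 (u / 2)) y = (1/2) *\<^sub>R curv L x (mk 0 0 u) y"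
    "curv L x (mk (- (1 / 2)) 0 0) y = (-1/2) *\<^sub>R curv L x (mk 1 0 0) y"
    "curv L x (mk 0 (- (1 / 2)) 0) y = (-1/2) *\<^sub>R curv L x (mk 0 1 0) y"
    "curv L x (mk 0 0 (- (1 / 2))) y = (-1/2) *\<^sub>R curv L x (mk 0 0 1) y" for u
    by (simp_all add: linear_scale[OF lin, symmetric] mk_scaleR)
  show ?thesis
    unfolding ric_def sum_Basis_vec
    by (simp add: sum_3 Basis_complex_def m_part_axis linear_0[OF lin] s low inner_axis inner_complex_def
        del: linear_0)
qed

lemma curv_mk:
  "curv L (mk a b c) (mk a' b' c') (mk a'' b'' c'') =
    L (mk a b c) (L (mk a' b' c') (mk a'' b'' c'')) - L (mk a' b' c') (L (mk a b c) (mk a'' b'' c''))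
    - L (mk (c' * cnj b - c * cnj b') (cnj a' * c - cnj a * c') (a * b' - a' * b)) (mk a'' b'' c'')
    - mk ((2 * (a' * cnj a - a * cnj a') + (c' * cnj c - c * cnj c') - (b' * cnj b - b * cnj b')) * a'')
       ((2 * (b' * cnj b - b * cnj b') + (c' * cnj c - c * cnj c') - (a' * cnj a - a * cnj a')) * b'')
       ((2 * (c' * cnj c - c * cnj c') + (a' * cnj a - a * cnj a') + (b' * cnj b - b * cnj b')) * c'')"
  by (simp only: curv_def lie_diag_mk) (simp only: m_part_lie_mk)

text \<open>The diagonal shape reflects invariance: the three root spaces are inequivalent under the
  torus, and the symmetry of the Ricci tensor of a symplectic connection excludes imaginary parts.
  The coefficients result from expanding the six entries in \<open>ric_eq\<close>.\<close>

lemma ric_Lk: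
  "ric (Lk k) (mk a b c) (mk a' b' c') =
    ((cmod k)\<^sup>2 - 8) * Re (cnj a * a') - (4 + Re k + (cmod k)\<^sup>2 / 2) * Re (cnj b * b')
    - (4 - Re k + (cmod k)\<^sup>2 / 2) * Re (cnj c * c')"
  unfolding ric_eq[OF m_product_Lk mk_in_m mk_in_m] curv_mk Lk_mk mk_diff mk_nth cmod_power2
  by (simp add: field_simps power2_eq_square)

text \<open>Let J multiply the coordinates a, b, c by \<i>, -\<i>, \<i>. The product
  \<open>Lk 0 x y\<close> is J-linear in \<open>y\<close>, and the Ricci form at
  \<open>k = 0\<close> is twice \<omega>(J x, y), so it is parallel together with \<omega>. The
  direct computation below confirms this.\<close>

lemma ricci_parallel_Lk_zero: "ricci_parallel (conn (Lk 0))"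
  unfolding ricci_parallel_conn_iff[OF m_product_Lk]
proof (intro ballI)
  fix x y z assume m: "x \<in> \<mm>" "y \<in> \<mm>" "z \<in> \<mm>"
  obtain a b c where x: "x = mk a b c" using mE[OF m(1)] .
  obtain a' b' c' where y: "y = mk a' b' c'" using mE[OF m(2)] .
  obtain a'' b'' c'' where z: "z = mk a'' b'' c''" using mE[OF m(3)] .
  show "ric (Lk 0) (Lk 0 x y) z + ric (Lk 0) y (Lk 0 x z) = 0"
    unfolding x y z Lk_mk ric_Lk by (simp add: field_simps)
qed

text \<open>\<open>Lk k\<close> sends two vectors from different root spaces into the third, so one
  vector from each is tested. The cyclic sum is -(4 + 3/2 |k|^2) Re (k u) - 2 Re k Re u, where -2 Re
  k is the difference of the Ricci coefficients on the second and third coordinates;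
  \<open>u = 1\<close> and \<open>u = \<i>\<close> separate the parts of \<open>k\<close>.\<close>

lemma preferred_Lk_imp: assumes "preferred (conn (Lk k))" shows "k = 0"
proof -
  have p: "ric (Lk k) (Lk k x y) z + ric (Lk k) y (Lk k x z) + ric (Lk k) (Lk k z x) y
      + ric (Lk k) x (Lk k z y) + ric (Lk k) (Lk k y z) x + ric (Lk k) z (Lk k y x) = 0"
    if "x = mk 1 0 0" "y = mk 0 1 0" "z = mk 0 0 u" for x y z u
    using preferred_conn_base[OF m_product_Lk assms] that by simp
  from p[OF refl refl refl, of 1] have "Re k * (6 + 3/2 * (cmod k)\<^sup>2) = 0"
    unfolding Lk_mk ric_Lk by (simp add: algebra_simps add_divide_distrib diff_divide_distrib)
  moreover from p[OF refl refl refl, of \<i>] have "Im k * (4 + 3/2 * (cmod k)\<^sup>2) = 0"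
    unfolding Lk_mk ric_Lk by (simp add: algebra_simps add_divide_distrib diff_divide_distrib)
  moreover have "6 + 3/2 * (cmod k)\<^sup>2 > 0" "4 + 3/2 * (cmod k)\<^sup>2 > 0"
    by (simp_all add: add_pos_nonneg)
  ultimately show ?thesis by (simp add: complex_eq_iff)
qed

section \<open>Classification of the invariant symplectic connections\<close>

definition h1 :: cmat where
  "h1 = (\<chi> i j. if i = j then (if i = 3 then -1 else \<i>) else 0)"

definition h2 :: cmat where
  "h2 = (\<chi> i j. if i = j then (if i = 1 then -1 else \<i>) else 0)"

lemma h_torus: "h1 \<in> torus" "h2 \<in> torus"
  by (simp_all add: torus_def SU3_def h1_def h2_def vec_eq_iff forall_3 mm_nth sum_3 mat_def det_3)

text \<open>Each element fixes one simple root space and turns the other two coordinates by a common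
  primitive fourth root of unity. Its square changes their signs.\<close>

lemma Adi_h_mk: "Adi h1 (mk a b c) = mk a (\<i> * b) (\<i> * c)" "Adi h2 (mk a b c) = mk (- \<i> * a) b (- \<i> * c)"
  unfolding Adi_torus_mk[OF h_torus(1)] Adi_torus_mk[OF h_torus(2)] mk_eq_iff by (simp_all add: h1_def h2_def complex_eq_iff)


lemma omega_antisym: "\<omega> x y = - \<omega> y x"
proof -
  have "lie y x = - lie x y" by (simp add: lie_def)
  then have "\<omega> x y = Re (trace (- (X0 ** lie x y)))" by (simp add: \<omega>_def mm_simps)
  then show ?thesis by (simp add: \<omega>_def trace_def sum_negf)
qed

text \<open>Through \<omega>, the difference from \<open>Lk k\<close> is a trilinear form \<delta>.
  Equal torsion makes it symmetric in the first two slots, the condition on \<omega> in the last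
  two, so it is totally symmetric. Torus invariance leaves one complex number undetermined, and
  \<open>k\<close> is chosen to match it.\<close>

lemma invariant_symplectic_product:
  assumes L: "m_product L"
    and torsion: "\<And>x y. x \<in> \<mm> \<Longrightarrow> y \<in> \<mm> \<Longrightarrow> L x y - L y x = m_part (lie x y)"
    and omega: "\<And>x y z. x \<in> \<mm> \<Longrightarrow> y \<in> \<mm> \<Longrightarrow> z \<in> \<mm> \<Longrightarrow> \<omega> (L x y) z + \<omega> y (L x z) = 0"
  obtains k where "\<And>x y. x \<in> \<mm> \<Longrightarrow> y \<in> \<mm> \<Longrightarrow> L x y = Lk k x y"
proof -
  interpret L: bounded_bilinear L by (rule m_product_bilinear[OF L])
  interpret \<omega>: bounded_bilinear \<omega> by (rule bounded_bilinear_omega)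
  define A B C where "A u = mk u 0 0" and "B u = mk 0 u 0" and "C u = mk 0 0 u" for u
  \<comment> \<open>\<omega> pairs \<open>Lk k (A 1) (B 1)\<close> with \<open>C u\<close> to Im (k
    u), so \<open>u = \<i>\<close> reads off the real part of \<open>k\<close> and
    \<open>u = 1\<close> the imaginary part.\<close>
  define k where "k = Complex (\<omega> (L (A 1) (B 1)) (C \<i>)) (\<omega> (L (A 1) (B 1)) (C 1))"
  interpret K: bounded_bilinear "Lk k" by (rule m_product_bilinear[OF m_product_Lk])
  define \<delta> where "\<delta> x y z = \<omega> (L x y - Lk k x y) z" for x y z
  have \<delta>_lin: "\<delta> (x + x') y z = \<delta> x y z + \<delta> x' y z" "\<delta> x (y + y') z = \<delta> x y z + \<delta> x y' z"
    "\<delta> x y (z + z') = \<delta> x y z + \<delta> x y z'" "\<delta> (- x) y z = - \<delta> x y z" "\<delta> x (- y) z = - \<delta> x y z"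
    "\<delta> x y (- z) = - \<delta> x y z" "\<delta> (r *\<^sub>R x) y z = r * \<delta> x y z" "\<delta> x (r *\<^sub>R y) z = r * \<delta> x y z"
    "\<delta> x y (r *\<^sub>R z) = r * \<delta> x y z" for x x' y y' z z' r
    by (simp_all add: \<delta>_def L.add_left L.add_right K.add_left K.add_right L.minus_left L.minus_right
        K.minus_left K.minus_right L.scaleR_left L.scaleR_right K.scaleR_left K.scaleR_right
        \<omega>.add_left \<omega>.add_right \<omega>.diff_left \<omega>.minus_left \<omega>.minus_right \<omega>.scaleR_left \<omega>.scaleR_right
        right_diff_distrib)
  have s12: "\<delta> x y z = \<delta> y x z" if "x \<in> \<mm>" "y \<in> \<mm>" for x y z
  proof -
    have "L x y - Lk k x y = L y x - Lk k y x"
      using torsion[OF that] Lk_torsion[OF that, of k] by (simp add: algebra_simps)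
    then show ?thesis by (simp add: \<delta>_def)
  qed
  have s23: "\<delta> x y z = \<delta> x z y" if "x \<in> \<mm>" "y \<in> \<mm>" "z \<in> \<mm>" for x y z
    using omega[OF that] Lk_omega[OF that, of k] omega_antisym[of y "L x z"] omega_antisym[of y "Lk k x z"]
    by (simp add: \<delta>_def \<omega>.diff_left)
  have inv: "\<delta> (Adi h x) (Adi h y) (Adi h z) = \<delta> x y z" if "h \<in> torus" "x \<in> \<mm>" "y \<in> \<mm>" for h x y z
    using L m_product_Lk[of k] that omega_torus[OF that(1)]
    by (simp add: \<delta>_def m_product_def Adi_simps(2)[symmetric])
  have m [simp]: "A u \<in> \<mm>" "B u \<in> \<mm>" "C u \<in> \<mm>" for u
    by (simp_all add: A_def B_def C_def)
  have neg: "A (- u) = - A u" "B (- u) = - B u" "C (- u) = - C u" for u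
    using mk_scaleR[of "-1"] by (simp_all add: A_def B_def C_def)
  have ad: "Adi h1 (A u) = A u" "Adi h1 (B u) = B (\<i> * u)" "Adi h1 (C u) = C (\<i> * u)"
    "Adi h2 (A u) = A (- \<i> * u)" "Adi h2 (B u) = B u" "Adi h2 (C u) = C (- \<i> * u)" for u
    by (simp_all add: A_def B_def C_def Adi_h_mk)
  have sq: "Adi h1 (Adi h1 (A u)) = A u" "Adi h1 (Adi h1 (B u)) = - B u" "Adi h1 (Adi h1 (C u)) = - C u"
    "Adi h2 (Adi h2 (A u)) = - A u" "Adi h2 (Adi h2 (B u)) = B u" "Adi h2 (Adi h2 (C u)) = - C u" for u
    by (simp_all add: ad neg Adi_simps)
  have q: "\<delta> (Adi h (Adi h x)) (Adi h (Adi h y)) (Adi h (Adi h z)) = \<delta> x y z"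
    if "h \<in> torus" "x \<in> \<mm>" "y \<in> \<mm>" for h x y z
    using inv that Adi_m by simp
  note q1 = q[OF h_torus(1)] and q2 = q[OF h_torus(2)]
  \<comment> \<open>In each case the square of \<open>h1\<close> or \<open>h2\<close> changes the
    sign of an odd number of arguments, so the value equals its own negative.\<close>
  have z: "\<delta> (A u) (A v) (A w) = 0" "\<delta> (A u) (A v) (B w) = 0" "\<delta> (A u) (A v) (C w) = 0"
    "\<delta> (A u) (B v) (B w) = 0" "\<delta> (A u) (C v) (C w) = 0" "\<delta> (B u) (B v) (B w) = 0"
    "\<delta> (B u) (B v) (C w) = 0" "\<delta> (B u) (C v) (C w) = 0" "\<delta> (C u) (C v) (C w) = 0" for u v w
    using q2[of "A u" "A v" "A w"] q1[of "A u" "A v" "B w"] q1[of "A u" "A v" "C w"]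
      q2[of "A u" "B v" "B w"] q2[of "A u" "C v" "C w"] q1[of "B u" "B v" "B w"]
      q2[of "B u" "B v" "C w"] q1[of "B u" "C v" "C w"] q1[of "C u" "C v" "C w"]
    by (simp_all add: sq \<delta>_lin)
  have split: "A u = Re u *\<^sub>R A 1 + Im u *\<^sub>R A \<i>" "B u = Re u *\<^sub>R B 1 + Im u *\<^sub>R B \<i>"
    "C u = Re u *\<^sub>R C 1 + Im u *\<^sub>R C \<i>" for u
    by (simp_all add: A_def B_def C_def mk_scaleR mk_add mk_eq_iff complex_eq_iff)
  have zABC: "\<delta> (A u) (B v) (C w) = 0" for u v w
  proof -
    have "\<delta> (A 1) (B 1) (C u) = 0" if "u = 1 \<or> u = \<i>" for u
    proof -
      have "\<omega> (Lk k (A 1) (B 1)) (C u) = \<omega> (L (A 1) (B 1)) (C u)"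
        using that unfolding A_def B_def C_def Lk_mk omega_mk by (auto simp: k_def A_def B_def C_def)
      then show ?thesis by (simp add: \<delta>_def \<omega>.diff_left)
    qed
    then have 1: "\<delta> (A 1) (B 1) (C w) = 0" for w
      by (subst split(3)) (simp add: \<delta>_lin)
    \<comment> \<open>\<open>h1\<close> turns \<open>B 1\<close> into \<open>B \<i>\<close>; the
      change is compensated in the third slot, which already ranges over all \<open>C w\<close>.
      Below, \<open>h2\<close> does the same for the first slot.\<close>
    have "\<delta> (A 1) (B \<i>) (C w) = 0" for w
      using inv[OF h_torus(1), of "A 1" "B 1" "C (- \<i> * w)"] 1 by (simp add: ad)
    then have 2: "\<delta> (A 1) (B v) (C w) = 0" for v w
      by (subst split(2)) (simp add: \<delta>_lin 1)
    have "\<delta> (A \<i>) (B v) (C w) = 0" for v w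
      using inv[OF h_torus(2), of "A 1" "B v" "C (\<i> * w)"] 2 by (simp add: ad neg \<delta>_lin)
    then show ?thesis by (subst split(1)) (simp add: \<delta>_lin 2)
  qed
  have sort: "\<delta> (B u) (A v) x = \<delta> (A v) (B u) x" "\<delta> (C u) (A v) x = \<delta> (A v) (C u) x"
    "\<delta> (C u) (B v) x = \<delta> (B v) (C u) x" for u v x
    by (simp_all add: s12)
  have sort': "\<delta> x (B u) (A v) = \<delta> x (A v) (B u)" "\<delta> x (C u) (A v) = \<delta> x (A v) (C u)"
    "\<delta> x (C u) (B v) = \<delta> x (B v) (C u)" if "x \<in> \<mm>" for u v x
    using that by (simp_all add: s23)
  have abc: "x = A (x $ 1 $ 2) + B (x $ 2 $ 3) + C (x $ 1 $ 3)" if "x \<in> \<mm>" for x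
    using m_eq_mk[OF that] by (simp add: A_def B_def C_def mk_add)
  \<comment> \<open>Multilinear expansion into 27 terms; \<open>sort\<close> and
    \<open>sort'\<close> put the arguments in the order \<open>A\<close>, \<open>B\<close>,
    \<open>C\<close>, where \<open>z\<close> and \<open>zABC\<close> apply.\<close>
  have \<delta>0: "\<delta> x y z = 0" if "x \<in> \<mm>" "y \<in> \<mm>" "z \<in> \<mm>" for x y z
    by (subst abc[OF that(1)], subst abc[OF that(2)], subst abc[OF that(3)])
      (simp add: \<delta>_lin sort sort' z zABC)
  have "L x y = Lk k x y" if "x \<in> \<mm>" "y \<in> \<mm>" for x y
    by (rule omega_nondegenerate[OF m_product_m[OF L that] m_product_m[OF m_product_Lk that]])
      (use \<delta>0[OF that] in \<open>simp add: \<delta>_def \<omega>.diff_left\<close>)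
  then show ?thesis by (rule that)
qed

theorem theorem1p4:
  shows "(\<forall>D. invariant_preferred_symplectic_connection D \<longleftrightarrow> D = natural_connection) \<and>
    ricci_parallel natural_connection"
proof (intro conjI allI iffI)
  show "ricci_parallel natural_connection"
    unfolding natural_connection_conn by (rule ricci_parallel_Lk_zero)
  fix D
  show "D = natural_connection" if D: "invariant_preferred_symplectic_connection D"
  proof -
    have i: "invariant_connection D" and s: "symplectic_connection D" and p: "preferred D"
      using D by (auto simp: invariant_preferred_symplectic_connection_def)
    obtain L where L: "m_product L" and DL: "D = conn L"
      using invariant_connection_conn_ex[OF i] .
    obtain k where k: "\<And>x y. x \<in> \<mm> \<Longrightarrow> y \<in> \<mm> \<Longrightarrow> L x y = Lk k x y"
      by (rule invariant_symplectic_product[OF L]) (use s[unfolded DL symplectic_conn_iff[OF L]] in auto)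
    have Dk: "D = conn (Lk k)"
      unfolding DL by (rule conn_cong[OF k L m_product_Lk])
    with p have "k = 0" using preferred_Lk_imp by simp
    then show ?thesis using Dk by (simp add: natural_connection_conn)
  qed
  show "invariant_preferred_symplectic_connection D" if "D = natural_connection"
    unfolding that natural_connection_conn invariant_preferred_symplectic_connection_def
      symplectic_conn_iff[OF m_product_Lk]
    using invariant_connection_conn[OF m_product_Lk] Lk_torsion Lk_omega
      ricci_parallel_imp_preferred[OF ricci_parallel_Lk_zero] by blast
qed

end
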